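(* Let assumptions (A1)–(A4), (B) and (C) of the context hold, let $\widetilde\lambda:=\lambda(1+\ell_c)^2$, $\widehat\lambda:=\lambda(1+\widehat\ell_c)^2$, and let $\rho>\ell_\varphi L_c+\max\{\widehat\lambda,\widetilde\lambda\}$. In the L-SPL algorithm described in the context, let $$\alpha_t=\alpha_0(t+1)^b,\qquad m_t=\lceil m_0(t+1)^j\rceil,\qquad n_t=\lceil n_0(t+1)^k\rceil,$$ where $\alpha_0>\rho+\ell_\varphi L_c$, $m_0,n_0$ are positive integers and $b,j,k\ge0$. Let $\nu,\delta>0$ and $\widetilde\nu:=\min\{\delta,\nu/\rho\}$. Then for any $b\in[0,\tfrac12]$, by minimizing the bound derived from the nonasymptotic guarantee (G) of the context, the choices $$j^*(b):=1-2b,\qquad k^*(b):=\frac{1-b}{2r}$$ attain the tightest sample complexity $\widetilde O\big(\widetilde\nu^{-\frac{2}{1-b}-\frac1r}\big)$ and the corresponding iteration complexity $\widetilde O\big(\widetilde\nu^{-\frac{2}{1-b}}\big)$ for obtaining a $(\nu,\delta)$-NSE solution $z^{t^*}$ by the L-SPL algorithm. (Here "tightest" refers, for the fixed $b$, to the choice of the sample size growth rates $j,k\ge0$, comparing the orders of the sample complexity upper bounds that (G) yields.)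
   Context: $\|\cdot\|$ is the Euclidean norm for vectors and the induced operator norm for matrices; $[n]=\{1,\dots,n\}$. $\nabla c(z)\in\mathbb R^{\ell\times d}$ is the Jacobian of $c$ at $z$. $\widetilde O(\cdot)$ is $O(\cdot)$ with logarithmic factors suppressed. A function $\phi$ on an open convex set is $\lambda$-weakly convex if $\phi(\cdot)+\frac{\lambda}{2}\|\cdot\|^2$ is convex there. $\partial f$ is the Clarke subdifferential and $\mathcal N_{\mathcal X}(y)$ the normal cone to $\mathcal X$ at $y$. Assumptions: (A1) $\mathcal X\subseteq\mathbb R^d$ is nonempty, closed, convex, and contained in an open convex set $\mathcal O\subseteq\mathbb R^d$ on which the relevant functions are defined. (A2) $\varphi:\mathcal O\times\mathbb R^\ell\to\mathbb R$ is $\lambda$-weakly convex and $\ell_\varphi$-Lipschitz continuous. (A3) For a decision $x$, $\xi=c(x)+\varepsilon$, where the random vector $\varepsilon\in\mathbb R^\ell$ is independent of $x$, $\mathbb E[\varepsilon]=0$, $\mathbb E\|\varepsilon\|^2<\infty$. $\mathbb P_\xi(x)$ denotes the law of $c(x)+\varepsilon$. (A4) $c:\mathcal O\to\mathbb R^\ell$ is $\ell_c$-Lipschitz and $C^1$-smooth with $L_c$-Lipschitz Jacobian. Problem: minimize $f(x):=\mathbb E[\varphi(x,c(x)+\varepsilon)]$ over $x\in\mathcal X$. For $x\in\mathbb R^d$: $f_{1/\rho}(x):=\inf_{y\in\mathcal X}\{f(y)+\frac\rho2\|y-x\|^2\}$ and $\operatorname{prox}_{f/\rho}(x):=\operatorname{argmin}_{y\in\mathcal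 X}\{f(y)+\frac\rho2\|y-x\|^2\}$. A random point $x$ is $(\nu,\delta)$-nearly stationary in expectation (NSE) for this problem if $x\in\mathcal X$ a.s. and there is a random point $y$ with $y\in\mathcal X$ a.s., $\mathbb E\|x-y\|\le\delta$ and $\mathbb E[\operatorname{dist}(0,\partial f(y)+\mathcal N_{\mathcal X}(y))]\le\nu$. A sufficient condition for $z^{t^*}$ to be $(\nu,\delta)$-NSE is $\mathbb E\|z^{t^*}-\operatorname{prox}_{f/\rho}(z^{t^*})\|\le\widetilde\nu=\min\{\delta,\nu/\rho\}$; the complexities are those needed to make this quantity $O(\widetilde\nu)$. Jacobian estimation. For $z\in\mathcal X$ and $n\ge1$, a data set $S_n=\{(X_i,\xi_i)\}_{i\in[n]}$ is generated by a random design: $X_1,\dots,X_n$ are i.i.d. from either a fixed density whose support contains $\mathcal X$ (static design) or the density $h_n^{-d}\widetilde g((\cdot-z)/h_n)$ with $\widetilde g$ an even probability density on $\mathbb R^d$ and $h_n>0$ (adaptive design), and $\xi_i$ is drawn independently from $\mathbb P_\xi(X_i)$ conditional on $X_i$. From $S_n$ one computes an estimate $\widehat\nabla c_n(z)\in\mathbb R^{\ell\times d}$ of $\nabla c(z)$. Define $e_1(n):=\sup_{z\in\mathcal X}\sqrt{\mathbb E[\|\widehat\nabla c_n(z)-\nabla c(z)\|^2]}$. (B) There is a scalar $\widehat\ell_c$ with $\|\widehat\nabla c_n(z)\|\le\widehat\ell_c$ almost surely for all $z\in\mathcal X$, $n\ge1$. (C) There are constants $r\in(0,\frac12)$ and $C_e>0$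 with $e_1(n)\le C_en^{-r}$ for all $n\ge1$. L-SPL algorithm. Given $z^0\in\mathcal X$, $T$, sample sizes $m_t,n_t$ and proximal parameters $\alpha_t>\rho+\ell_\varphi L_c$, for $t=0,\dots,T$: draw fresh i.i.d. samples $W^t_{m_t}=\{\eta^t_i\}_{i\in[m_t]}$ from $\mathbb P_\xi(z^t)$ and a fresh data set $S^t_{n_t}$ from the chosen random design with $z=z^t$, $n=n_t$; form the estimate $\widehat\nabla c^t_{n_t}(z^t)$ of $\nabla c(z^t)$ from $S^t_{n_t}$; set $$z^{t+1}:=\operatorname*{argmin}_{z\in\mathcal X}\Big\{\frac1{m_t}\sum_{i\in[m_t]}\varphi\big(z,\eta^t_i+\widehat\nabla c^t_{n_t}(z^t)(z-z^t)\big)+\frac{\alpha_t}2\|z-z^t\|^2\Big\}.$$ Output $z^{t^*}$, where $t^*\in\{0,\dots,T\}$ is sampled with $\mathbb P(t^*=t)\propto\frac{1}{\alpha_t+\rho-\tau}$ and $\tau:=\ell_\varphi L_c+\widehat\lambda+\widetilde\lambda$. The iteration complexity is the order of $T$ and the sample complexity the order of $\sum_{t=0}^T(m_t+n_t)$. Nonasymptotic guarantee (G) (a known result for the algorithm under (A1)–(A4), (B), with $\Delta_0:=f_{1/\rho}(z^0)-\min_{z\in\mathcal X}f(z)$): $$\mathbb E\|\operatorname{prox}_{f/\rho}(z^{t^*})-z^{t^*}\|\le\sqrt{\frac{4\Delta_0+\sum_{t=0}^T\frac{\rho}{\alpha_t+\rho-\tau}\left[\frac{8\ell_\varphi^2(1+\widehat\ell_c)^2}{m_t(\alpha_t-\widehat\lambda)}+\frac{4\ell_\varphi^2e_1^2(n_t)}{2\rho-\ell_\varphi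 L_c-\tau}+\frac{2\ell_\varphi^2e_1^2(n_t)}{\alpha_t-\rho-\ell_\varphi L_c}\right]}{\sum_{t=0}^T\frac{\rho(2\rho-\ell_\varphi L_c-\tau)}{\alpha_t+\rho-\tau}}}.$$ Under (C), the bound derived from (G) is, in order, $$O\left(\sqrt{\frac{1+\sum_{t=0}^T\big(\frac1{m_t\alpha_t^2}+\frac1{n_t^{2r}\alpha_t}+\frac1{n_t^{2r}\alpha_t^2}\big)}{\sum_{t=0}^T\frac1{\alpha_t}}}\right).$$ *)

theory Defs
  imports
    "HOL-Analysis.Analysis"
    "HOL-Probability.Probability"
    "HOL-Library.Landau_Symbols"
begin

section \<open>Weak convexity, Clarke subdifferential, normal cone, Moreau envelope\<close>

definition weakly_convex_on :: "real \<Rightarrow> 'a::real_inner set \<Rightarrow> ('a \<Rightarrow> real) \<Rightarrow> bool" where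
  "weakly_convex_on lam S f \<longleftrightarrow> convex_on S (\<lambda>x. f x + lam / 2 * (norm x)\<^sup>2)"

definition clarke_derivative :: "('a::real_inner \<Rightarrow> real) \<Rightarrow> 'a \<Rightarrow> 'a \<Rightarrow> ereal" where
  "clarke_derivative f y v =
     Limsup (nhds y \<times>\<^sub>F at_right (0::real)) (\<lambda>(x, s). ereal ((f (x + s *\<^sub>R v) - f x) / s))"

definition clarke_subdifferential :: "('a::real_inner \<Rightarrow> real) \<Rightarrow> 'a \<Rightarrow> 'a set" where
  "clarke_subdifferential f y = {g. \<forall>v. ereal (g \<bullet> v) \<le> clarke_derivative f y v}"

definition normal_cone :: "'a::real_inner set \<Rightarrow> 'a \<Rightarrow> 'a set" where
  "normal_cone X y = (if y \<in> X then {g. \<forall>x\<in>X. g \<bullet> (x - y) \<le> 0} else {})"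

text \<open>
  The distance from the origin to the set of sums. It is an infimum in the extended
  nonnegative reals, so that the distance to an empty set is infinite (\<^const>\<open>infdist\<close>
  would give zero).
\<close>

definition stationarity_gap :: "'a::real_inner set \<Rightarrow> ('a \<Rightarrow> real) \<Rightarrow> 'a \<Rightarrow> ennreal" where
  "stationarity_gap X f y =
     (INF g \<in> {u + v |u v. u \<in> clarke_subdifferential f y \<and> v \<in> normal_cone X y}. ennreal (norm g))"

definition moreau_envelope :: "'a::real_inner set \<Rightarrow> ('a \<Rightarrow> real) \<Rightarrow> real \<Rightarrow> 'a \<Rightarrow> real" where
  "moreau_envelope X f rho x = (INF y\<in>X. f y + rho / 2 * (norm (y - x))\<^sup>2)"

definition prox_point :: "'a::real_inner set \<Rightarrow> ('a \<Rightarrow> real) \<Rightarrow> real \<Rightarrow> 'a \<Rightarrow> 'a" where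
  "prox_point X f rho x = arg_min_on (\<lambda>y. f y + rho / 2 * (norm (y - x))\<^sup>2) X"

text \<open>
  Expectations of nonnegative quantities are taken as extended nonnegative integrals, so
  that a bound on an expectation includes its finiteness.
\<close>

definition nearly_stationary ::
  "'w measure \<Rightarrow> 'a::euclidean_space set \<Rightarrow> ('a \<Rightarrow> real) \<Rightarrow> real \<Rightarrow> real \<Rightarrow> ('w \<Rightarrow> 'a) \<Rightarrow> bool" where
  "nearly_stationary M X f nu delta x \<longleftrightarrow>
     x \<in> borel_measurable M \<and> (AE \<omega> in M. x \<omega> \<in> X) \<and>
     (\<exists>y \<in> borel_measurable M. (AE \<omega> in M. y \<omega> \<in> X) \<and>
        (\<integral>\<^sup>+\<omega>. ennreal (norm (x \<omega> - y \<omega>)) \<partial>M) \<le> ennreal delta \<and>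
        (\<integral>\<^sup>+\<omega>. stationarity_gap X f (y \<omega>) \<partial>M) \<le> ennreal nu)"

section \<open>Decision-dependent problem and random designs\<close>

text \<open>The operator norm induced by the Euclidean norms; \<^const>\<open>norm\<close> on matrices is Frobenius.\<close>

definition opnorm :: "real^'d^'l \<Rightarrow> real" where
  "opnorm A = onorm (\<lambda>x. A *v x)"

definition outcome_law :: "(real^'d \<Rightarrow> real^'l) \<Rightarrow> (real^'l) measure \<Rightarrow> real^'d \<Rightarrow> (real^'l) measure" where
  "outcome_law c N x = distr N borel (\<lambda>e. c x + e)"

definition objective ::
  "((real^'d) \<times> (real^'l) \<Rightarrow> real) \<Rightarrow> (real^'d \<Rightarrow> real^'l) \<Rightarrow> (real^'l) measure \<Rightarrow> real^'d \<Rightarrow> real" where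
  "objective phi c N x = (\<integral>e. phi (x, c x + e) \<partial>N)"

definition prob_density :: "('a::euclidean_space \<Rightarrow> real) \<Rightarrow> bool" where
  "prob_density p \<longleftrightarrow> p \<in> borel_measurable borel \<and> (\<forall>x. 0 \<le> p x) \<and> (\<integral>\<^sup>+x. ennreal (p x) \<partial>lborel) = 1"

definition density_support :: "('a::euclidean_space \<Rightarrow> real) \<Rightarrow> 'a set" where
  "density_support p =
     {x. \<forall>U. open U \<and> x \<in> U \<longrightarrow> 0 < emeasure (density lborel (\<lambda>y. ennreal (p y))) U}"

text \<open>
  A static design is given by its density, an adaptive one by the even density on the
  whole space and the bandwidths \<open>h n\<close>.
\<close>

datatype 'a design = Static "'a \<Rightarrow> real" | Adaptive "'a \<Rightarrow> real" "nat \<Rightarrow> real"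

fun valid_design :: "'a::euclidean_space set \<Rightarrow> 'a design \<Rightarrow> bool" where
  "valid_design X (Static p) \<longleftrightarrow> prob_density p \<and> X \<subseteq> density_support p"
| "valid_design X (Adaptive g h) \<longleftrightarrow> prob_density g \<and> (\<forall>x. g (- x) = g x) \<and> (\<forall>n\<ge>1. 0 < h n)"

fun design_law :: "'a::euclidean_space design \<Rightarrow> nat \<Rightarrow> 'a \<Rightarrow> 'a measure" where
  "design_law (Static p) n z = density lborel (\<lambda>x. ennreal (p x))"
| "design_law (Adaptive g h) n z =
     density lborel (\<lambda>x. ennreal ((1 / h n) ^ DIM('a) * g ((1 / h n) *\<^sub>R (x - z))))"

definition observation_law ::
  "(real^'d \<Rightarrow> real^'l) \<Rightarrow> (real^'l) measure \<Rightarrow> (real^'d) design \<Rightarrow> nat \<Rightarrow> real^'d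
     \<Rightarrow> ((real^'d) \<times> (real^'l)) measure" where
  "observation_law c N D n z =
     distr (design_law D n z \<Otimes>\<^sub>M N) (borel \<Otimes>\<^sub>M borel) (\<lambda>(x, e). (x, c x + e))"

definition dataset_law ::
  "(real^'d \<Rightarrow> real^'l) \<Rightarrow> (real^'l) measure \<Rightarrow> (real^'d) design \<Rightarrow> nat \<Rightarrow> real^'d
     \<Rightarrow> (nat \<Rightarrow> (real^'d) \<times> (real^'l)) measure" where
  "dataset_law c N D n z = Pi\<^sub>M {..<n} (\<lambda>_. observation_law c N D n z)"

definition sample_law ::
  "(real^'d \<Rightarrow> real^'l) \<Rightarrow> (real^'l) measure \<Rightarrow> nat \<Rightarrow> real^'d \<Rightarrow> (nat \<Rightarrow> real^'l) measure" where
  "sample_law c N m z = Pi\<^sub>M {..<m} (\<lambda>_. outcome_law c N z)"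

text \<open>
  A Jacobian estimator \<open>est n z S\<close> maps the sample size, the current point and a data set
  of that size to a matrix.
\<close>

type_synonym ('d, 'l) estimator =
  "nat \<Rightarrow> real^'d \<Rightarrow> (nat \<Rightarrow> (real^'d) \<times> (real^'l)) \<Rightarrow> real^'d^'l"

definition measurable_estimator :: "('d::finite, 'l::finite) estimator \<Rightarrow> bool" where
  "measurable_estimator est \<longleftrightarrow>
     (\<forall>n\<ge>1. (\<lambda>(z, S). est n z S)
        \<in> borel_measurable (borel \<Otimes>\<^sub>M Pi\<^sub>M {..<n} (\<lambda>_. borel \<Otimes>\<^sub>M borel)))"

definition estimation_error ::
  "(real^'d) set \<Rightarrow> (real^'d \<Rightarrow> real^'l) \<Rightarrow> (real^'l) measure \<Rightarrow> (real^'d) design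
     \<Rightarrow> ('d::finite, 'l::finite) estimator \<Rightarrow> nat \<Rightarrow> real" where
  "estimation_error X c N D est n =
     (SUP z\<in>X. sqrt (\<integral>S. (opnorm (est n z S - jacobian c (at z)))\<^sup>2 \<partial>dataset_law c N D n z))"

section \<open>The algorithm\<close>

definition spl_model ::
  "((real^'d) \<times> (real^'l) \<Rightarrow> real) \<Rightarrow> nat \<Rightarrow> real \<Rightarrow> real^'d \<Rightarrow> (nat \<Rightarrow> real^'l) \<Rightarrow> real^'d^'l
     \<Rightarrow> real^'d \<Rightarrow> real" where
  "spl_model phi m a z W A y =
     (\<Sum>i<m. phi (y, W i + A *v (y - z))) / real m + a / 2 * (norm (y - z))\<^sup>2"

text \<open>
  A run with iterations \<open>0, \<dots>, T\<close> on the probability space \<open>M\<close>: \<open>F t\<close> is the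
  information available when \<open>z t\<close> has been computed. The freshness condition says that,
  conditionally on \<open>F t\<close>, the pair \<open>(W t, S t)\<close> has the product law
  \<open>sample_law c N (m t) (z t) \<otimes> dataset_law c N D (n t) (z t)\<close>.
\<close>

definition lspl_run ::
  "'w measure \<Rightarrow> (nat \<Rightarrow> 'w measure) \<Rightarrow> (real^'d) set \<Rightarrow> ((real^'d) \<times> (real^'l) \<Rightarrow> real)
    \<Rightarrow> (real^'d \<Rightarrow> real^'l) \<Rightarrow> (real^'l) measure \<Rightarrow> (real^'d) design \<Rightarrow> ('d::finite, 'l::finite) estimator
    \<Rightarrow> (nat \<Rightarrow> real) \<Rightarrow> (nat \<Rightarrow> nat) \<Rightarrow> (nat \<Rightarrow> nat) \<Rightarrow> real^'d \<Rightarrow> nat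
    \<Rightarrow> (nat \<Rightarrow> 'w \<Rightarrow> nat \<Rightarrow> real^'l) \<Rightarrow> (nat \<Rightarrow> 'w \<Rightarrow> nat \<Rightarrow> (real^'d) \<times> (real^'l))
    \<Rightarrow> (nat \<Rightarrow> 'w \<Rightarrow> real^'d) \<Rightarrow> bool" where
  "lspl_run M F X phi c N D est alpha m n z0 T W S z \<longleftrightarrow>
     prob_space M \<and>
     (\<forall>t\<le>Suc T. subalgebra M (F t)) \<and>
     (\<forall>t\<le>T. subalgebra (F (Suc t)) (F t)) \<and>
     (\<forall>t\<le>Suc T. z t \<in> borel_measurable (F t)) \<and>
     (\<forall>t\<le>T. W t \<in> measurable (F (Suc t)) (Pi\<^sub>M {..<m t} (\<lambda>_. borel))) \<and>
     (\<forall>t\<le>T. S t \<in> measurable (F (Suc t)) (Pi\<^sub>M {..<n t} (\<lambda>_. borel \<Otimes>\<^sub>M borel))) \<and>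
     (\<forall>t\<le>T. \<forall>E\<in>sets (F t). \<forall>A\<in>sets (Pi\<^sub>M {..<m t} (\<lambda>_. borel)).
        \<forall>B\<in>sets (Pi\<^sub>M {..<n t} (\<lambda>_. borel \<Otimes>\<^sub>M borel)).
          emeasure M {\<omega>\<in>E. W t \<omega> \<in> A \<and> S t \<omega> \<in> B} =
          (\<integral>\<^sup>+\<omega>\<in>E. emeasure (sample_law c N (m t) (z t \<omega>)) A
                  * emeasure (dataset_law c N D (n t) (z t \<omega>)) B \<partial>M)) \<and>
     (AE \<omega> in M. z 0 \<omega> = z0) \<and>
     (\<forall>t\<le>T. AE \<omega> in M.
        is_arg_min (spl_model phi (m t) (alpha t) (z t \<omega>) (W t \<omega>) (est (n t) (z t \<omega>) (S t \<omega>)))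
          (\<lambda>y. y \<in> X) (z (Suc t) \<omega>))"

text \<open>An index in \<open>0, \<dots>, T\<close> drawn independently of \<open>G\<close>, with probabilities proportional to \<open>w\<close>.\<close>

definition random_index ::
  "'w measure \<Rightarrow> 'w measure \<Rightarrow> (nat \<Rightarrow> real) \<Rightarrow> nat \<Rightarrow> ('w \<Rightarrow> nat) \<Rightarrow> bool" where
  "random_index M G w T tstar \<longleftrightarrow>
     tstar \<in> measurable M (count_space UNIV) \<and> (\<forall>\<omega>\<in>space M. tstar \<omega> \<le> T) \<and>
     (\<forall>t\<le>T. \<forall>E\<in>sets G. measure M {\<omega>\<in>E. tstar \<omega> = t} = w t / (\<Sum>s\<le>T. w s) * measure M E)"

definition step_param :: "real \<Rightarrow> real \<Rightarrow> nat \<Rightarrow> real" where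
  "step_param a0 b t = a0 * (real t + 1) powr b"

definition sample_size :: "nat \<Rightarrow> real \<Rightarrow> nat \<Rightarrow> nat" where
  "sample_size m0 j t = nat \<lceil>real m0 * (real t + 1) powr j\<rceil>"

definition total_samples :: "(nat \<Rightarrow> nat) \<Rightarrow> (nat \<Rightarrow> nat) \<Rightarrow> nat \<Rightarrow> nat" where
  "total_samples m n T = (\<Sum>t\<le>T. m t + n t)"

section \<open>Convergence bounds and asymptotic notation\<close>

text \<open>
  The nonasymptotic upper bound on the expected distance between the output and its
  proximal point; \<open>lhat\<close> bounds the Jacobian estimates, \<open>lamhat\<close> is the weak convexity
  modulus of the sampled models, and \<open>e\<close> is the estimation error.
\<close>

definition guarantee_bound ::
  "real \<Rightarrow> real \<Rightarrow> real \<Rightarrow> real \<Rightarrow> real \<Rightarrow> real \<Rightarrow> real \<Rightarrow> (nat \<Rightarrow> real) \<Rightarrow> (nat \<Rightarrow> real) \<Rightarrow> (nat \<Rightarrow> nat)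
    \<Rightarrow> (nat \<Rightarrow> nat) \<Rightarrow> nat \<Rightarrow> real" where
  "guarantee_bound Delta0 rho lphi Lc lhat lamhat tau e alpha m n T =
     sqrt ((4 * Delta0 + (\<Sum>t\<le>T. rho / (alpha t + rho - tau) *
              (8 * lphi\<^sup>2 * (1 + lhat)\<^sup>2 / (real (m t) * (alpha t - lamhat))
               + 4 * lphi\<^sup>2 * (e (n t))\<^sup>2 / (2 * rho - lphi * Lc - tau)
               + 2 * lphi\<^sup>2 * (e (n t))\<^sup>2 / (alpha t - rho - lphi * Lc))))
           / (\<Sum>t\<le>T. rho * (2 * rho - lphi * Lc - tau) / (alpha t + rho - tau)))"

text \<open>The order of the bound when the estimation error decays like \<open>n powr (- r)\<close>.\<close>

definition rate_bound :: "real \<Rightarrow> (nat \<Rightarrow> real) \<Rightarrow> (nat \<Rightarrow> nat) \<Rightarrow> (nat \<Rightarrow> nat) \<Rightarrow> nat \<Rightarrow> real" where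
  "rate_bound r alpha m n T =
     sqrt ((1 + (\<Sum>t\<le>T. 1 / (real (m t) * (alpha t)\<^sup>2)
                       + 1 / (real (n t) powr (2 * r) * alpha t)
                       + 1 / (real (n t) powr (2 * r) * (alpha t)\<^sup>2)))
           / (\<Sum>t\<le>T. 1 / alpha t))"

text \<open>Order up to logarithmic factors, as the accuracy tends to zero from the right.\<close>

definition soft_bigo :: "(real \<Rightarrow> real) \<Rightarrow> (real \<Rightarrow> real) set" where
  "soft_bigo g = (\<Union>p::nat. O[at_right 0](\<lambda>x. g x * (ln (1 / x)) ^ p))"

end

theory Submission
  imports Defs
begin

text \<open>
  Write \<open>x\<close> for the current iterate and \<open>p\<close> for its proximal point. The sampled model is
  strongly convex, and so is the objective plus \<open>rho / 2 * (norm (y - x))\<^sup>2\<close>; adding the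
  quadratic growth of both at their minimisers, evaluated at each other's minimiser, bounds the
  distance from the next iterate to \<open>p\<close> by that from \<open>x\<close> to \<open>p\<close>, up to three errors: the
  linearisation of \<open>c\<close>, the error of the Jacobian estimate, and the generalisation gap of the
  sampled model at its own minimiser. The last is controlled by algorithmic stability: exchanging one
  sample moves the minimiser by \<open>O(1/m)\<close>. Since the Moreau envelope at the next iterate is at
  most the value of its defining infimand at \<open>p\<close>, it decreases in expectation, and the sum over the
  iterations telescopes. The proximal point is nearly stationary by separating the strict epigraph of the
  regularised objective from the feasible set.

  For the rates, with \<open>T + 1 = N\<close> the squared bound is at least a constant times both
  \<open>N powr (- (1 - b))\<close> and \<open>N powr (- 2 * r * k)\<close>, while at least \<open>N powr (1 + k)\<close> samples
  are drawn up to a constant; the two constraints balance exactly at \<open>k = (1 - b) / (2 * r)\<close>.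
\<close>

section \<open>Weakly convex functions and their minimisers\<close>

text \<open>Two obstacles shape the development. The sampling laws depend on the random iterate, and
  freshness is known only on rectangles; each conditional law is therefore realised as the image of
  one fixed probability space, which reduces conditioning to Fubini. Moreover the next iterate is
  just some minimiser; strong convexity makes it unique, and measurability is derived from its
  quadratic growth.

  Expectations along a run are extended nonnegative integrals of the Moreau envelope minus the
  infimum of the objective, and the descent is written without subtraction, so that no integrability
  has to be shown there. Within one step the losses are centred at the current point, and a step has
  length at most \<open>2 * Lmod / a\<close> for every sample, so the integrands are bounded.

  The constants of the guarantee: half of the margin \<open>kappa\<close> absorbs the estimation
  error, the other half is the decrease \<open>rho * kappa / (4 * (a + rho - tau))\<close>, whence
  the factor 4 at \<open>Delta0\<close>; the factor 8 is 4 times that of the stability term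
  \<open>2 * Lmod\<^sup>2 / (real m * (a - lamhat))\<close>.\<close>

lemma norm_convex_combination:
  fixes x y :: "'a::real_inner"
  assumes "u + v = 1"
  shows "(norm (u *\<^sub>R x + v *\<^sub>R y))\<^sup>2 = u * (norm x)\<^sup>2 + v * (norm y)\<^sup>2 - u * v * (norm (x - y))\<^sup>2"
proof -
  have v: "v = 1 - u" using assms by simp
  show ?thesis unfolding v power2_norm_eq_inner
    by (simp add: inner_add inner_diff inner_commute algebra_simps)
qed

text \<open>The quadratic cancels and leaves the defect
  \<open>u * v * (norm (x - y))\<^sup>2\<close>. In this form the defects of summands, integrals and
  Lipschitz perturbations simply add up, which is how the moduli below are computed.\<close>

lemma weakly_convex_onI:
  assumes "convex S"
    and "\<And>x y u v. \<lbrakk>x \<in> S; y \<in> S; 0 \<le> u; 0 \<le> v; u + v = 1\<rbrakk> \<Longrightarrow>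
      f (u *\<^sub>R x + v *\<^sub>R y) \<le> u * f x + v * f y + lam / 2 * (u * v * (norm (x - y))\<^sup>2)"
  shows "weakly_convex_on lam S f"
  unfolding weakly_convex_on_def convex_on_def
proof (intro conjI ballI allI impI)
  fix x y and u v :: real
  assume *: "x \<in> S" "y \<in> S" "0 \<le> u" "0 \<le> v" "u + v = 1"
  show "f (u *\<^sub>R x + v *\<^sub>R y) + lam / 2 * (norm (u *\<^sub>R x + v *\<^sub>R y))\<^sup>2
    \<le> u * (f x + lam / 2 * (norm x)\<^sup>2) + v * (f y + lam / 2 * (norm y)\<^sup>2)"
    using assms(2)[OF *] unfolding norm_convex_combination[OF *(5)] by (simp add: algebra_simps)
qed fact

lemma weakly_convex_onD:
  assumes "weakly_convex_on lam S f" "x \<in> S" "y \<in> S" "0 \<le> u" "0 \<le> v" "u + v = 1"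
  shows "f (u *\<^sub>R x + v *\<^sub>R y) \<le> u * f x + v * f y + lam / 2 * (u * v * (norm (x - y))\<^sup>2)"
proof -
  have "f (u *\<^sub>R x + v *\<^sub>R y) + lam / 2 * (norm (u *\<^sub>R x + v *\<^sub>R y))\<^sup>2
    \<le> u * (f x + lam / 2 * (norm x)\<^sup>2) + v * (f y + lam / 2 * (norm y)\<^sup>2)"
    using assms unfolding weakly_convex_on_def convex_on_def by blast
  then show ?thesis unfolding norm_convex_combination[OF assms(6)] by (simp add: algebra_simps)
qed

lemma weakly_convex_on_subset:
  assumes "weakly_convex_on lam S f" "T \<subseteq> S" "convex T"
  shows "weakly_convex_on lam T f"
  using assms by (intro weakly_convex_onI weakly_convex_onD[OF assms(1)]) auto

text \<open>Moving the centre \<open>w\<close> changes the square by an affine function only. The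
  modulus \<open>lam - mu\<close> may be negative: strong convexity is expressed as weak convexity
  with a negative modulus.\<close>

lemma weakly_convex_on_add_square:
  fixes w :: "'a::real_inner"
  assumes "weakly_convex_on lam S f"
  shows "weakly_convex_on (lam - mu) S (\<lambda>y. f y + mu / 2 * (norm (y - w))\<^sup>2)"
proof (rule weakly_convex_onI)
  show "convex S" using assms by (auto simp: weakly_convex_on_def convex_on_def)
  fix x y and u v :: real
  assume *: "x \<in> S" "y \<in> S" "0 \<le> u" "0 \<le> v" "u + v = 1"
  have "u *\<^sub>R x + v *\<^sub>R y - w = u *\<^sub>R (x - w) + v *\<^sub>R (y - w)"
    using *(5) by (simp add: algebra_simps flip: scaleR_add_left)
  then have "(norm (u *\<^sub>R x + v *\<^sub>R y - w))\<^sup>2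
      = u * (norm (x - w))\<^sup>2 + v * (norm (y - w))\<^sup>2 - u * v * (norm (x - y))\<^sup>2"
    using norm_convex_combination[OF *(5), of "x - w" "y - w"] by simp
  then have "mu / 2 * (norm (u *\<^sub>R x + v *\<^sub>R y - w))\<^sup>2
      = mu / 2 * (u * (norm (x - w))\<^sup>2 + v * (norm (y - w))\<^sup>2 - u * v * (norm (x - y))\<^sup>2)" by simp
  then show "f (u *\<^sub>R x + v *\<^sub>R y) + mu / 2 * (norm (u *\<^sub>R x + v *\<^sub>R y - w))\<^sup>2
    \<le> u * (f x + mu / 2 * (norm (x - w))\<^sup>2) + v * (f y + mu / 2 * (norm (y - w))\<^sup>2)
      + (lam - mu) / 2 * (u * v * (norm (x - y))\<^sup>2)"
    using weakly_convex_onD[OF assms *] by (simp add: field_simps)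
qed

text \<open>Compare \<open>Z\<close> with the point
  \<open>u *\<^sub>R y + (1 - u) *\<^sub>R Z\<close>, divide by \<open>u\<close> and let
  \<open>u\<close> tend to 0.\<close>

lemma minimizer_quadratic_growth:
  fixes g :: "'a::real_inner \<Rightarrow> real"
  assumes g: "weakly_convex_on (- mu) S g" and Z: "Z \<in> S" "\<And>y. y \<in> S \<Longrightarrow> g Z \<le> g y"
    and y: "y \<in> S"
  shows "g Z + mu / 2 * (norm (y - Z))\<^sup>2 \<le> g y"
proof -
  have S: "convex S" using g by (auto simp: weakly_convex_on_def convex_on_def)
  have le: "g Z + mu / 2 * (norm (y - Z))\<^sup>2 * (1 - u) \<le> g y" if u: "0 < u" "u < 1" for u
  proof -
    have "g Z \<le> g (u *\<^sub>R y + (1 - u) *\<^sub>R Z)"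
      using u S Z y by (intro Z(2) convexD[OF S]) auto
    also have "\<dots> \<le> u * g y + (1 - u) * g Z + - mu / 2 * (u * (1 - u) * (norm (y - Z))\<^sup>2)"
      using u Z y by (intro weakly_convex_onD[OF g]) auto
    finally have "u * (g Z + mu / 2 * (norm (y - Z))\<^sup>2 * (1 - u)) \<le> u * g y"
      by (simp add: field_simps)
    then show ?thesis using u by (simp add: mult_le_cancel_left_pos)
  qed
  have "((\<lambda>u. g Z + mu / 2 * (norm (y - Z))\<^sup>2 * (1 - u)) \<longlongrightarrow>
      g Z + mu / 2 * (norm (y - Z))\<^sup>2 * (1 - 0)) (at_right 0)"
    by (intro tendsto_intros)
  moreover have "\<forall>\<^sub>F u in at_right 0. g Z + mu / 2 * (norm (y - Z))\<^sup>2 * (1 - u) \<le> g y"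
    using le by (auto simp: eventually_at_right[of 0 1] intro!: exI[of _ 1])
  ultimately show ?thesis
    using tendsto_upperbound[of _ _ "at_right (0::real)"] by fastforce
qed

lemma coercive_attains_inf:
  fixes g :: "'a::euclidean_space \<Rightarrow> real"
  assumes X: "closed X" "X \<noteq> {}" and g: "continuous_on X g"
    and mu: "0 < mu" and coercive: "\<And>y. y \<in> X \<Longrightarrow> B + mu * (norm (y - w))\<^sup>2 \<le> g y"
  shows "\<exists>Z\<in>X. \<forall>y\<in>X. g Z \<le> g y"
proof -
  obtain y0 where y0: "y0 \<in> X" using X by auto
  \<comment> \<open>Coercivity confines the sublevel set of \<open>y0\<close> to the ball of this
    radius, where compactness applies.\<close>
  define R where "R = sqrt ((g y0 - B) / mu)"
  have R: "dist w y \<le> R" if "y \<in> X" "g y \<le> g y0" for y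
  proof -
    have "(norm (y - w))\<^sup>2 \<le> (g y0 - B) / mu"
      using coercive[OF that(1)] that(2) mu by (simp add: field_simps)
    then show ?thesis unfolding R_def dist_norm by (simp add: real_le_rsqrt norm_minus_commute)
  qed
  have "compact (X \<inter> cball w R)" using X by (simp add: closed_Int_compact)
  moreover have "y0 \<in> X \<inter> cball w R" using y0 R by auto
  ultimately obtain Z where Z: "Z \<in> X \<inter> cball w R" "\<And>y. y \<in> X \<inter> cball w R \<Longrightarrow> g Z \<le> g y"
    using continuous_attains_inf[of "X \<inter> cball w R" g] continuous_on_subset[OF g]
    by (metis empty_iff inf_le1)
  have "g Z \<le> g y" if "y \<in> X" for y
  proof (cases "g y \<le> g y0")
    case True
    then show ?thesis using Z(2) R that by auto
  next
    case False
    then show ?thesis using Z(2)[of y0] y0 R by force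
  qed
  then show ?thesis using Z by auto
qed

text \<open>The minimiser is the limit of the first \<open>1/k\<close>-minimisers in a countable dense subset.\<close>

lemma borel_measurable_minimizer:
  fixes g :: "'p \<Rightarrow> 'a::euclidean_space \<Rightarrow> real"
  assumes X: "X \<noteq> {}" and mu: "0 < mu"
    and meas: "\<And>y. y \<in> X \<Longrightarrow> (\<lambda>p. g p y) \<in> borel_measurable P"
    and cont: "\<And>p. p \<in> space P \<Longrightarrow> continuous_on X (g p)"
    and Z: "\<And>p. p \<in> space P \<Longrightarrow> Z p \<in> X"
    and growth: "\<And>p y. p \<in> space P \<Longrightarrow> y \<in> X \<Longrightarrow> g p (Z p) + mu * (norm (y - Z p))\<^sup>2 \<le> g p y"
  shows "Z \<in> borel_measurable P"
proof -
  obtain Q where Q: "countable Q" "Q \<subseteq> X" "X \<subseteq> closure Q" by (rule separable)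
  have "Q \<noteq> {}" using Q X by auto
  define q where "q = from_nat_into Q"
  have qQ: "range q = Q" unfolding q_def using Q \<open>Q \<noteq> {}\<close> by (simp add: range_from_nat_into)
  then have qX: "q i \<in> X" for i using Q by blast
  have [measurable]: "(\<lambda>p. g p (q i)) \<in> borel_measurable P" for i using meas qX by blast
  have bdd: "bdd_below (range (\<lambda>j. g p (q j)))" if "p \<in> space P" for p
  proof (rule bdd_belowI2)
    fix j
    show "g p (Z p) \<le> g p (q j)"
      using growth[OF that qX[of j]] mu by (smt (verit) mult_nonneg_nonneg zero_le_power2)
  qed
  have dense: "\<exists>i. g p (q i) < g p (Z p) + e" if p: "p \<in> space P" and "0 < e" for p e
  proof -
    obtain d where d: "0 < d" "\<And>y. y \<in> X \<Longrightarrow> dist y (Z p) < d \<Longrightarrow> dist (g p y) (g p (Z p)) < e"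
      using cont[OF p] Z[OF p] \<open>0 < e\<close> unfolding continuous_on_iff by metis
    obtain y where "y \<in> Q" "dist y (Z p) < d"
      using Q(3) Z[OF p] d(1) closure_approachable[of "Z p" Q] by blast
    moreover from this obtain i where "y = q i" using qQ by blast
    ultimately have "dist (g p (q i)) (g p (Z p)) < e" using d(2) qX by blast
    then show ?thesis by (intro exI[of _ i]) (auto simp: dist_real_def)
  qed
  have INF: "(INF j. g p (q j)) = g p (Z p)" if p: "p \<in> space P" for p
  proof (rule antisym)
    show "(INF j. g p (q j)) \<le> g p (Z p)"
    proof (rule field_le_epsilon)
      fix e :: real assume "0 < e"
      then obtain i where "g p (q i) < g p (Z p) + e" using dense p by blast
      then show "(INF j. g p (q j)) \<le> g p (Z p) + e"
        using cINF_lower[OF bdd[OF p], of i] by simp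
    qed
    show "g p (Z p) \<le> (INF j. g p (q j))"
    proof (rule cINF_greatest)
      fix j
      show "g p (Z p) \<le> g p (q j)"
        using growth[OF p qX[of j]] mu by (smt (verit) mult_nonneg_nonneg zero_le_power2)
    qed simp
  qed
  \<comment> \<open>Written as a countable infimum, the minimal value is measurable without
    reference to \<open>Z\<close>, whose measurability is still open.\<close>
  define V where "V p = (INF j. g p (q j))" for p
  have [measurable]: "V \<in> borel_measurable P"
    unfolding V_def by (rule borel_measurable_cINF) (auto intro: bdd)
  \<comment> \<open>Taking the least index makes the choice of a near-minimiser measurable;
    quadratic growth then converts accuracy in value into distance to \<open>Z p\<close>.\<close>
  define I where "I k p = (LEAST i. g p (q i) < V p + 1 / real (Suc k))" for k p
  have [measurable]: "I k \<in> measurable P (count_space UNIV)" for k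
    unfolding I_def by measurable
  have I: "g p (q (I k p)) < V p + 1 / real (Suc k)" if "p \<in> space P" for p k
  proof -
    have "\<exists>i. g p (q i) < V p + 1 / real (Suc k)"
      using dense[OF that, of "1 / real (Suc k)"] unfolding V_def INF[OF that] by simp
    then show ?thesis unfolding I_def by (rule LeastI_ex)
  qed
  show ?thesis
  proof (rule borel_measurable_LIMSEQ_metric)
    show "(\<lambda>p. q (I k p)) \<in> borel_measurable P" for k by measurable
    fix p assume p: "p \<in> space P"
    have m1: "mu * (norm (q (I k p) - Z p))\<^sup>2 \<le> 1 / real (Suc k)" for k
      using growth[OF p qX[of "I k p"]] I[OF p, of k] INF[OF p] by (simp add: V_def)
    have "(norm (q (I k p) - Z p))\<^sup>2 \<le> 1 / mu * (1 / real (Suc k))" for k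
      by (rule mult_left_le_imp_le[OF _ mu]) (use m1[of k] mu in simp)
    then have le: "norm (q (I k p) - Z p) \<le> sqrt (1 / mu * (1 / real (Suc k)))" for k
      by (rule real_le_rsqrt)
    have "(\<lambda>k. sqrt (1 / mu * (1 / real (Suc k)))) \<longlonglongrightarrow> sqrt (1 / mu * 0)"
      by (intro tendsto_intros lim_1_over_n[THEN LIMSEQ_Suc])
    then have lim: "(\<lambda>k. sqrt (1 / mu * (1 / real (Suc k)))) \<longlonglongrightarrow> 0" by simp
    have "(\<lambda>k. q (I k p) - Z p) \<longlonglongrightarrow> 0"
      by (rule Lim_null_comparison[OF always_eventually lim]) (use le in auto)
    then show "(\<lambda>k. q (I k p)) \<longlonglongrightarrow> Z p" by (simp add: LIM_zero_iff)
  qed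
qed

text \<open>The separating hyperplane cannot be vertical because \<open>y\<close> is interior to
  \<open>S\<close>. Normalised, it yields one vector \<open>p\<close> that is a subgradient of
  \<open>h\<close> and whose negative is normal to \<open>X\<close>: the sum rule at a constrained
  minimiser.\<close>

lemma separation_subgradient:
  fixes h :: "'a::euclidean_space \<Rightarrow> real"
  assumes S: "open S" and h: "convex_on S h" and X: "convex X" "X \<subseteq> S"
    and y: "y \<in> X" "\<And>x. x \<in> X \<Longrightarrow> h y \<le> h x"
  obtains p where "\<And>u. u \<in> S \<Longrightarrow> h y + p \<bullet> (u - y) \<le> h u" "\<And>x. x \<in> X \<Longrightarrow> - p \<bullet> (x - y) \<le> 0"
proof -
  \<comment> \<open>The excess over \<open>h y\<close> is recorded strictly, so that minimality of
    \<open>y\<close> on \<open>X\<close> makes \<open>A\<close> and \<open>C\<close>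
    disjoint.\<close>
  define A where "A = {(u, s). u \<in> S \<and> h u - h y < s}"
  define C where "C = X \<times> {..(0::real)}"
  have A: "convex A"
  proof (rule convexI)
    fix a a' and u v :: real
    assume *: "a \<in> A" "a' \<in> A" "0 \<le> u" "0 \<le> v" "u + v = 1"
    obtain x s x' s' where a: "a = (x, s)" "a' = (x', s')" by (cases a, cases a')
    have "h (u *\<^sub>R x + v *\<^sub>R x') \<le> u * h x + v * h x'"
      using * h a by (auto simp: A_def convex_on_def)
    also have "\<dots> < u * (s + h y) + v * (s' + h y)"
    proof (cases "u = 0")
      case False
      then have "u * h x < u * (s + h y)" "v * h x' \<le> v * (s' + h y)"
        using * a by (auto simp: A_def intro!: mult_left_mono)
      then show ?thesis by simp
    next
      case True
      then show ?thesis using * a by (auto simp: A_def)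
    qed
    also have "\<dots> = u * s + v * s' + h y"
    proof -
      have "u * (s + h y) + v * (s' + h y) = u * s + v * s' + (u + v) * h y" by (simp add: algebra_simps)
      then show ?thesis using *(5) by simp
    qed
    finally show "u *\<^sub>R a + v *\<^sub>R a' \<in> A"
      using * a h by (auto simp: A_def convex_on_def intro: convexD)
  qed
  have C: "convex C" unfolding C_def using X by (intro convex_Times) auto
  have "(y, 1) \<in> A" "(y, 0) \<in> C" using y X by (auto simp: A_def C_def)
  moreover have "A \<inter> C = {}" using y X by (fastforce simp: A_def C_def)
  ultimately obtain a t where a: "a \<noteq> 0" "\<And>x. x \<in> C \<Longrightarrow> a \<bullet> x \<le> t" "\<And>x. x \<in> A \<Longrightarrow> t \<le> a \<bullet> x"
    using separating_hyperplane_sets[OF C A] by blast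
  obtain p be where pb: "a = (p, be)" by (cases a)
  have t0: "p \<bullet> y \<le> t" using a(2)[of "(y, 0)"] y by (simp add: pb C_def)
  have up: "t \<le> p \<bullet> u + be * (h u - h y)" if u: "u \<in> S" for u
  proof -
    have "((\<lambda>e. p \<bullet> u + be * (h u - h y + e)) \<longlongrightarrow> p \<bullet> u + be * (h u - h y + 0)) (at_right 0)"
      by (intro tendsto_intros)
    moreover have "\<forall>\<^sub>F e in at_right 0. t \<le> p \<bullet> u + be * (h u - h y + e)"
      using a(3)[of "(u, h u - h y + e)" for e] u
      by (auto simp: pb A_def eventually_at_right[of 0 1] intro!: exI[of _ 1])
    ultimately show ?thesis using tendsto_lowerbound[of _ _ "at_right (0::real)"] by fastforce
  qed
  have t: "t = p \<bullet> y" using t0 up[of y] y X by auto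
  have "0 \<le> be"
    using a(3)[of "(y, 1)"] t \<open>(y, 1) \<in> A\<close> by (simp add: pb)
  moreover have "be \<noteq> 0"
  proof
    assume "be = 0"
    then have le: "p \<bullet> y \<le> p \<bullet> u" if "u \<in> S" for u using up[OF that] t by simp
    have "p \<noteq> 0" using a(1) pb \<open>be = 0\<close> by (auto simp: zero_prod_def)
    \<comment> \<open>A vertical hyperplane would make \<open>y\<close> a minimiser of
      \<open>p \<bullet> u\<close> over \<open>S\<close>; moving from the interior point
      \<open>y\<close> against \<open>p\<close> contradicts this.\<close>
    obtain e where e: "0 < e" "cball y e \<subseteq> S" using S y X open_contains_cball by blast
    have "y - (e / norm p) *\<^sub>R p \<in> cball y e" using e \<open>p \<noteq> 0\<close> by (simp add: dist_norm)
    then have "p \<bullet> y \<le> p \<bullet> (y - (e / norm p) *\<^sub>R p)" using le e by blast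
    then show False using e \<open>p \<noteq> 0\<close>
      by (simp add: inner_diff_right divide_le_0_iff mult_le_0_iff) (metis inner_gt_zero_iff not_less)
  qed
  ultimately have be: "0 < be" by simp
  show thesis
  proof (rule that[of "- (1 / be) *\<^sub>R p"])
    fix u assume "u \<in> S"
    then show "h y + - (1 / be) *\<^sub>R p \<bullet> (u - y) \<le> h u"
      using up[of u] t be by (simp add: inner_diff_right field_simps)
  next
    fix x assume "x \<in> X"
    then have "p \<bullet> (x - y) \<le> 0" using a(2)[of "(x, 0)"] t by (simp add: pb C_def inner_diff_right)
    then show "- (- (1 / be) *\<^sub>R p) \<bullet> (x - y) \<le> 0"
      using be by (simp add: divide_le_0_iff mult_le_0_iff)
  qed
qed

text \<open>The Clarke limit superior also moves the base point; freezing it at \<open>y\<close> can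
  only decrease the limit, so an ordinary one-sided difference quotient bounds it from
  below.\<close>

lemma clarke_derivative_ge:
  fixes f :: "'a::real_inner \<Rightarrow> real"
  assumes lim: "((\<lambda>s. l s) \<longlongrightarrow> L) (at_right 0)"
    and le: "\<forall>\<^sub>F s in at_right 0. l s \<le> (f (y + s *\<^sub>R v) - f y) / s"
  shows "ereal L \<le> clarke_derivative f y v"
proof -
  let ?F = "\<lambda>(x, s). ereal ((f (x + s *\<^sub>R v) - f x) / s)"
  have lim': "filterlim (\<lambda>s. (y, s)) (nhds y \<times>\<^sub>F at_right 0) (at_right (0::real))"
    by (intro filterlim_Pair filterlim_ident) simp
  have "ereal L = Limsup (at_right 0) (\<lambda>s. ereal (l s))"
    using lim by (intro lim_imp_Limsup[symmetric]) auto
  also have "\<dots> \<le> Limsup (at_right 0) (\<lambda>s. ?F (y, s))"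
    using le by (intro Limsup_mono) auto
  also have "\<dots> \<le> Limsup (nhds y \<times>\<^sub>F at_right (0::real)) ?F"
    unfolding Limsup_def
  proof (rule INF_greatest)
    fix P assume "P \<in> {P. eventually P (nhds y \<times>\<^sub>F at_right (0::real))}"
    then have "\<forall>\<^sub>F s in at_right 0. P (y, s)"
      using lim' unfolding filterlim_iff by blast
    then show "(INF P\<in>{P. eventually P (at_right 0)}. SUP x\<in>Collect P. ?F (y, x)) \<le> Sup (?F ` Collect P)"
      by (intro INF_lower2[of "\<lambda>s. P (y, s)"] SUP_least) (auto intro!: SUP_upper2)
  qed
  finally show ?thesis unfolding clarke_derivative_def .
qed

text \<open>The subgradient \<open>p\<close> of the regularised function minus the gradient
  \<open>rho *\<^sub>R (y - x)\<close> of the quadratic lies in the Clarke subdifferential of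
  \<open>f\<close>; adding the normal vector \<open>- p\<close> leaves
  \<open>rho *\<^sub>R (x - y)\<close>.\<close>

lemma stationarity_gap_le:
  fixes f :: "'a::euclidean_space \<Rightarrow> real"
  assumes S: "open S" and f: "weakly_convex_on rho S f" and X: "convex X" "X \<subseteq> S" and rho: "0 \<le> rho"
    and y: "y \<in> X" "\<And>u. u \<in> X \<Longrightarrow> f y + rho / 2 * (norm (y - x))\<^sup>2 \<le> f u + rho / 2 * (norm (u - x))\<^sup>2"
  shows "stationarity_gap X f y \<le> ennreal (rho * norm (x - y))"
proof -
  let ?h = "\<lambda>u. f u + rho / 2 * (norm (u - x))\<^sup>2"
  have "weakly_convex_on (rho - rho) S ?h" by (rule weakly_convex_on_add_square[OF f])
  then have h: "convex_on S ?h" by (simp add: weakly_convex_on_def)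
  obtain p where p: "\<And>u. u \<in> S \<Longrightarrow> ?h y + p \<bullet> (u - y) \<le> ?h u" "\<And>u. u \<in> X \<Longrightarrow> - p \<bullet> (u - y) \<le> 0"
    using separation_subgradient[OF S h X y] by blast
  have "- p \<in> normal_cone X y" using p y by (auto simp: normal_cone_def)
  moreover have "p + rho *\<^sub>R (x - y) \<in> clarke_subdifferential f y"
    unfolding clarke_subdifferential_def
  proof (intro CollectI allI)
    fix v
    \<comment> \<open>The subgradient inequality of the regularised function divided by
      \<open>s\<close>; the term linear in \<open>s\<close> is the curvature of the quadratic and
      vanishes in the limit.\<close>
    define l where "l s = (p + rho *\<^sub>R (x - y)) \<bullet> v - rho / 2 * (norm v)\<^sup>2 * s" for s :: real
    have "((\<lambda>s. l s) \<longlongrightarrow> (p + rho *\<^sub>R (x - y)) \<bullet> v - rho / 2 * (norm v)\<^sup>2 * 0) (at_right 0)"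
      unfolding l_def by (intro tendsto_intros)
    then have "((\<lambda>s. l s) \<longlongrightarrow> (p + rho *\<^sub>R (x - y)) \<bullet> v) (at_right 0)" by simp
    moreover have "\<forall>\<^sub>F s in at_right 0. l s \<le> (f (y + s *\<^sub>R v) - f y) / s"
    proof -
      have "((\<lambda>s. y + s *\<^sub>R v) \<longlongrightarrow> y + 0 *\<^sub>R v) (at_right 0)" by (intro tendsto_intros)
      then have "\<forall>\<^sub>F s in at_right 0. y + s *\<^sub>R v \<in> S"
        using S y X by (intro topological_tendstoD) auto
      then show ?thesis using eventually_at_right_less[of 0]
      proof eventually_elim
        case (elim s)
        define q where "q = (y - x) \<bullet> v"
        have q: "l s = p \<bullet> v - rho * q - rho / 2 * (norm v)\<^sup>2 * s"
          unfolding l_def q_def by (simp add: inner_add_left inner_diff_left algebra_simps)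
        have "(norm (y + s *\<^sub>R v - x))\<^sup>2 = (norm (y - x))\<^sup>2 + 2 * s * q + s\<^sup>2 * (norm v)\<^sup>2"
          unfolding q_def
          unfolding power2_norm_eq_inner
          by (simp add: inner_add_left inner_add_right inner_diff_left inner_diff_right inner_commute algebra_simps power2_eq_square)
        then have "rho / 2 * (norm (y + s *\<^sub>R v - x))\<^sup>2
            = rho / 2 * ((norm (y - x))\<^sup>2 + 2 * s * q + s\<^sup>2 * (norm v)\<^sup>2)" by simp
        moreover have "f y + rho / 2 * (norm (y - x))\<^sup>2 + s * (p \<bullet> v)
            \<le> f (y + s *\<^sub>R v) + rho / 2 * (norm (y + s *\<^sub>R v - x))\<^sup>2"
          using p(1)[OF elim(1)] by simp
        moreover have "rho / 2 * ((norm (y - x))\<^sup>2 + 2 * s * q + s\<^sup>2 * (norm v)\<^sup>2)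
            = rho / 2 * (norm (y - x))\<^sup>2 + s * (p \<bullet> v) - s * l s"
          unfolding q by (simp add: algebra_simps power2_eq_square)
        ultimately have "s * l s \<le> f (y + s *\<^sub>R v) - f y" by linarith
        then show ?case using elim(2) by (simp add: pos_le_divide_eq mult.commute)
      qed
    qed
    ultimately show "ereal ((p + rho *\<^sub>R (x - y)) \<bullet> v) \<le> clarke_derivative f y v"
      by (rule clarke_derivative_ge)
  qed
  ultimately have "(p + rho *\<^sub>R (x - y)) + - p \<in>
      {u + v |u v. u \<in> clarke_subdifferential f y \<and> v \<in> normal_cone X y}" by blast
  then have "stationarity_gap X f y \<le> ennreal (norm ((p + rho *\<^sub>R (x - y)) + - p))"
    unfolding stationarity_gap_def by (rule INF_lower)
  then show ?thesis using rho by simp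
qed

section \<open>The composite objective\<close>

lemma norm_matrix_vector_le_opnorm: "norm (A *v x) \<le> opnorm A * norm x"
  unfolding opnorm_def by (rule onorm) simp

lemma opnorm_nonneg: "0 \<le> opnorm A"
  unfolding opnorm_def by (rule onorm_pos_le) simp

lemma opnorm_le:
  fixes A :: "real^'d^'l"
  shows "(\<And>x. norm (A *v x) \<le> K * norm x) \<Longrightarrow> opnorm A \<le> K"
  unfolding opnorm_def by (rule onorm_le)

lemma opnorm_triangle: "opnorm (A + B) \<le> opnorm A + opnorm B"
  by (rule opnorm_le)
    (smt (verit) matrix_vector_mult_add_rdistrib norm_triangle_ineq norm_matrix_vector_le_opnorm distrib_right)

lemma opnorm_uminus: "opnorm (- A) = opnorm A"
proof -
  have "(- A) *v x = - (A *v x)" for x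
    using matrix_vector_mult_diff_rdistrib[of 0 A x] by simp
  then have "(*v) (- A) = (\<lambda>x. - (A *v x))" by auto
  then show ?thesis unfolding opnorm_def by (simp add: onorm_neg)
qed

lemma bounded_bilinear_matrix_vector_mult:
  "bounded_bilinear (\<lambda>(A :: real^'d^'l) (x :: real^'d). A *v x)"
  unfolding bilinear_conv_bounded_bilinear[symmetric] bilinear_def
  by (auto intro!: linearI simp: matrix_vector_right_distrib matrix_vector_mult_add_rdistrib
      matrix_vector_mult_scaleR scaleR_matrix_vector_assoc)

lemma borel_measurable_matrix_vector_mult [measurable (raw)]:
  fixes A :: "'p \<Rightarrow> real^'d^'l" and v :: "'p \<Rightarrow> real^'d"
  assumes "A \<in> borel_measurable M" "v \<in> borel_measurable M"
  shows "(\<lambda>p. A p *v v p) \<in> borel_measurable M"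
  by (rule borel_measurable_continuous_Pair[OF assms])
    (intro bounded_bilinear.continuous_on[OF bounded_bilinear_matrix_vector_mult] continuous_intros)

text \<open>Lipschitz for the Frobenius norm of the type, hence continuous. The absolute value of
  \<open>K\<close> is taken because the bilinear bound comes without a sign for it.\<close>

lemma borel_measurable_opnorm [measurable]: "(opnorm :: real^'d^'l \<Rightarrow> real) \<in> borel_measurable borel"
proof -
  obtain K where K: "\<And>(A :: real^'d^'l) x. norm (A *v x) \<le> norm A * norm x * K"
    using bounded_bilinear.bounded[OF bounded_bilinear_matrix_vector_mult] by blast
  have le: "opnorm A \<le> norm A * K" for A :: "real^'d^'l"
    by (rule opnorm_le) (use K in \<open>simp add: ac_simps\<close>)
  have diff: "opnorm A - opnorm B \<le> norm (A - B) * \<bar>K\<bar>" for A B :: "real^'d^'l"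
  proof -
    have "opnorm A \<le> opnorm (A - B) + opnorm B" using opnorm_triangle[of "A - B" B] by simp
    also have "opnorm (A - B) \<le> norm (A - B) * \<bar>K\<bar>"
      using le[of "A - B"] by (meson abs_ge_self mult_left_mono norm_ge_zero order_trans)
    finally show ?thesis by simp
  qed
  have "\<bar>K\<bar>-lipschitz_on UNIV (opnorm :: real^'d^'l \<Rightarrow> real)"
  proof (rule lipschitz_onI)
    fix A B :: "real^'d^'l"
    show "dist (opnorm A) (opnorm B) \<le> \<bar>K\<bar> * dist A B"
      using diff[of A B] diff[of B A] by (simp add: dist_norm abs_le_iff norm_minus_commute mult.commute)
  qed simp
  then show ?thesis
    by (intro borel_measurable_continuous_onI lipschitz_on_continuous_on)
qed

text \<open>Along the segment the deviation from the linear model has a derivative of norm at most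
  \<open>L * s * (norm (y - x))\<^sup>2\<close>. Comparison with the real majorant that has this
  derivative replaces an integral of the Jacobian.\<close>

lemma linearization_error:
  fixes c :: "real^'d \<Rightarrow> real^'l"
  assumes S: "convex S" and diff: "\<forall>x\<in>S. c differentiable (at x)"
    and J: "\<forall>x\<in>S. \<forall>y\<in>S. opnorm (jacobian c (at x) - jacobian c (at y)) \<le> L * norm (x - y)"
    and x: "x \<in> S" and y: "y \<in> S"
  shows "norm (c y - c x - jacobian c (at x) *v (y - x)) \<le> L / 2 * (norm (y - x))\<^sup>2"
proof -
  let ?p = "\<lambda>s. x + s *\<^sub>R (y - x)"
  let ?g = "\<lambda>s. c (?p s) - s *\<^sub>R (jacobian c (at x) *v (y - x))"
  let ?g' = "\<lambda>s. jacobian c (at (?p s)) *v (y - x) - jacobian c (at x) *v (y - x)"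
  have p: "?p s \<in> S" if "0 \<le> s" "s \<le> 1" for s
    using convexD_alt[OF S x y that] by (simp add: algebra_simps)
  have g': "(?g has_vector_derivative ?g' s) (at s)" if s: "0 \<le> s" "s \<le> 1" for s
  proof -
    have c': "(c has_derivative (\<lambda>h. jacobian c (at (?p s)) *v h)) (at (?p s))"
      using diff p[OF s] by (simp add: jacobian_works[symmetric])
    have p': "(?p has_derivative (\<lambda>h. h *\<^sub>R (y - x))) (at s)"
      by (auto intro!: derivative_eq_intros)
    show ?thesis
      using has_derivative_diff[OF has_derivative_compose[OF p' c']
          has_derivative_scaleR_left[OF has_derivative_ident, of "jacobian c (at x) *v (y - x)"]]
      unfolding has_vector_derivative_def
      by (simp only: matrix_vector_mult_scaleR scaleR_diff_right[symmetric])
  qed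
  have cont: "continuous_on {0..1} ?g"
    by (rule continuous_at_imp_continuous_on)
      (use g' in \<open>auto intro!: has_vector_derivative_continuous\<close>)
  have "norm (?g 1 - ?g 0) \<le> L / 2 * (norm (y - x))\<^sup>2 * 1\<^sup>2 - L / 2 * (norm (y - x))\<^sup>2 * 0\<^sup>2"
  proof (rule differentiable_bound_general[OF zero_less_one cont])
    show "continuous_on {0..1} (\<lambda>s::real. L / 2 * (norm (y - x))\<^sup>2 * s\<^sup>2)"
      by (intro continuous_intros)
    fix s :: real assume s: "0 < s" "s < 1"
    show "(?g has_vector_derivative ?g' s) (at s)" using g' s by simp
    show "((\<lambda>s. L / 2 * (norm (y - x))\<^sup>2 * s\<^sup>2) has_vector_derivative L * s * (norm (y - x))\<^sup>2) (at s)"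
      unfolding has_real_derivative_iff_has_vector_derivative[symmetric]
      by (auto intro!: derivative_eq_intros)
    have "norm (?g' s) \<le> opnorm (jacobian c (at (?p s)) - jacobian c (at x)) * norm (y - x)"
      using norm_matrix_vector_le_opnorm[of "jacobian c (at (?p s)) - jacobian c (at x)" "y - x"]
      by (simp add: matrix_vector_mult_diff_rdistrib)
    also have "\<dots> \<le> (L * norm (?p s - x)) * norm (y - x)"
    proof (rule mult_right_mono)
      have "?p s \<in> S" using p s by simp
      then show "opnorm (jacobian c (at (?p s)) - jacobian c (at x)) \<le> L * norm (?p s - x)"
        using J x by blast
    qed simp
    also have "\<dots> = L * s * (norm (y - x))\<^sup>2" using s by (simp add: power2_eq_square)
    finally show "norm (?g' s) \<le> L * s * (norm (y - x))\<^sup>2" .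
  qed
  then show ?thesis by (simp add: algebra_simps)
qed

text \<open>One-sided difference quotients in direction \<open>v\<close> stay in the open set
  \<open>S\<close> for small \<open>s\<close> and are bounded by \<open>L * norm v\<close>. The
  bound is what keeps the error of bounded Jacobian estimates bounded in
  \<open>estimation_error_bounds\<close>.\<close>

lemma lipschitz_on_opnorm_jacobian_le:
  fixes c :: "real^'d \<Rightarrow> real^'l"
  assumes S: "open S" and lip: "L-lipschitz_on S c" and x: "x \<in> S" and diff: "c differentiable (at x)"
  shows "opnorm (jacobian c (at x)) \<le> L"
proof (rule opnorm_le)
  fix v :: "real^'d"
  have c': "(c has_derivative (\<lambda>h. jacobian c (at x) *v h)) (at (x + 0 *\<^sub>R v))"
    using diff by (simp add: jacobian_works[symmetric])
  have p': "((\<lambda>s. x + s *\<^sub>R v) has_derivative (\<lambda>h. h *\<^sub>R v)) (at (0::real))"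
    by (auto intro!: derivative_eq_intros)
  have "((\<lambda>s. c (x + s *\<^sub>R v)) has_vector_derivative jacobian c (at x) *v v) (at 0)"
    using has_derivative_compose[OF p' c'] unfolding has_vector_derivative_def matrix_vector_mult_scaleR .
  then have "((\<lambda>s. norm (c (x + s *\<^sub>R v) - c x - s *\<^sub>R (jacobian c (at x) *v v)) / norm s) \<longlongrightarrow> 0) (at 0)"
    unfolding has_vector_derivative_def has_derivative_at by simp
  then have "((\<lambda>s. norm (c (x + s *\<^sub>R v) - c x - s *\<^sub>R (jacobian c (at x) *v v)) / norm s) \<longlongrightarrow> 0) (at_right 0)"
    by (rule filterlim_mono) (auto simp: at_within_le_at)
  then have "((\<lambda>s. L * norm v + norm (c (x + s *\<^sub>R v) - c x - s *\<^sub>R (jacobian c (at x) *v v)) / norm s)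
      \<longlongrightarrow> L * norm v + 0) (at_right 0)"
    by (intro tendsto_intros)
  moreover have "\<forall>\<^sub>F s in at_right 0. norm (jacobian c (at x) *v v)
      \<le> L * norm v + norm (c (x + s *\<^sub>R v) - c x - s *\<^sub>R (jacobian c (at x) *v v)) / norm s"
  proof -
    have "((\<lambda>s. x + s *\<^sub>R v) \<longlongrightarrow> x + 0 *\<^sub>R v) (at_right 0)" by (intro tendsto_intros)
    then have "\<forall>\<^sub>F s in at_right 0. x + s *\<^sub>R v \<in> S"
      using S x by (intro topological_tendstoD) auto
    then show ?thesis using eventually_at_right_less[of 0]
    proof eventually_elim
      case (elim s)
      let ?e = "c (x + s *\<^sub>R v) - c x - s *\<^sub>R (jacobian c (at x) *v v)"
      have "s * norm (jacobian c (at x) *v v) = norm (c (x + s *\<^sub>R v) - c x - ?e)"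
        using elim by simp
      also have "\<dots> \<le> norm (c (x + s *\<^sub>R v) - c x) + norm ?e" by (rule norm_triangle_ineq4)
      also have "norm (c (x + s *\<^sub>R v) - c x) \<le> L * (s * norm v)"
        using lipschitz_onD[OF lip elim(1) x] elim by (simp add: dist_norm)
      finally have "s * norm (jacobian c (at x) *v v) \<le> s * (L * norm v + norm ?e / norm s)"
        using elim by (simp add: algebra_simps)
      then show ?case using elim by simp
    qed
  qed
  ultimately show "norm (jacobian c (at x) *v v) \<le> L * norm v"
    using tendsto_lowerbound[of _ _ "at_right (0::real)"] by fastforce
qed

text \<open>Everything about one step with a fixed matrix. Here the estimates are present only
  through the norm bound \<open>lhat\<close>; design and estimator join in
  \<open>lspl_setting\<close>.\<close>

locale composite_problem =
  fixes X Op :: "(real^'d) set" and phi :: "(real^'d) \<times> (real^'l) \<Rightarrow> real"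
    and c :: "real^'d \<Rightarrow> real^'l" and N :: "(real^'l) measure"
    and lam lphi lc Lc lhat rho :: real
  assumes X: "X \<noteq> {}" "closed X" "convex X" and Op: "open Op" "convex Op" "X \<subseteq> Op"
    and lam: "0 \<le> lam" and phi_weakly_convex: "weakly_convex_on lam (Op \<times> UNIV) phi"
    and phi_lipschitz: "lphi-lipschitz_on (Op \<times> UNIV) phi"
    and N: "prob_space N" "sets N = sets borel" "integrable N (\<lambda>e. (norm e)\<^sup>2)"
    and c_measurable [measurable]: "c \<in> borel_measurable borel" and c_lipschitz: "lc-lipschitz_on Op c"
    and c_differentiable: "\<forall>x\<in>Op. c differentiable (at x)"
    and c_smooth: "\<forall>x\<in>Op. \<forall>y\<in>Op. opnorm (jacobian c (at x) - jacobian c (at y)) \<le> Lc * norm (x - y)"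
    and objective_bounded: "bdd_below (objective phi c N ` X)"
    and lhat: "0 \<le> lhat"
    and rho: "lphi * Lc + max (lam * (1 + lhat)\<^sup>2) (lam * (1 + lc)\<^sup>2) < rho"
begin

abbreviation "f \<equiv> objective phi c N"
abbreviation "J z \<equiv> jacobian c (at z)"
definition "lamhat = lam * (1 + lhat)\<^sup>2"
definition "lamtilde = lam * (1 + lc)\<^sup>2"
text \<open>Lipschitz constant of a linearised loss in the decision: 1 for the direct argument of
  \<open>phi\<close>, \<open>lhat\<close> for the modelled outcome.\<close>

definition "Lmod = lphi * (1 + lhat)"
text \<open>The sum of the margins \<open>rho - lphi * Lc - lamhat\<close> of the sampled model and
  \<open>rho - lphi * Lc - lamtilde\<close> of the objective, both positive by the choice of
  \<open>rho\<close>.\<close>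

definition "kappa = 2 * rho - 2 * (lphi * Lc) - lamhat - lamtilde"
abbreviation "P \<equiv> prox_point X f rho"

interpretation N: prob_space N by (rule N)

lemma sets_N [measurable_cong]: "sets N = sets borel" by (rule N)

lemma lphi: "0 \<le> lphi" using phi_lipschitz by (rule lipschitz_on_nonneg)
lemma lc: "0 \<le> lc" using c_lipschitz by (rule lipschitz_on_nonneg)

lemma Lc: "0 \<le> Lc"
proof -
  obtain x where x: "x \<in> Op" using X Op by auto
  obtain e where e: "0 < e" "cball x e \<subseteq> Op" using Op x open_contains_cball by blast
  \<comment> \<open>Any coordinate direction gives a second point of the open set, at distance
    \<open>e\<close>; the Jacobian bound between the two points fixes the sign of
    \<open>Lc\<close>.\<close>
  define y where "y = x + e *\<^sub>R axis undefined 1"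
  have n: "norm (x - y) = e" using e by (simp add: y_def norm_axis_1)
  then have "y \<in> Op" using e by (auto simp: dist_norm)
  then have "0 \<le> Lc * e" using c_smooth x n opnorm_nonneg order_trans by metis
  then show ?thesis using e by (simp add: zero_le_mult_iff)
qed

lemma lamhat_nonneg: "0 \<le> lamhat" and lamtilde_nonneg: "0 \<le> lamtilde" and Lmod_nonneg: "0 \<le> Lmod"
  using lam lphi lhat lc by (auto simp: lamhat_def lamtilde_def Lmod_def)

lemma rho_gt: "lphi * Lc + lamhat < rho" "lphi * Lc + lamtilde < rho" and rho_pos: "0 < rho"
proof -
  show 1: "lphi * Lc + lamhat < rho" and "lphi * Lc + lamtilde < rho"
    using rho unfolding lamhat_def lamtilde_def by linarith+
  have "0 \<le> lphi * Lc" using lphi Lc by simp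
  then show "0 < rho" using 1 lamhat_nonneg by linarith
qed

lemma kappa_pos: "0 < kappa"
  using rho_gt unfolding kappa_def by linarith

lemma phi_diff_le:
  assumes "y \<in> Op" "y' \<in> Op"
  shows "\<bar>phi (y, v) - phi (y', v')\<bar> \<le> lphi * (norm (y - y') + norm (v - v'))"
proof -
  have "dist (phi (y, v)) (phi (y', v')) \<le> lphi * dist (y, v) (y', v')"
    using assms by (intro lipschitz_onD[OF phi_lipschitz]) auto
  also have "\<dots> \<le> lphi * (norm (y - y') + norm (v - v'))"
    using norm_Pair_le[of "y - y'" "v - v'"] lphi by (intro mult_left_mono) (auto simp: dist_norm)
  finally show ?thesis by (simp add: dist_real_def)
qed

text \<open>\<open>phi\<close> is controlled only over \<open>Op\<close>, so its measurability is
  known only on the restricted space; this is why points are kept in \<open>Op\<close> or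
  \<open>X\<close> throughout.\<close>

lemma phi_measurable:
  assumes "g \<in> borel_measurable M" "v \<in> borel_measurable M" "\<And>p. p \<in> space M \<Longrightarrow> g p \<in> Op"
  shows "(\<lambda>p. phi (g p, v p)) \<in> borel_measurable M"
proof -
  have "phi \<in> borel_measurable (restrict_space borel (Op \<times> UNIV))"
    by (intro borel_measurable_continuous_on_restrict lipschitz_on_continuous_on[OF phi_lipschitz])
  moreover have "(\<lambda>p. (g p, v p)) \<in> measurable M (restrict_space borel (Op \<times> UNIV))"
    using assms by (intro measurable_restrict_space2 borel_measurable_Pair) auto
  ultimately show ?thesis by (rule measurable_compose_rev)
qed

lemma integrable_norm: "integrable N (\<lambda>e. norm e)"
proof (rule Bochner_Integration.integrable_bound)
  show "integrable N (\<lambda>e. 1 + (norm e)\<^sup>2)" using N by (intro Bochner_Integration.integrable_add) auto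
  have "x \<le> 1 + x\<^sup>2" for x :: real
  proof -
    have "0 \<le> (x - 1 / 2)\<^sup>2" by simp
    then show ?thesis by (simp add: power2_eq_square algebra_simps)
  qed
  then show "AE e in N. norm (norm e) \<le> norm (1 + (norm e)\<^sup>2)" by (auto intro!: AE_I2)
qed simp

lemma integrable_phi:
  assumes "x \<in> Op"
  shows "integrable N (\<lambda>e. phi (x, v + e))"
proof (rule Bochner_Integration.integrable_bound)
  show "integrable N (\<lambda>e. \<bar>phi (x, v)\<bar> + lphi * norm e)" using integrable_norm by simp
  show "(\<lambda>e. phi (x, v + e)) \<in> borel_measurable N" using assms by (intro phi_measurable) auto
  have "\<bar>phi (x, v + e)\<bar> \<le> \<bar>phi (x, v)\<bar> + lphi * norm e" for e
    using phi_diff_le[OF assms assms, of "v + e" v] by simp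
  then show "AE e in N. norm (phi (x, v + e)) \<le> norm (\<bar>phi (x, v)\<bar> + lphi * norm e)"
    using lphi by (intro AE_I2) (simp add: abs_mult)
qed

lemma objective_lipschitz: "(lphi * (1 + lc))-lipschitz_on Op f"
proof (rule lipschitz_onI)
  fix x y assume xy: "x \<in> Op" "y \<in> Op"
  have c: "norm (c x - c y) \<le> lc * norm (x - y)"
    using lipschitz_onD[OF c_lipschitz xy] by (simp add: dist_norm)
  have *: "\<bar>phi (x, c x + e) - phi (y, c y + e)\<bar> \<le> lphi * (1 + lc) * dist x y" for e
  proof -
    have "\<bar>phi (x, c x + e) - phi (y, c y + e)\<bar> \<le> lphi * (norm (x - y) + norm (c x - c y))"
      using phi_diff_le[OF xy, of "c x + e" "c y + e"] by simp
    also have "\<dots> \<le> lphi * (norm (x - y) + lc * norm (x - y))"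
      using c lphi by (intro mult_left_mono) auto
    finally show ?thesis by (simp add: algebra_simps dist_norm)
  qed
  have "f x - f y = (\<integral>e. phi (x, c x + e) - phi (y, c y + e) \<partial>N)"
    unfolding objective_def using xy by (simp add: integrable_phi)
  also have "\<bar>\<dots>\<bar> \<le> (\<integral>e. \<bar>phi (x, c x + e) - phi (y, c y + e)\<bar> \<partial>N)" by (rule integral_abs_bound)
  also have "\<dots> \<le> (\<integral>e. lphi * (1 + lc) * dist x y \<partial>N)"
    using xy * by (intro integral_mono integrable_abs Bochner_Integration.integrable_diff integrable_phi) auto
  finally show "dist (f x) (f y) \<le> lphi * (1 + lc) * dist x y"
    by (simp add: dist_real_def N.prob_space)
qed (use lphi lc in simp)

text \<open>The value of \<open>c\<close> at a convex combination deviates from the combination of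
  the values by a second-order term with constant \<open>Lc\<close>, which the Lipschitz property of
  \<open>phi\<close> turns into \<open>lphi * Lc\<close>. Weak convexity of \<open>phi\<close>
  between the two pairs costs \<open>lam * (1 + lc\<^sup>2)\<close>, bounded by
  \<open>lamtilde\<close>.\<close>

lemma objective_weakly_convex: "weakly_convex_on (lphi * Lc + lamtilde) Op f"
proof (rule weakly_convex_onI)
  fix x y and u v :: real
  assume *: "x \<in> Op" "y \<in> Op" "0 \<le> u" "0 \<le> v" "u + v = 1"
  let ?p = "u *\<^sub>R x + v *\<^sub>R y" and ?n = "(norm (x - y))\<^sup>2"
  have p: "?p \<in> Op" using * Op by (auto intro: convexD)
  have v: "v = 1 - u" using * by simp
  have split: "a = u *\<^sub>R a + v *\<^sub>R a" for a :: "real^'d"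
    using *(5) by (simp flip: scaleR_add_left)
  have "x - ?p = (u *\<^sub>R x + v *\<^sub>R x) - ?p" "y - ?p = (u *\<^sub>R y + v *\<^sub>R y) - ?p"
    using split by metis+
  then have px: "x - ?p = v *\<^sub>R (x - y)" and py: "y - ?p = - u *\<^sub>R (x - y)"
    by (simp_all add: scaleR_diff_right)
  have tx: "norm (c x - c ?p - J ?p *v (x - ?p)) \<le> Lc / 2 * (v\<^sup>2 * ?n)"
    using linearization_error[OF Op(2) c_differentiable c_smooth p *(1)] *
    unfolding px by (simp add: power_mult_distrib)
  have ty: "norm (c y - c ?p - J ?p *v (y - ?p)) \<le> Lc / 2 * (u\<^sup>2 * ?n)"
    using linearization_error[OF Op(2) c_differentiable c_smooth p *(2)] *
    unfolding py by (simp add: power_mult_distrib)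
  \<comment> \<open>Linearising at \<open>?p\<close> itself makes the Jacobian terms cancel, because
    \<open>?p\<close> is the weighted mean of \<open>x\<close> and \<open>y\<close>.\<close>
  have "u *\<^sub>R (c x - c ?p - J ?p *v (x - ?p)) + v *\<^sub>R (c y - c ?p - J ?p *v (y - ?p))
      = u *\<^sub>R c x + v *\<^sub>R c y - (u + v) *\<^sub>R c ?p - J ?p *v (u *\<^sub>R (x - ?p) + v *\<^sub>R (y - ?p))"
    by (simp add: algebra_simps matrix_vector_mult_scaleR matrix_vector_right_distrib)
  also have "u *\<^sub>R (x - ?p) + v *\<^sub>R (y - ?p) = 0" unfolding px py by (simp add: mult.commute)
  finally have "norm (c ?p - (u *\<^sub>R c x + v *\<^sub>R c y)) =
      norm (u *\<^sub>R (c x - c ?p - J ?p *v (x - ?p)) + v *\<^sub>R (c y - c ?p - J ?p *v (y - ?p)))"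
    using *(5) by (simp add: norm_minus_commute)
  also have "\<dots> \<le> u * norm (c x - c ?p - J ?p *v (x - ?p)) + v * norm (c y - c ?p - J ?p *v (y - ?p))"
    using norm_triangle_ineq[of "u *\<^sub>R (c x - c ?p - J ?p *v (x - ?p))" "v *\<^sub>R (c y - c ?p - J ?p *v (y - ?p))"]
      *(3,4) by simp
  also have "\<dots> \<le> u * (Lc / 2 * (v\<^sup>2 * ?n)) + v * (Lc / 2 * (u\<^sup>2 * ?n))"
    using * tx ty by (intro add_mono mult_left_mono) auto
  also have "\<dots> = Lc / 2 * (u * v * ?n) * (u + v)" by (simp add: algebra_simps power2_eq_square)
  finally have cp: "norm (c ?p - (u *\<^sub>R c x + v *\<^sub>R c y)) \<le> Lc / 2 * (u * v * ?n)" using * by simp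
  have cxy: "(norm (c x - c y))\<^sup>2 \<le> lc\<^sup>2 * ?n"
    using lipschitz_onD[OF c_lipschitz *(1,2)] power_mono[of "norm (c x - c y)" "lc * norm (x - y)" 2]
    by (simp add: dist_norm power_mult_distrib)
  have pw: "phi (?p, c ?p + e) \<le> u * phi (x, c x + e) + v * phi (y, c y + e)
      + (lphi * Lc + lamtilde) / 2 * (u * v * ?n)" for e
  proof -
    have e: "u *\<^sub>R (x, c x + e) + v *\<^sub>R (y, c y + e) = (?p, u *\<^sub>R c x + v *\<^sub>R c y + e)"
    proof -
      have "u *\<^sub>R e + v *\<^sub>R e = e" using *(5) by (simp flip: scaleR_add_left)
      moreover have "u *\<^sub>R (c x + e) + v *\<^sub>R (c y + e)
          = u *\<^sub>R c x + v *\<^sub>R c y + (u *\<^sub>R e + v *\<^sub>R e)" by (simp add: scaleR_add_right)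
      ultimately show ?thesis by simp
    qed
    have "phi (?p, c ?p + e) \<le> phi (?p, u *\<^sub>R c x + v *\<^sub>R c y + e) + lphi * norm (c ?p - (u *\<^sub>R c x + v *\<^sub>R c y))"
      using phi_diff_le[OF p p, of "c ?p + e" "u *\<^sub>R c x + v *\<^sub>R c y + e"] by simp
    moreover have "phi (?p, u *\<^sub>R c x + v *\<^sub>R c y + e) \<le> u * phi (x, c x + e) + v * phi (y, c y + e)
        + lam / 2 * (u * v * (norm ((x, c x + e) - (y, c y + e)))\<^sup>2)"
      using weakly_convex_onD[OF phi_weakly_convex, of "(x, c x + e)" "(y, c y + e)" u v] *
      unfolding e by simp
    moreover have "lam / 2 * (u * v * (norm ((x, c x + e) - (y, c y + e)))\<^sup>2)
        \<le> lam / 2 * (u * v * ((1 + lc)\<^sup>2 * ?n))"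
    proof -
      have "(norm ((x, c x + e) - (y, c y + e)))\<^sup>2 \<le> ?n + lc\<^sup>2 * ?n"
        using cxy by (simp add: norm_Pair)
      also have "\<dots> \<le> (1 + lc)\<^sup>2 * ?n" using lc by (simp add: power2_eq_square algebra_simps)
      finally show ?thesis using * lam by (intro mult_left_mono) auto
    qed
    moreover have "lphi * norm (c ?p - (u *\<^sub>R c x + v *\<^sub>R c y)) \<le> lphi * (Lc / 2 * (u * v * ?n))"
      using cp lphi by (rule mult_left_mono)
    moreover have "lam / 2 * (u * v * ((1 + lc)\<^sup>2 * ?n)) + lphi * (Lc / 2 * (u * v * ?n))
        = (lphi * Lc + lamtilde) / 2 * (u * v * ?n)"
      by (simp add: lamtilde_def field_simps)
    ultimately show ?thesis by linarith
  qed
  have "f ?p \<le> (\<integral>e. u * phi (x, c x + e) + v * phi (y, c y + e) + (lphi * Lc + lamtilde) / 2 * (u * v * ?n) \<partial>N)"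
    unfolding objective_def using * p pw
    by (intro integral_mono Bochner_Integration.integrable_add integrable_mult_right integrable_phi) auto
  also have "\<dots> = u * f x + v * f y + (lphi * Lc + lamtilde) / 2 * (u * v * ?n)"
    unfolding objective_def using * by (simp add: integrable_phi N.prob_space)
  finally show "f ?p \<le> u * f x + v * f y + (lphi * Lc + lamtilde) / 2 * (u * v * ?n)" .
qed (rule Op)

end

lemma le_divide_of_square_le:
  fixes x a b :: real
  assumes "0 < a" "0 \<le> b" "0 \<le> x" "a * x\<^sup>2 \<le> b * x"
  shows "x \<le> b / a"
proof (cases "x = 0")
  case False
  then have "(a * x) * x \<le> b * x" and "0 < x" using assms by (auto simp: power2_eq_square)
  then show ?thesis using assms(1) by (simp add: pos_le_divide_eq mult.commute)
qed (use assms in simp)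

section \<open>The proximal point and the sampled step\<close>

context composite_problem
begin

lemma X_subset: "x \<in> X \<Longrightarrow> x \<in> Op" using Op by blast

lemma objective_continuous: "continuous_on X f"
  using lipschitz_on_continuous_on[OF objective_lipschitz] Op continuous_on_subset by blast

text \<open>\<open>prox_point\<close> is a choice operator, so a minimiser has to be exhibited
  first. The lower bound of \<open>f\<close> on \<open>X\<close> together with the quadratic gives
  coercivity, and \<open>rho\<close> exceeding the modulus of \<open>f\<close> gives growth.\<close>

lemma prox: "P x \<in> X"
  and prox_growth: "y \<in> X \<Longrightarrow> f (P x) + rho / 2 * (norm (P x - x))\<^sup>2
    + (rho - lphi * Lc - lamtilde) / 2 * (norm (y - P x))\<^sup>2 \<le> f y + rho / 2 * (norm (y - x))\<^sup>2"
proof -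
  let ?g = "\<lambda>y. f y + rho / 2 * (norm (y - x))\<^sup>2"
  obtain B where B: "\<And>y. y \<in> X \<Longrightarrow> B \<le> f y" using objective_bounded unfolding bdd_below_def by auto
  have "continuous_on X ?g" by (intro continuous_intros objective_continuous)
  then obtain Z where Z: "Z \<in> X" "\<And>y. y \<in> X \<Longrightarrow> ?g Z \<le> ?g y"
    using coercive_attains_inf[OF X(2,1), of ?g "rho / 2" B x] rho_pos B by auto
  have "P x \<in> X \<and> (\<forall>y\<in>X. ?g (P x) \<le> ?g y)"
    unfolding prox_point_def arg_min_on_def
    by (rule arg_minI[of _ Z]) (use Z in \<open>auto simp: not_less\<close>)
  then have P: "P x \<in> X" "\<And>y. y \<in> X \<Longrightarrow> ?g (P x) \<le> ?g y" by auto
  show "P x \<in> X" by fact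
  have "weakly_convex_on ((lphi * Lc + lamtilde) - rho) X ?g"
    using weakly_convex_on_add_square[OF weakly_convex_on_subset[OF objective_weakly_convex Op(3) X(3)]] .
  then have wc: "weakly_convex_on (- (rho - lphi * Lc - lamtilde)) X ?g" by (simp add: algebra_simps)
  show "f (P x) + rho / 2 * (norm (P x - x))\<^sup>2
    + (rho - lphi * Lc - lamtilde) / 2 * (norm (y - P x))\<^sup>2 \<le> f y + rho / 2 * (norm (y - x))\<^sup>2" if "y \<in> X"
    using minimizer_quadratic_growth[OF wc P that] .
qed

lemma prox_le: "y \<in> X \<Longrightarrow> f (P x) + rho / 2 * (norm (P x - x))\<^sup>2 \<le> f y + rho / 2 * (norm (y - x))\<^sup>2"
proof -
  assume y: "y \<in> X"
  have "0 \<le> (rho - lphi * Lc - lamtilde) / 2 * (norm (y - P x))\<^sup>2" using rho_gt by simp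
  then show ?thesis using prox_growth[OF y, of x] by linarith
qed

lemma moreau_envelope_eq: "moreau_envelope X f rho x = f (P x) + rho / 2 * (norm (P x - x))\<^sup>2"
  unfolding moreau_envelope_def
  by (rule cInf_eq_minimum) (use prox prox_le in auto)

lemma moreau_envelope_le: "y \<in> X \<Longrightarrow> moreau_envelope X f rho x \<le> f y + rho / 2 * (norm (y - x))\<^sup>2"
  unfolding moreau_envelope_eq by (rule prox_le)

lemma inf_le_moreau_envelope: "(INF y\<in>X. f y) \<le> moreau_envelope X f rho x"
proof -
  have "(INF y\<in>X. f y) \<le> f (P x)" using objective_bounded prox by (intro cINF_lower) auto
  also have "\<dots> \<le> moreau_envelope X f rho x" unfolding moreau_envelope_eq using rho_pos by simp
  finally show ?thesis .
qed

lemma prox_measurable [measurable]: "P \<in> borel_measurable borel"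
proof (rule borel_measurable_minimizer[OF X(1), where mu = "(rho - lphi * Lc - lamtilde) / 2"
      and g = "\<lambda>x y. f y + rho / 2 * (norm (y - x))\<^sup>2"])
  show "continuous_on X (\<lambda>y. f y + rho / 2 * (norm (y - x))\<^sup>2)" for x
    by (intro continuous_intros objective_continuous)
qed (use rho_gt prox prox_growth in auto)

lemma prox_stationary: "stationarity_gap X f (P x) \<le> ennreal (rho * norm (x - P x))"
proof (rule stationarity_gap_le[OF Op(1) _ X(3) Op(3) _ prox])
  \<comment> \<open>The modulus of \<open>f\<close> is enlarged to \<open>rho\<close>, which the
    proximal quadratic compensates exactly.\<close>
  show "weakly_convex_on rho Op f"
  proof (rule weakly_convex_onI[OF Op(2)])
    fix x y and u v :: real
    assume *: "x \<in> Op" "y \<in> Op" "0 \<le> u" "0 \<le> v" "u + v = 1"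
    have "(lphi * Lc + lamtilde) / 2 * (u * v * (norm (x - y))\<^sup>2) \<le> rho / 2 * (u * v * (norm (x - y))\<^sup>2)"
      using rho_gt * by (intro mult_right_mono) auto
    then show "f (u *\<^sub>R x + v *\<^sub>R y) \<le> u * f x + v * f y + rho / 2 * (u * v * (norm (x - y))\<^sup>2)"
      using weakly_convex_onD[OF objective_weakly_convex *] by linarith
  qed
qed (use rho_pos prox_le in auto)

definition lin :: "real^'d \<Rightarrow> real^'d^'l \<Rightarrow> real^'l \<Rightarrow> real^'d \<Rightarrow> real" where
  "lin z A w y = phi (y, w + A *v (y - z))"

text \<open>A function of the data, so that stability and measurability can be stated. A run only
  asserts that its iterate is some minimiser; \<open>is_arg_min_step\<close> identifies the
  two.\<close>

definition step :: "nat \<Rightarrow> real \<Rightarrow> real^'d \<Rightarrow> real^'d^'l \<Rightarrow> (nat \<Rightarrow> real^'l) \<Rightarrow> real^'d" where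
  "step m a z A W = arg_min_on (spl_model phi m a z W A) X"

lemma spl_model_lin: "spl_model phi m a z W A y = (\<Sum>i<m. lin z A (W i) y) / real m + a / 2 * (norm (y - z))\<^sup>2"
  unfolding spl_model_def lin_def ..

lemma lin_lipschitz:
  assumes A: "opnorm A \<le> lhat" and "y \<in> X" "y' \<in> X"
  shows "\<bar>lin z A w y - lin z A w y'\<bar> \<le> Lmod * norm (y - y')"
proof -
  have "A *v (y - z) - A *v (y' - z) = A *v (y - y')"
    by (simp add: matrix_vector_mult_diff_distrib)
  then have "norm ((w + A *v (y - z)) - (w + A *v (y' - z))) \<le> opnorm A * norm (y - y')"
    using norm_matrix_vector_le_opnorm[of A "y - y'"] by simp
  also have "\<dots> \<le> lhat * norm (y - y')" using A by (intro mult_right_mono) auto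
  finally have le: "norm ((w + A *v (y - z)) - (w + A *v (y' - z))) \<le> lhat * norm (y - y')" .
  have "\<bar>lin z A w y - lin z A w y'\<bar> \<le> lphi * (norm (y - y') + norm ((w + A *v (y - z)) - (w + A *v (y' - z))))"
    unfolding lin_def using assms by (intro phi_diff_le X_subset)
  also have "\<dots> \<le> lphi * (norm (y - y') + lhat * norm (y - y'))"
    using le lphi by (intro mult_left_mono add_left_mono) auto
  finally show ?thesis by (simp add: Lmod_def algebra_simps)
qed

text \<open>The decision enters \<open>phi\<close> through an affine map, so no curvature term as in
  the objective arises; the modulus only grows by the stretch \<open>1 + lhat\<^sup>2\<close>,
  bounded by \<open>(1 + lhat)\<^sup>2\<close>.\<close>

lemma lin_weakly_convex:
  assumes A: "opnorm A \<le> lhat"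
  shows "weakly_convex_on lamhat X (lin z A w)"
proof (rule weakly_convex_onI[OF X(3)])
  fix x y and u v :: real
  assume *: "x \<in> X" "y \<in> X" "0 \<le> u" "0 \<le> v" "u + v = 1"
  have split: "a = u *\<^sub>R a + v *\<^sub>R a" for a :: "'b::real_vector"
    using *(5) by (simp flip: scaleR_add_left)
  have "w + A *v (u *\<^sub>R x + v *\<^sub>R y - z) = (u *\<^sub>R w + v *\<^sub>R w) + A *v (u *\<^sub>R x + v *\<^sub>R y - (u *\<^sub>R z + v *\<^sub>R z))"
    using split by metis
  also have "u *\<^sub>R x + v *\<^sub>R y - (u *\<^sub>R z + v *\<^sub>R z) = u *\<^sub>R (x - z) + v *\<^sub>R (y - z)"
    by (simp add: scaleR_diff_right)
  also have "(u *\<^sub>R w + v *\<^sub>R w) + A *v (u *\<^sub>R (x - z) + v *\<^sub>R (y - z))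
      = u *\<^sub>R (w + A *v (x - z)) + v *\<^sub>R (w + A *v (y - z))"
    by (simp add: matrix_vector_right_distrib matrix_vector_mult_scaleR scaleR_add_right)
  finally have e: "(u *\<^sub>R x + v *\<^sub>R y, w + A *v (u *\<^sub>R x + v *\<^sub>R y - z))
      = u *\<^sub>R (x, w + A *v (x - z)) + v *\<^sub>R (y, w + A *v (y - z))" by simp
  have "A *v (x - z) - A *v (y - z) = A *v (x - y)"
    by (simp add: matrix_vector_mult_diff_distrib)
  then have "norm (A *v (x - z) - A *v (y - z)) \<le> lhat * norm (x - y)"
    using norm_matrix_vector_le_opnorm[of A "x - y"] mult_right_mono[OF A norm_ge_zero[of "x - y"]] by simp
  then have "(norm (A *v (x - z) - A *v (y - z)))\<^sup>2 \<le> (lhat * norm (x - y))\<^sup>2"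
    by (intro power_mono) auto
  then have "(norm ((x, w + A *v (x - z)) - (y, w + A *v (y - z))))\<^sup>2 \<le> (norm (x - y))\<^sup>2 + lhat\<^sup>2 * (norm (x - y))\<^sup>2"
    by (simp add: norm_Pair power_mult_distrib)
  also have "\<dots> \<le> (1 + lhat)\<^sup>2 * (norm (x - y))\<^sup>2"
    using lhat by (simp add: power2_eq_square algebra_simps)
  finally have n: "lam / 2 * (u * v * (norm ((x, w + A *v (x - z)) - (y, w + A *v (y - z))))\<^sup>2)
      \<le> lam / 2 * (u * v * ((1 + lhat)\<^sup>2 * (norm (x - y))\<^sup>2))"
    using lam * by (intro mult_left_mono) auto
  have "lin z A w (u *\<^sub>R x + v *\<^sub>R y) \<le> u * lin z A w x + v * lin z A w y
      + lam / 2 * (u * v * (norm ((x, w + A *v (x - z)) - (y, w + A *v (y - z))))\<^sup>2)"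
    unfolding lin_def e using * by (intro weakly_convex_onD[OF phi_weakly_convex]) (auto intro: X_subset)
  then show "lin z A w (u *\<^sub>R x + v *\<^sub>R y) \<le> u * lin z A w x + v * lin z A w y
      + lamhat / 2 * (u * v * (norm (x - y))\<^sup>2)"
    using n by (simp add: lamhat_def field_simps)
qed

context
  fixes m :: nat and a :: real and z :: "real^'d" and A :: "real^'d^'l"
  assumes m: "0 < m" and a: "lamhat < a" and z: "z \<in> X" and A: "opnorm A \<le> lhat"
begin

lemma a_pos: "0 < a" using a lamhat_nonneg by simp

lemma mean_lin_lipschitz:
  assumes "y \<in> X" "y' \<in> X"
  shows "\<bar>(\<Sum>i<m. lin z A (W i) y) / real m - (\<Sum>i<m. lin z A (W i) y') / real m\<bar> \<le> Lmod * norm (y - y')"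
proof -
  have "\<bar>(\<Sum>i<m. lin z A (W i) y - lin z A (W i) y')\<bar> \<le> (\<Sum>i<m. \<bar>lin z A (W i) y - lin z A (W i) y'\<bar>)"
    by (rule sum_abs)
  also have "\<dots> \<le> (\<Sum>i<m. Lmod * norm (y - y'))"
    using A assms by (intro sum_mono lin_lipschitz)
  finally show ?thesis using m
    by (simp add: sum_subtractf diff_divide_distrib[symmetric] abs_divide pos_divide_le_eq mult.commute)
qed

lemma spl_model_strongly_convex: "weakly_convex_on (- (a - lamhat)) X (spl_model phi m a z W A)"
proof -
  have "weakly_convex_on lamhat X (\<lambda>y. (\<Sum>i<m. lin z A (W i) y) / real m)"
  proof (rule weakly_convex_onI[OF X(3)])
    fix x y and u v :: real
    assume *: "x \<in> X" "y \<in> X" "0 \<le> u" "0 \<le> v" "u + v = 1"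
    have "(\<Sum>i<m. lin z A (W i) (u *\<^sub>R x + v *\<^sub>R y)) \<le>
        (\<Sum>i<m. u * lin z A (W i) x + v * lin z A (W i) y + lamhat / 2 * (u * v * (norm (x - y))\<^sup>2))"
      by (intro sum_mono weakly_convex_onD[OF lin_weakly_convex[OF A]] *)
    also have "\<dots> = u * (\<Sum>i<m. lin z A (W i) x) + v * (\<Sum>i<m. lin z A (W i) y)
        + real m * (lamhat / 2 * (u * v * (norm (x - y))\<^sup>2))"
      by (simp add: sum.distrib sum_distrib_left)
    finally have "(\<Sum>i<m. lin z A (W i) (u *\<^sub>R x + v *\<^sub>R y)) / real m \<le>
      (u * (\<Sum>i<m. lin z A (W i) x) + v * (\<Sum>i<m. lin z A (W i) y)
        + real m * (lamhat / 2 * (u * v * (norm (x - y))\<^sup>2))) / real m"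
      by (intro divide_right_mono) auto
    then show "(\<Sum>i<m. lin z A (W i) (u *\<^sub>R x + v *\<^sub>R y)) / real m \<le>
      u * ((\<Sum>i<m. lin z A (W i) x) / real m) + v * ((\<Sum>i<m. lin z A (W i) y) / real m)
        + lamhat / 2 * (u * v * (norm (x - y))\<^sup>2)"
      using m by (simp add: add_divide_distrib)
  qed
  from weakly_convex_on_add_square[OF this, of a z] show ?thesis
    unfolding spl_model_lin by simp
qed

lemma spl_model_continuous: "continuous_on X (spl_model phi m a z W A)"
proof -
  have "Lmod-lipschitz_on X (\<lambda>y. (\<Sum>i<m. lin z A (W i) y) / real m)"
    using mean_lin_lipschitz Lmod_nonneg by (intro lipschitz_onI) (auto simp: dist_norm dist_real_def)
  then show ?thesis
    unfolding spl_model_lin by (intro continuous_intros lipschitz_on_continuous_on)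
qed

lemma step_in: "step m a z A W \<in> X"
  and step_growth: "y \<in> X \<Longrightarrow> spl_model phi m a z W A (step m a z A W)
    + (a - lamhat) / 2 * (norm (y - step m a z A W))\<^sup>2 \<le> spl_model phi m a z W A y"
proof -
  let ?g = "spl_model phi m a z W A"
  \<comment> \<open>Half of the proximal quadratic absorbs the linear decrease
    \<open>Lmod * norm (y - z)\<close> at the price \<open>Lmod\<^sup>2 / a\<close>; the other half
    is left as coercivity.\<close>
  let ?B = "(\<Sum>i<m. lin z A (W i) z) / real m - Lmod\<^sup>2 / a"
  have coercive: "?B + a / 4 * (norm (y - z))\<^sup>2 \<le> ?g y" if "y \<in> X" for y
  proof -
    let ?s = "norm (y - z)"
    have "0 \<le> a / 4 * (?s - 2 * Lmod / a)\<^sup>2" using a_pos by simp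
    also have "\<dots> = a / 4 * ?s\<^sup>2 - Lmod * ?s + Lmod\<^sup>2 / a"
      using a_pos by (simp add: power2_eq_square field_simps)
    finally show ?thesis
      unfolding spl_model_lin using mean_lin_lipschitz[OF that z, of W] by simp
  qed
  obtain Z where Z: "Z \<in> X" "\<And>y. y \<in> X \<Longrightarrow> ?g Z \<le> ?g y"
    using coercive_attains_inf[OF X(2,1) spl_model_continuous, of "a / 4" ?B z W] a_pos coercive by auto
  have "step m a z A W \<in> X \<and> (\<forall>y\<in>X. ?g (step m a z A W) \<le> ?g y)"
    unfolding step_def arg_min_on_def
    by (rule arg_minI[of _ Z]) (use Z in \<open>auto simp: not_less\<close>)
  then have S: "step m a z A W \<in> X" "\<And>y. y \<in> X \<Longrightarrow> ?g (step m a z A W) \<le> ?g y" by auto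
  show "step m a z A W \<in> X" by fact
  show "?g (step m a z A W) + (a - lamhat) / 2 * (norm (y - step m a z A W))\<^sup>2 \<le> ?g y" if "y \<in> X"
    using minimizer_quadratic_growth[OF spl_model_strongly_convex S that] .
qed

lemma is_arg_min_step:
  assumes "is_arg_min (spl_model phi m a z W A) (\<lambda>y. y \<in> X) y"
  shows "y = step m a z A W"
proof -
  have "y \<in> X" "spl_model phi m a z W A y \<le> spl_model phi m a z W A (step m a z A W)"
    using assms step_in[of W] by (auto simp: is_arg_min_linorder)
  then have "(a - lamhat) / 2 * (norm (y - step m a z A W))\<^sup>2 \<le> 0" using step_growth[of y W] by simp
  then show ?thesis using a by (auto simp: mult_le_0_iff)
qed

text \<open>Comparison with staying at \<open>z\<close>: moving by \<open>s\<close> gains at most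
  \<open>Lmod * s\<close> and costs \<open>a / 2 * s\<^sup>2\<close>. The bound is the same for all
  samples, which makes the later integrands bounded.\<close>

lemma step_dist: "norm (step m a z A W - z) \<le> 2 * Lmod / a"
proof -
  let ?s = "norm (step m a z A W - z)"
  have "a / 2 * ?s\<^sup>2 \<le> Lmod * ?s"
  proof -
    have "0 \<le> (a - lamhat) / 2 * (norm (z - step m a z A W))\<^sup>2" using a by simp
    moreover have "a / 2 * (norm (z - z))\<^sup>2 = 0" by simp
    ultimately show ?thesis
      using step_growth[OF z, of W] mean_lin_lipschitz[OF step_in z, of W W]
      unfolding spl_model_lin by linarith
  qed
  from le_divide_of_square_le[OF _ _ _ this] show ?thesis using a_pos Lmod_nonneg by (simp add: mult.commute)
qed

text \<open>The growth inequalities of the two models at each other's minimiser are added; all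
  samples except the \<open>i\<close>-th cancel, and what remains has weight
  \<open>1 / real m\<close>.\<close>

lemma step_stable:
  assumes i: "i < m"
  shows "norm (step m a z A (W(i := w)) - step m a z A W) \<le> 2 * Lmod / (real m * (a - lamhat))"
proof -
  define Z where "Z = step m a z A W"
  define Z' where "Z' = step m a z A (W(i := w))"
  let ?d = "norm (Z' - Z)"
  have ZX: "Z \<in> X" "Z' \<in> X" unfolding Z_def Z'_def by (rule step_in)+
  define R where "R y = (\<Sum>j\<in>{..<m} - {i}. lin z A (W j) y)" for y
  have s: "(\<Sum>j<m. lin z A (W j) y) = lin z A (W i) y + R y"
    "(\<Sum>j<m. lin z A ((W(i := w)) j) y) = lin z A w y + R y" for y
    using i by (simp_all add: R_def sum.remove[of "{..<m}" i])
  have "spl_model phi m a z W A Z + (a - lamhat) / 2 * ?d\<^sup>2 \<le> spl_model phi m a z W A Z'"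
    unfolding Z_def using ZX(2) by (rule step_growth)
  moreover have "(a - lamhat) * ?d\<^sup>2 = 2 * ((a - lamhat) / 2 * ?d\<^sup>2)" by simp
  moreover have "spl_model phi m a z (W(i := w)) A Z' + (a - lamhat) / 2 * ?d\<^sup>2 \<le> spl_model phi m a z (W(i := w)) A Z"
    unfolding Z'_def norm_minus_commute[of "step m a z A (W(i := w))"] using ZX(1) by (rule step_growth)
  ultimately have "(a - lamhat) * ?d\<^sup>2 \<le>
      ((lin z A (W i) Z' - lin z A (W i) Z) + (lin z A w Z - lin z A w Z')) / real m"
    unfolding spl_model_lin s add_divide_distrib diff_divide_distrib[of "_ - _"]
      diff_divide_distrib[of "lin _ _ _ _"] by linarith
  also have "\<dots> \<le> (Lmod * ?d + Lmod * ?d) / real m"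
    using lin_lipschitz[OF A ZX(2,1), of z "W i"] lin_lipschitz[OF A ZX, of z w]
    by (intro divide_right_mono add_mono) (auto simp: norm_minus_commute)
  finally have "real m * (a - lamhat) * ?d\<^sup>2 \<le> 2 * Lmod * ?d"
    using m by (simp add: field_simps)
  from le_divide_of_square_le[OF _ _ _ this] have "?d \<le> 2 * Lmod / (real m * (a - lamhat))"
    using a m Lmod_nonneg by simp
  then show ?thesis unfolding Z_def Z'_def .
qed

end

lemma step_measurable:
  assumes m: "0 < m" and a: "lamhat < a"
    and [measurable]: "zz \<in> borel_measurable M" "AA \<in> borel_measurable M"
      "\<And>i. i < m \<Longrightarrow> (\<lambda>p. WW p i) \<in> borel_measurable M"
    and zX: "\<And>p. p \<in> space M \<Longrightarrow> zz p \<in> X" and AA: "\<And>p. p \<in> space M \<Longrightarrow> opnorm (AA p) \<le> lhat"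
  shows "(\<lambda>p. step m a (zz p) (AA p) (WW p)) \<in> borel_measurable M"
proof (rule borel_measurable_minimizer[OF X(1), where mu = "(a - lamhat) / 2"
      and g = "\<lambda>p. spl_model phi m a (zz p) (WW p) (AA p)"])
  fix y assume "y \<in> X"
  then have [measurable]: "i < m \<Longrightarrow> (\<lambda>p. phi (y, WW p i + AA p *v (y - zz p))) \<in> borel_measurable M" for i
    by (intro phi_measurable) (auto intro: X_subset)
  show "(\<lambda>p. spl_model phi m a (zz p) (WW p) (AA p) y) \<in> borel_measurable M"
    unfolding spl_model_def by measurable
qed (use a spl_model_continuous[OF m a zX AA] step_in[OF m a zX AA] step_growth[OF m a zX AA] in auto)

end

section \<open>Stability of the sampled step\<close>

text \<open>
  The heart of the stability argument: if the decision depends on an observation, replacing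
  that observation by an independent copy changes the expected loss by at most the stability
  constant \<open>k\<close>, because the two copies can be exchanged.
\<close>

lemma (in prob_space) integral_exchange_le:
  fixes h :: "'a \<Rightarrow> 'a \<Rightarrow> real"
  assumes [measurable]: "(\<lambda>(x, w). h x w) \<in> borel_measurable (M \<Otimes>\<^sub>M M)"
    and bound: "\<And>x w. x \<in> space M \<Longrightarrow> w \<in> space M \<Longrightarrow> \<bar>h x w\<bar> \<le> B"
    and stable: "\<And>x w. x \<in> space M \<Longrightarrow> w \<in> space M \<Longrightarrow> h x w \<le> h w w + k"
  shows "(\<integral>x. \<integral>w. h x w \<partial>M \<partial>M) \<le> (\<integral>w. h w w \<partial>M) + k"
proof -
  interpret P2: pair_prob_space M M ..
  have int: "integrable (M \<Otimes>\<^sub>M M) (\<lambda>(x, w). h x w)"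
    by (rule P2.P.integrable_const_bound[where B = B]) (auto intro!: AE_I2 bound simp: space_pair_measure)
  have diag: "integrable M (\<lambda>w. h w w)"
    by (rule integrable_const_bound[where B = B]) (auto intro!: AE_I2 bound)
  have sec: "integrable M (\<lambda>x. h x w)" if "w \<in> space M" for w
    using that by (intro integrable_const_bound[where B = B]) (auto intro!: AE_I2 bound)
  \<comment> \<open>After the swap the test point \<open>w\<close> is fixed in the inner integral,
    where the training point \<open>x\<close> may be replaced by \<open>w\<close> at cost
    \<open>k\<close>.\<close>
  have "(\<integral>x. \<integral>w. h x w \<partial>M \<partial>M) = (\<integral>w. \<integral>x. h x w \<partial>M \<partial>M)"
    using P2.Fubini_integral[OF int] by simp
  also have "\<dots> \<le> (\<integral>w. h w w + k \<partial>M)"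
  proof (rule integral_mono)
    show "integrable M (\<lambda>w. \<integral>x. h x w \<partial>M)" using P2.integrable_snd[OF int] by simp
    show "integrable M (\<lambda>w. h w w + k)" using diag by simp
    fix w assume w: "w \<in> space M"
    have "(\<integral>x. h x w \<partial>M) \<le> (\<integral>x. h w w + k \<partial>M)"
      using w sec stable by (intro integral_mono) auto
    then show "(\<integral>x. h x w \<partial>M) \<le> h w w + k" by (simp add: prob_space)
  qed
  also have "\<dots> = (\<integral>w. h w w \<partial>M) + k" using diag by (simp add: prob_space)
  finally show ?thesis .
qed

context composite_problem
begin

lemma prob_space_outcome_law: "prob_space (outcome_law c N z)"
proof -
  interpret N: prob_space N by (rule N)
  show ?thesis unfolding outcome_law_def by (rule N.prob_space_distr) simp
qed

lemma sets_outcome_law [measurable_cong]: "sets (outcome_law c N z) = sets borel"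
  unfolding outcome_law_def by auto

lemma prob_space_sample_law: "prob_space (sample_law c N m z)"
  unfolding sample_law_def by (intro prob_space_PiM prob_space_outcome_law)

lemma sets_sample_law [measurable_cong]: "sets (sample_law c N m z) = sets (Pi\<^sub>M {..<m} (\<lambda>_. borel))"
  unfolding sample_law_def by (intro sets_PiM_cong) (auto simp: sets_outcome_law)

text \<open>Centring at \<open>z\<close> makes the loss bounded in \<open>w\<close>, so that all integrals below exist.\<close>

definition ulin :: "real^'d \<Rightarrow> real^'d^'l \<Rightarrow> real^'l \<Rightarrow> real^'d \<Rightarrow> real" where
  "ulin z A w y = lin z A w y - lin z A w z"

definition Ulin :: "real^'d \<Rightarrow> real^'d^'l \<Rightarrow> real^'d \<Rightarrow> real" where
  "Ulin z A y = (\<integral>w. ulin z A w y \<partial>outcome_law c N z)"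

lemma ulin_bound: "opnorm A \<le> lhat \<Longrightarrow> z \<in> X \<Longrightarrow> y \<in> X \<Longrightarrow> \<bar>ulin z A w y\<bar> \<le> Lmod * norm (y - z)"
  unfolding ulin_def by (rule lin_lipschitz)

lemma ulin_measurable:
  assumes "g \<in> borel_measurable M" "v \<in> borel_measurable M" "\<And>p. p \<in> space M \<Longrightarrow> g p \<in> X" "z \<in> X"
  shows "(\<lambda>p. ulin z A (v p) (g p)) \<in> borel_measurable M"
  unfolding ulin_def lin_def using assms
  by (intro borel_measurable_diff phi_measurable borel_measurable_add borel_measurable_matrix_vector_mult)
     (auto intro: X_subset)

lemma integrable_ulin:
  assumes "opnorm A \<le> lhat" "z \<in> X" "y \<in> X"
  shows "integrable (outcome_law c N z) (\<lambda>w. ulin z A w y)"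
proof -
  interpret Q: prob_space "outcome_law c N z" by (rule prob_space_outcome_law)
  have [measurable]: "(\<lambda>w. ulin z A w y) \<in> borel_measurable borel"
    using assms by (intro ulin_measurable) auto
  show ?thesis
    using ulin_bound[OF assms] by (intro Q.integrable_const_bound[where B = "Lmod * norm (y - z)"]) auto
qed

text \<open>Both quantities are integrals over the same noise \<open>e\<close>, which cancels in the
  difference of outcomes; what remains is the linearisation error of \<open>c\<close> and the matrix
  error applied to \<open>y - z\<close>.\<close>

lemma Ulin_objective:
  assumes A: "opnorm A \<le> lhat" and z: "z \<in> X" and y: "y \<in> X"
  shows "\<bar>(f y - f z) - Ulin z A y\<bar>
    \<le> lphi * (Lc / 2 * (norm (y - z))\<^sup>2 + opnorm (A - J z) * norm (y - z))"
proof -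
  interpret N: prob_space N by (rule N)
  have zy: "z \<in> Op" "y \<in> Op" using z y X_subset by auto
  have [measurable]: "(\<lambda>w. ulin z A w y) \<in> borel_measurable borel"
    using y z by (intro ulin_measurable) auto
  have "Ulin z A y = (\<integral>e. ulin z A (c z + e) y \<partial>N)"
    unfolding Ulin_def outcome_law_def by (subst integral_distr) auto
  also have "\<dots> = (\<integral>e. phi (y, c z + A *v (y - z) + e) - phi (z, c z + e) \<partial>N)"
    by (simp add: ulin_def lin_def add_ac)
  finally have "(f y - f z) - Ulin z A y = (\<integral>e. phi (y, c y + e) - phi (z, c z + e) -
      (phi (y, c z + A *v (y - z) + e) - phi (z, c z + e)) \<partial>N)"
    unfolding objective_def by (simp add: integrable_phi zy)
  also have "\<dots> = (\<integral>e. phi (y, c y + e) - phi (y, c z + A *v (y - z) + e) \<partial>N)" by simp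
  also have "\<bar>\<dots>\<bar> \<le> (\<integral>e. \<bar>phi (y, c y + e) - phi (y, c z + A *v (y - z) + e)\<bar> \<partial>N)"
    by (rule integral_abs_bound)
  also have "\<dots> \<le> (\<integral>e. lphi * (Lc / 2 * (norm (y - z))\<^sup>2 + opnorm (A - J z) * norm (y - z)) \<partial>N)"
  proof (rule integral_mono)
    fix e
    have e: "(c y + e) - (c z + A *v (y - z) + e) = (c y - c z - J z *v (y - z)) - (A - J z) *v (y - z)"
      by (simp add: matrix_vector_mult_diff_rdistrib)
    have "norm ((c y + e) - (c z + A *v (y - z) + e))
        \<le> norm (c y - c z - J z *v (y - z)) + norm ((A - J z) *v (y - z))"
      unfolding e by (rule norm_triangle_ineq4)
    also have "\<dots> \<le> Lc / 2 * (norm (y - z))\<^sup>2 + opnorm (A - J z) * norm (y - z)"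
      by (intro add_mono linearization_error[OF Op(2) c_differentiable c_smooth zy] norm_matrix_vector_le_opnorm)
    finally have le: "lphi * norm ((c y + e) - (c z + A *v (y - z) + e))
        \<le> lphi * (Lc / 2 * (norm (y - z))\<^sup>2 + opnorm (A - J z) * norm (y - z))"
      using lphi by (rule mult_left_mono)
    then show "\<bar>phi (y, c y + e) - phi (y, c z + A *v (y - z) + e)\<bar>
        \<le> lphi * (Lc / 2 * (norm (y - z))\<^sup>2 + opnorm (A - J z) * norm (y - z))"
      using phi_diff_le[OF zy(2,2), of "c y + e" "c z + A *v (y - z) + e"] by simp
  qed (use zy in \<open>auto intro!: integrable_phi\<close>)
  finally show ?thesis by (simp add: N.prob_space)
qed

context
  fixes m :: nat and a :: real and z :: "real^'d" and A :: "real^'d^'l"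
  assumes m: "0 < m" and a: "lamhat < a" and z: "z \<in> X" and A: "opnorm A \<le> lhat"
begin

lemma step_sample_measurable:
  "step m a z A \<in> borel_measurable (sample_law c N m z)"
proof -
  have "(\<lambda>W. step m a z A W) \<in> borel_measurable (Pi\<^sub>M {..<m} (\<lambda>_. borel))"
    using z A by (intro step_measurable[OF m a]) auto
  then show ?thesis by simp
qed

lemma ulin_step_bound: "\<bar>ulin z A w (step m a z A W)\<bar> \<le> Lmod * (2 * Lmod / a)"
proof -
  have "\<bar>ulin z A w (step m a z A W)\<bar> \<le> Lmod * norm (step m a z A W - z)"
    using A z step_in[OF m a z A] by (intro ulin_bound)
  also have "\<dots> \<le> Lmod * (2 * Lmod / a)"
    using step_dist[OF m a z A] Lmod_nonneg by (intro mult_left_mono)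
  finally show ?thesis .
qed

lemma Ulin_bound:
  assumes y: "y \<in> X" shows "\<bar>Ulin z A y\<bar> \<le> Lmod * norm (y - z)"
proof -
  interpret Q: prob_space "outcome_law c N z" by (rule prob_space_outcome_law)
  have "\<bar>Ulin z A y\<bar> \<le> (\<integral>w. \<bar>ulin z A w y\<bar> \<partial>outcome_law c N z)"
    unfolding Ulin_def by (rule integral_abs_bound)
  also have "\<dots> \<le> (\<integral>w. Lmod * norm (y - z) \<partial>outcome_law c N z)"
    using ulin_bound[OF A z y] integrable_ulin[OF A z y] by (intro integral_mono integrable_abs) auto
  finally show ?thesis by (simp add: Q.prob_space)
qed

lemma Ulin_step_bound: "\<bar>Ulin z A (step m a z A W)\<bar> \<le> Lmod * (2 * Lmod / a)"
  using Ulin_bound[OF step_in[OF m a z A], of W] mult_left_mono[OF step_dist[OF m a z A, of W] Lmod_nonneg]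
  by linarith

lemma Ulin_step_measurable: "(\<lambda>W. Ulin z A (step m a z A W)) \<in> borel_measurable (sample_law c N m z)"
proof -
  interpret Q: prob_space "outcome_law c N z" by (rule prob_space_outcome_law)
  note [measurable] = step_sample_measurable
  have "(\<lambda>(W, w). ulin z A w (step m a z A W)) \<in> borel_measurable (sample_law c N m z \<Otimes>\<^sub>M outcome_law c N z)"
    unfolding split_beta' using step_in[OF m a z A] z by (intro ulin_measurable) auto
  then show ?thesis unfolding Ulin_def by measurable
qed

lemma ulin_step_measurable:
  assumes "i < m"
  shows "(\<lambda>W. ulin z A (W i) (step m a z A W)) \<in> borel_measurable (sample_law c N m z)"
proof (rule ulin_measurable[OF step_sample_measurable])
  show "(\<lambda>W. W i) \<in> borel_measurable (sample_law c N m z)"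
    unfolding measurable_cong_sets[OF sets_sample_law refl]
    by (rule measurable_component_singleton) (use assms in simp)
qed (rule step_in[OF m a z A] z)+

text \<open>Writing the sample as \<open>V(i := x)\<close> isolates the observation \<open>x\<close>
  that is both trained on and tested. The left-hand side tests the same decision on an independent
  \<open>w\<close>, so \<open>integral_exchange_le\<close> applies for each fixed
  \<open>V\<close>.\<close>

lemma stability_component:
  assumes i: "i < m"
  shows "(\<integral>W. Ulin z A (step m a z A W) \<partial>sample_law c N m z)
    \<le> (\<integral>W. ulin z A (W i) (step m a z A W) \<partial>sample_law c N m z) + 2 * Lmod\<^sup>2 / (real m * (a - lamhat))"
proof -
  let ?Q = "outcome_law c N z"
  interpret Q: prob_space ?Q by (rule prob_space_outcome_law)
  interpret product_prob_space "\<lambda>_ :: nat. ?Q" by standard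
  interpret W: prob_space "sample_law c N m z" by (rule prob_space_sample_law)
  let ?I = "{..<m} - {i}"
  have ins: "insert i ?I = {..<m}" using i by auto
  let ?k = "2 * Lmod\<^sup>2 / (real m * (a - lamhat))"
  let ?PI = "Pi\<^sub>M ?I (\<lambda>_. ?Q)"
  interpret PI: prob_space ?PI by (intro prob_space_PiM prob_space_outcome_law)
  have law: "sample_law c N m z = Pi\<^sub>M (insert i ?I) (\<lambda>_. ?Q)" unfolding ins sample_law_def ..
  have int1: "integrable (sample_law c N m z) (\<lambda>W. Ulin z A (step m a z A W))"
  proof (rule W.integrable_const_bound[OF _ Ulin_step_measurable])
    have "norm (Ulin z A (step m a z A W)) \<le> Lmod * (2 * Lmod / a)" for W
      using Ulin_step_bound[of W] by simp
    then show "AE W in sample_law c N m z. norm (Ulin z A (step m a z A W)) \<le> Lmod * (2 * Lmod / a)" by simp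
  qed
  have int2: "integrable (sample_law c N m z) (\<lambda>W. ulin z A (W i) (step m a z A W))"
    using ulin_step_bound by (intro W.integrable_const_bound[OF _ ulin_step_measurable[OF i]]) auto
  \<comment> \<open>Integrating out one coordinate keeps a bounded function bounded, hence
    integrable over the remaining ones.\<close>
  have fold: "integrable ?PI (\<lambda>V. \<integral>x. G (V(i := x)) \<partial>?Q)"
    if [measurable]: "G \<in> borel_measurable (sample_law c N m z)" and B: "\<And>W. \<bar>G W\<bar> \<le> B"
    for G :: "(nat \<Rightarrow> real^'l) \<Rightarrow> real" and B
  proof (rule PI.integrable_const_bound[where B = B])
    have "(\<lambda>(V, x). V(i := x)) \<in> measurable (?PI \<Otimes>\<^sub>M ?Q) (sample_law c N m z)"
      unfolding law by (rule measurable_add_dim)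
    from measurable_compose[OF this that(1)]
    have [measurable]: "(\<lambda>(V, x). G (V(i := x))) \<in> borel_measurable (?PI \<Otimes>\<^sub>M ?Q)"
      by (simp add: split_beta')
    show "(\<lambda>V. \<integral>x. G (V(i := x)) \<partial>?Q) \<in> borel_measurable ?PI" by measurable
    have "\<bar>\<integral>x. G (V(i := x)) \<partial>?Q\<bar> \<le> B" if V: "V \<in> space ?PI" for V
    proof -
      have "(\<lambda>x. G (V(i := x))) \<in> borel_measurable ?Q" using V by measurable
      then have int: "integrable ?Q (\<lambda>x. G (V(i := x)))"
        using B by (intro Q.integrable_const_bound[where B = B]) auto
      have "\<bar>\<integral>x. G (V(i := x)) \<partial>?Q\<bar> \<le> (\<integral>x. \<bar>G (V(i := x))\<bar> \<partial>?Q)" by (rule integral_abs_bound)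
      also have "\<dots> \<le> (\<integral>x. B \<partial>?Q)" using int B by (intro integral_mono integrable_abs) auto
      finally show ?thesis by (simp add: Q.prob_space)
    qed
    then show "AE V in ?PI. norm (\<integral>x. G (V(i := x)) \<partial>?Q) \<le> B" by (auto intro!: AE_I2)
  qed
  have fold1: "integrable ?PI (\<lambda>V. \<integral>x. Ulin z A (step m a z A (V(i := x))) \<partial>?Q)"
    using fold[OF Ulin_step_measurable Ulin_step_bound] by simp
  have fold2: "integrable ?PI (\<lambda>V. \<integral>x. ulin z A x (step m a z A (V(i := x))) \<partial>?Q)"
    using fold[OF ulin_step_measurable[OF i] ulin_step_bound] by simp
  have step_upd: "(\<lambda>(x, w). step m a z A (V(i := x))) \<in> borel_measurable (?Q \<Otimes>\<^sub>M ?Q)" if V: "V \<in> space ?PI" for V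
  proof -
    have "(\<lambda>x. V(i := x)) \<in> measurable ?Q (sample_law c N m z)"
      unfolding law using V by (intro measurable_fun_upd[where J = ?I]) auto
    from measurable_compose[OF this step_sample_measurable] show ?thesis by simp
  qed
  have "(\<integral>W. Ulin z A (step m a z A W) \<partial>sample_law c N m z)
      = (\<integral>V. \<integral>x. Ulin z A (step m a z A (V(i := x))) \<partial>?Q \<partial>?PI)"
    using int1 unfolding law by (intro product_integral_insert) auto
  also have "\<dots> \<le> (\<integral>V. (\<integral>x. ulin z A x (step m a z A (V(i := x))) \<partial>?Q) + ?k \<partial>?PI)"
  proof (rule integral_mono)
    show "integrable ?PI (\<lambda>V. \<integral>x. Ulin z A (step m a z A (V(i := x))) \<partial>?Q)"
      by (rule fold1)
    show "integrable ?PI (\<lambda>V. (\<integral>x. ulin z A x (step m a z A (V(i := x))) \<partial>?Q) + ?k)"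
      using fold2 by simp
    fix V assume V: "V \<in> space ?PI"
    show "(\<integral>x. Ulin z A (step m a z A (V(i := x))) \<partial>?Q) \<le> (\<integral>x. ulin z A x (step m a z A (V(i := x))) \<partial>?Q) + ?k"
      unfolding Ulin_def
    proof (rule Q.integral_exchange_le[where B = "Lmod * (2 * Lmod / a)"])
      show "(\<lambda>(x, w). ulin z A w (step m a z A (V(i := x)))) \<in> borel_measurable (?Q \<Otimes>\<^sub>M ?Q)"
        unfolding split_beta' using step_in[OF m a z A] z step_upd[OF V]
        by (intro ulin_measurable) (auto simp: split_beta')
      fix x w
      show "\<bar>ulin z A w (step m a z A (V(i := x)))\<bar> \<le> Lmod * (2 * Lmod / a)" by (rule ulin_step_bound)
      have "ulin z A w (step m a z A (V(i := x))) - ulin z A w (step m a z A (V(i := w)))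
          \<le> Lmod * norm (step m a z A (V(i := x)) - step m a z A (V(i := w)))"
        unfolding ulin_def using lin_lipschitz[OF A step_in[OF m a z A] step_in[OF m a z A]]
        by (smt (verit))
      \<comment> \<open>Stability is applied at the sample \<open>V(i := w)\<close>: overwriting its
        \<open>i\<close>-th entry by \<open>x\<close> gives \<open>V(i := x)\<close>.\<close>
      also have "\<dots> \<le> Lmod * (2 * Lmod / (real m * (a - lamhat)))"
        using step_stable[OF m a z A i, of "V(i := w)" x] Lmod_nonneg by (intro mult_left_mono) auto
      also have "\<dots> = ?k" by (simp add: power2_eq_square)
      finally show "ulin z A w (step m a z A (V(i := x))) \<le> ulin z A w (step m a z A (V(i := w))) + ?k" by simp
    qed
  qed
  also have "\<dots> = (\<integral>V. (\<integral>x. ulin z A x (step m a z A (V(i := x))) \<partial>?Q) \<partial>?PI) + ?k"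
    using fold2 by (simp add: PI.prob_space)
  also have "(\<integral>V. (\<integral>x. ulin z A x (step m a z A (V(i := x))) \<partial>?Q) \<partial>?PI)
      = (\<integral>W. ulin z A (W i) (step m a z A W) \<partial>sample_law c N m z)"
    using int2 unfolding law by (subst product_integral_insert) auto
  finally show ?thesis .
qed

end

end

section \<open>Expected decrease of the Moreau envelope\<close>

lemma young_weighted:
  fixes x y c :: real
  assumes "0 < c"
  shows "x * y \<le> c / 2 * y\<^sup>2 + x\<^sup>2 / (2 * c)"
proof -
  have "0 \<le> c / 2 * (y - x / c)\<^sup>2" using assms by simp
  also have "\<dots> = c / 2 * y\<^sup>2 - x * y + x\<^sup>2 / (2 * c)"
    using assms by (simp add: power2_eq_square field_simps)
  finally show ?thesis by simp
qed

context composite_problem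
begin

definition "tau = lphi * Lc + lamhat + lamtilde"
text \<open>Subtracting the infimum makes the envelope nonnegative, so that its expectations can be
  extended integrals; at \<open>z0\<close> it is the constant \<open>Delta0\<close> of the
  guarantee.\<close>

definition "gap x = moreau_envelope X f rho x - (INF z\<in>X. f z)"

lemma kappa_eq: "kappa = 2 * rho - lphi * Lc - tau"
  unfolding kappa_def tau_def by simp

lemma gap_nonneg: "0 \<le> gap x"
  unfolding gap_def using inf_le_moreau_envelope by simp

text \<open>The infimum over an uncountable set is read off at the measurable minimiser
  \<open>P\<close>; the values of \<open>P\<close> lie in \<open>X\<close>, where \<open>f\<close>
  is continuous.\<close>

lemma moreau_envelope_measurable [measurable]: "moreau_envelope X f rho \<in> borel_measurable borel"
proof -
  have "f \<in> borel_measurable (restrict_space borel X)"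
    by (intro borel_measurable_continuous_on_restrict objective_continuous)
  moreover have "P \<in> measurable borel (restrict_space borel X)"
    using prox by (intro measurable_restrict_space2) auto
  ultimately have [measurable]: "(\<lambda>x. f (P x)) \<in> borel_measurable borel" by (rule measurable_compose_rev)
  have "moreau_envelope X f rho = (\<lambda>x. f (P x) + rho / 2 * (norm (P x - x))\<^sup>2)"
    by (rule ext) (rule moreau_envelope_eq)
  then show ?thesis by simp
qed

lemma gap_measurable [measurable]: "gap \<in> borel_measurable borel"
  unfolding gap_def by measurable

context
  fixes m :: nat and a :: real
  assumes m: "0 < m" and a: "rho + lphi * Lc < a"
begin

lemma a_gt_lamhat: "lamhat < a" and a_tau_pos: "0 < a + rho - tau"
proof -
  have "0 \<le> lphi * Lc" using lphi Lc by simp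
  then show "lamhat < a" "0 < a + rho - tau" using a rho_gt unfolding tau_def by linarith+
qed

context
  fixes z :: "real^'d" and A :: "real^'d^'l"
  assumes z: "z \<in> X" and A: "opnorm A \<le> lhat"
begin

definition "mean_ulin W y = (\<Sum>i<m. ulin z A (W i) y) / real m"

lemma integrable_ulin_step:
  "i < m \<Longrightarrow> integrable (sample_law c N m z) (\<lambda>W. ulin z A (W i) (step m a z A W))"
proof -
  assume i: "i < m"
  interpret W: prob_space "sample_law c N m z" by (rule prob_space_sample_law)
  show ?thesis
    by (rule W.integrable_const_bound[OF _ ulin_step_measurable[OF m a_gt_lamhat z A i]])
      (use ulin_step_bound[OF m a_gt_lamhat z A] in auto)
qed

lemma integrable_Ulin_step: "integrable (sample_law c N m z) (\<lambda>W. Ulin z A (step m a z A W))"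
proof -
  interpret W: prob_space "sample_law c N m z" by (rule prob_space_sample_law)
  show ?thesis
    by (rule W.integrable_const_bound[OF _ Ulin_step_measurable[OF m a_gt_lamhat z A]])
      (use Ulin_step_bound[OF m a_gt_lamhat z A] in auto)
qed

lemma integrable_mean_ulin_step: "integrable (sample_law c N m z) (\<lambda>W. mean_ulin W (step m a z A W))"
  unfolding mean_ulin_def using integrable_ulin_step
  by (intro integrable_divide Bochner_Integration.integrable_sum) auto

lemma stability:
  "(\<integral>W. Ulin z A (step m a z A W) \<partial>sample_law c N m z)
    \<le> (\<integral>W. mean_ulin W (step m a z A W) \<partial>sample_law c N m z) + 2 * Lmod\<^sup>2 / (real m * (a - lamhat))"
proof -
  let ?E = "\<lambda>g. \<integral>W. g W \<partial>sample_law c N m z"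
  let ?S = "2 * Lmod\<^sup>2 / (real m * (a - lamhat))"
  have "real m * ?E (\<lambda>W. Ulin z A (step m a z A W))
      = (\<Sum>i<m. ?E (\<lambda>W. Ulin z A (step m a z A W)))" by simp
  also have "\<dots> \<le> (\<Sum>i<m. ?E (\<lambda>W. ulin z A (W i) (step m a z A W)) + ?S)"
    using stability_component[OF m a_gt_lamhat z A] by (intro sum_mono) auto
  also have "\<dots> = (\<Sum>i<m. ?E (\<lambda>W. ulin z A (W i) (step m a z A W))) + real m * ?S"
    by (simp add: sum.distrib)
  also have "(\<Sum>i<m. ?E (\<lambda>W. ulin z A (W i) (step m a z A W)))
      = ?E (\<lambda>W. \<Sum>i<m. ulin z A (W i) (step m a z A W))"
    using integrable_ulin_step by (intro Bochner_Integration.integral_sum[symmetric]) auto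
  also have "\<dots> = real m * ?E (\<lambda>W. mean_ulin W (step m a z A W))"
    unfolding mean_ulin_def using m by simp
  finally have "real m * ?E (\<lambda>W. Ulin z A (step m a z A W))
      \<le> real m * (?E (\<lambda>W. mean_ulin W (step m a z A W)) + ?S)" by (simp add: distrib_left)
  then show ?thesis using m by simp
qed

text \<open>Here \<open>y\<close> is fixed before sampling, as \<open>P z\<close> is in the
  application. For the step, which depends on the sample, \<open>stability\<close> takes the place
  of this equality.\<close>

lemma mean_ulin_unbiased:
  assumes y: "y \<in> X"
  shows "integrable (sample_law c N m z) (\<lambda>W. mean_ulin W y)"
    and "(\<integral>W. mean_ulin W y \<partial>sample_law c N m z) = Ulin z A y"
proof -
  have comp: "distr (sample_law c N m z) (outcome_law c N z) (\<lambda>W. W i) = outcome_law c N z" if "i < m" for i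
    unfolding sample_law_def
    using distr_PiM_component[of "{..<m}" "\<lambda>_. outcome_law c N z" i] prob_space_outcome_law that by simp
  have proj: "(\<lambda>W. W i) \<in> measurable (sample_law c N m z) (outcome_law c N z)" if "i < m" for i
    unfolding sample_law_def by (rule measurable_component_singleton) (use that in simp)
  have meas: "(\<lambda>w. ulin z A w y) \<in> borel_measurable (outcome_law c N z)"
    using integrable_ulin[OF A z y] by (rule borel_measurable_integrable)
  have int: "integrable (sample_law c N m z) (\<lambda>W. ulin z A (W i) y)" if "i < m" for i
    using integrable_ulin[OF A z y] comp[OF that] integrable_distr_eq[OF proj[OF that] meas] by simp
  then show "integrable (sample_law c N m z) (\<lambda>W. mean_ulin W y)"
    unfolding mean_ulin_def by (intro integrable_divide Bochner_Integration.integrable_sum) auto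
  have val: "(\<integral>W. ulin z A (W i) y \<partial>sample_law c N m z) = Ulin z A y" if "i < m" for i
    unfolding Ulin_def using integral_distr[OF proj[OF that] meas] comp[OF that] by simp
  have "(\<integral>W. mean_ulin W y \<partial>sample_law c N m z) = (\<Sum>i<m. \<integral>W. ulin z A (W i) y \<partial>sample_law c N m z) / real m"
    unfolding mean_ulin_def using int by (subst integral_divide_zero, subst Bochner_Integration.integral_sum) auto
  also have "\<dots> = Ulin z A y" using val m by simp
  finally show "(\<integral>W. mean_ulin W y \<partial>sample_law c N m z) = Ulin z A y" .
qed

text \<open>The coefficients of the squared distance between the two minimisers add up to
  \<open>(a + rho - tau) / 2\<close>. Young's inequality absorbs the matrix error twice: into the
  surplus \<open>a - rho - lphi * Lc\<close> at the squared step length, which is why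
  \<open>a\<close> must exceed \<open>rho + lphi * Lc\<close>, and into half of the margin
  \<open>kappa\<close>. The two brackets are kept for the expectation: the first has mean zero, the
  second is the generalisation gap.\<close>

lemma step_pathwise:
  fixes W
  defines "Z \<equiv> step m a z A W" and "e \<equiv> opnorm (A - J z)"
  shows "(a + rho - tau) / 2 * (norm (P z - Z))\<^sup>2 \<le>
     (mean_ulin W (P z) - Ulin z A (P z)) + (Ulin z A Z - mean_ulin W Z)
     + (a - rho + lphi * Lc) / 2 * (norm (P z - z))\<^sup>2 + kappa / 4 * (norm (P z - z))\<^sup>2
     + (lphi * e)\<^sup>2 / kappa + (lphi * e)\<^sup>2 / (2 * (a - rho - lphi * Lc))"
proof -
  have ZX: "Z \<in> X" unfolding Z_def by (rule step_in[OF m a_gt_lamhat z A])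
  define D where "D = norm (P z - z)"
  define s where "s = norm (Z - z)"
  define q where "q = (norm (P z - Z))\<^sup>2"
  have mean: "(\<Sum>i<m. lin z A (W i) y) / real m = mean_ulin W y + (\<Sum>i<m. lin z A (W i) z) / real m" for y
    unfolding mean_ulin_def ulin_def by (simp add: sum_subtractf diff_divide_distrib)
  have 1: "mean_ulin W Z + a / 2 * s\<^sup>2 + (a - lamhat) / 2 * q \<le> mean_ulin W (P z) + a / 2 * D\<^sup>2"
    using step_growth[OF m a_gt_lamhat z A prox[of z], of W]
    unfolding spl_model_lin mean[of Z] mean[of "P z"] Z_def[symmetric] s_def q_def D_def by simp
  have 2: "f (P z) + rho / 2 * D\<^sup>2 + (rho - lphi * Lc - lamtilde) / 2 * q \<le> f Z + rho / 2 * s\<^sup>2"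
    using prox_growth[OF ZX, of z] unfolding D_def s_def q_def by (simp add: norm_minus_commute)
  have 3: "f Z - f z \<le> Ulin z A Z + lphi * (Lc / 2 * s\<^sup>2 + e * s)"
    using Ulin_objective[OF A z ZX] unfolding s_def e_def by linarith
  have 4: "Ulin z A (P z) \<le> f (P z) - f z + lphi * (Lc / 2 * D\<^sup>2 + e * D)"
    using Ulin_objective[OF A z prox[of z]] unfolding D_def e_def by linarith
  have 5: "(lphi * e) * s \<le> (a - rho - lphi * Lc) / 2 * s\<^sup>2 + (lphi * e)\<^sup>2 / (2 * (a - rho - lphi * Lc))"
    using a by (intro young_weighted) simp
  have 6: "(lphi * e) * D \<le> kappa / 4 * D\<^sup>2 + (lphi * e)\<^sup>2 / kappa"
    using young_weighted[of "kappa / 2" "lphi * e" D] kappa_pos by simp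
  show ?thesis
    using 1 2 3 4 5 6 unfolding q_def[symmetric] D_def[symmetric]
    by (simp add: tau_def algebra_simps add_divide_distrib diff_divide_distrib)
qed

lemma step_expected:
  defines "e \<equiv> opnorm (A - J z)" and "S \<equiv> 2 * Lmod\<^sup>2 / (real m * (a - lamhat))"
  shows "integrable (sample_law c N m z) (\<lambda>W. (norm (P z - step m a z A W))\<^sup>2)"
    and "(\<integral>W. (norm (P z - step m a z A W))\<^sup>2 \<partial>sample_law c N m z)
      \<le> (norm (P z - z))\<^sup>2 - kappa / (2 * (a + rho - tau)) * (norm (P z - z))\<^sup>2
        + 2 / (a + rho - tau) * (S + (lphi * e)\<^sup>2 / kappa + (lphi * e)\<^sup>2 / (2 * (a - rho - lphi * Lc)))"
proof -
  interpret W: prob_space "sample_law c N m z" by (rule prob_space_sample_law)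
  let ?E = "\<lambda>g. \<integral>W. g W \<partial>sample_law c N m z"
  let ?Z = "step m a z A"
  define R where "R = (a - rho + lphi * Lc) / 2 * (norm (P z - z))\<^sup>2 + kappa / 4 * (norm (P z - z))\<^sup>2
     + (lphi * e)\<^sup>2 / kappa + (lphi * e)\<^sup>2 / (2 * (a - rho - lphi * Lc))"
  note [measurable] = step_sample_measurable[OF m a_gt_lamhat z A]
  show int: "integrable (sample_law c N m z) (\<lambda>W. (norm (P z - ?Z W))\<^sup>2)"
  proof (rule W.integrable_const_bound[where B = "(norm (P z - z) + 2 * Lmod / a)\<^sup>2"])
    have "norm (P z - ?Z W) \<le> norm (P z - z) + 2 * Lmod / a" for W
      using step_dist[OF m a_gt_lamhat z A, of W] norm_triangle_ineq[of "P z - z" "z - ?Z W"]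
      by (simp add: norm_minus_commute)
    then have "(norm (P z - ?Z W))\<^sup>2 \<le> (norm (P z - z) + 2 * Lmod / a)\<^sup>2" for W
      by (intro power_mono) auto
    then show "AE W in sample_law c N m z. norm ((norm (P z - ?Z W))\<^sup>2) \<le> (norm (P z - z) + 2 * Lmod / a)\<^sup>2"
      by simp
  qed measurable
  have "(a + rho - tau) / 2 * ?E (\<lambda>W. (norm (P z - ?Z W))\<^sup>2) = ?E (\<lambda>W. (a + rho - tau) / 2 * (norm (P z - ?Z W))\<^sup>2)"
    by simp
  also have "\<dots> \<le> ?E (\<lambda>W. (mean_ulin W (P z) - Ulin z A (P z)) + (Ulin z A (?Z W) - mean_ulin W (?Z W)) + R)"
  proof (rule integral_mono)
    show "(a + rho - tau) / 2 * (norm (P z - ?Z W))\<^sup>2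
      \<le> (mean_ulin W (P z) - Ulin z A (P z)) + (Ulin z A (?Z W) - mean_ulin W (?Z W)) + R" for W
      using step_pathwise[of W] unfolding R_def e_def by linarith
    show "integrable (sample_law c N m z) (\<lambda>W. (a + rho - tau) / 2 * (norm (P z - ?Z W))\<^sup>2)"
      by (intro integrable_mult_right int)
    show "integrable (sample_law c N m z) (\<lambda>W. (mean_ulin W (P z) - Ulin z A (P z))
        + (Ulin z A (?Z W) - mean_ulin W (?Z W)) + R)"
      using mean_ulin_unbiased(1)[OF prox] integrable_mean_ulin_step integrable_Ulin_step
      by (intro Bochner_Integration.integrable_add Bochner_Integration.integrable_diff) auto
  qed
  also have "\<dots> = (?E (\<lambda>W. mean_ulin W (P z)) - Ulin z A (P z))
      + (?E (\<lambda>W. Ulin z A (?Z W)) - ?E (\<lambda>W. mean_ulin W (?Z W))) + R"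
    using mean_ulin_unbiased(1)[OF prox[of z]] integrable_mean_ulin_step integrable_Ulin_step
    by (simp add: W.prob_space)
  also have "\<dots> \<le> S + R"
    using stability mean_ulin_unbiased(2)[OF prox[of z]] unfolding S_def by simp
  finally have main: "(a + rho - tau) / 2 * ?E (\<lambda>W. (norm (P z - ?Z W))\<^sup>2) \<le> S + R" .
  define T where "T = a + rho - tau"
  have T: "0 < T" using a_tau_pos unfolding T_def .
  \<comment> \<open>After division by \<open>T / 2\<close> the factor of
    \<open>(norm (P z - z))\<^sup>2\<close> becomes \<open>1 - kappa / T + kappa / (2 * T)\<close>,
    the contraction claimed.\<close>
  have aT: "a - rho + lphi * Lc = T - kappa" unfolding T_def kappa_eq by simp
  have "?E (\<lambda>W. (norm (P z - ?Z W))\<^sup>2) \<le> 2 / T * (S + R)"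
    using main T unfolding T_def[symmetric] by (simp add: field_simps)
  also have "\<dots> = (norm (P z - z))\<^sup>2 - kappa / (2 * T) * (norm (P z - z))\<^sup>2
        + 2 / T * (S + (lphi * e)\<^sup>2 / kappa + (lphi * e)\<^sup>2 / (2 * (a - rho - lphi * Lc)))"
    unfolding R_def aT using T by (simp add: algebra_simps diff_divide_distrib add_divide_distrib)
  finally show "?E (\<lambda>W. (norm (P z - ?Z W))\<^sup>2)
      \<le> (norm (P z - z))\<^sup>2 - kappa / (2 * (a + rho - tau)) * (norm (P z - z))\<^sup>2
        + 2 / (a + rho - tau) * (S + (lphi * e)\<^sup>2 / kappa + (lphi * e)\<^sup>2 / (2 * (a - rho - lphi * Lc)))"
    unfolding T_def .
qed

text \<open>The decrease stands on the left, which avoids subtraction of extended reals, and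
  \<open>ennreal (e\<^sup>2)\<close> is a separate factor so that it can later be averaged over the
  data set.\<close>

lemma gap_step_expected:
  defines "e \<equiv> opnorm (A - J z)"
  shows "(\<integral>\<^sup>+W. ennreal (gap (step m a z A W)) \<partial>sample_law c N m z)
      + ennreal (rho * kappa / (4 * (a + rho - tau)) * (norm (P z - z))\<^sup>2)
    \<le> ennreal (gap z) + ennreal (rho / (a + rho - tau) * (2 * Lmod\<^sup>2 / (real m * (a - lamhat))))
      + ennreal (rho / (a + rho - tau) * (lphi\<^sup>2 / kappa + lphi\<^sup>2 / (2 * (a - rho - lphi * Lc)))) * ennreal (e\<^sup>2)"
proof -
  interpret W: prob_space "sample_law c N m z" by (rule prob_space_sample_law)
  let ?Z = "step m a z A"
  define T where "T = a + rho - tau"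
  define S where "S = 2 * Lmod\<^sup>2 / (real m * (a - lamhat))"
  define U where "U = lphi\<^sup>2 / kappa + lphi\<^sup>2 / (2 * (a - rho - lphi * Lc))"
  have T: "0 < T" using a_tau_pos unfolding T_def .
  have S: "0 \<le> S" unfolding S_def using a_gt_lamhat by simp
  have U: "0 \<le> U" unfolding U_def using a kappa_pos by simp
  define Q where "Q = (\<integral>W. (norm (P z - ?Z W))\<^sup>2 \<partial>sample_law c N m z)"
  have "0 \<le> Q" unfolding Q_def by simp
  let ?i = "INF z\<in>X. f z"
  have Pi: "0 \<le> f (P z) - ?i" using objective_bounded prox by (simp add: cINF_lower)
  have le: "ennreal (gap (?Z W)) \<le> ennreal ((f (P z) - ?i) + rho / 2 * (norm (P z - ?Z W))\<^sup>2)" for W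
    unfolding gap_def using moreau_envelope_le[OF prox[of z], of "?Z W"] by (intro ennreal_leI) simp
  have int: "integrable (sample_law c N m z) (\<lambda>W. (f (P z) - ?i) + rho / 2 * (norm (P z - ?Z W))\<^sup>2)"
    using step_expected(1) by simp
  have "(\<integral>\<^sup>+W. ennreal (gap (?Z W)) \<partial>sample_law c N m z)
      \<le> (\<integral>\<^sup>+W. ennreal ((f (P z) - ?i) + rho / 2 * (norm (P z - ?Z W))\<^sup>2) \<partial>sample_law c N m z)"
    by (intro nn_integral_mono le)
  also have "\<dots> = ennreal (\<integral>W. (f (P z) - ?i) + rho / 2 * (norm (P z - ?Z W))\<^sup>2 \<partial>sample_law c N m z)"
    using Pi rho_pos by (intro nn_integral_eq_integral int AE_I2) simp
  also have "(\<integral>W. (f (P z) - ?i) + rho / 2 * (norm (P z - ?Z W))\<^sup>2 \<partial>sample_law c N m z)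
      = (f (P z) - ?i) + rho / 2 * Q"
    unfolding Q_def using step_expected(1) by (simp add: W.prob_space)
  finally have "(\<integral>\<^sup>+W. ennreal (gap (?Z W)) \<partial>sample_law c N m z)
      + ennreal (rho * kappa / (4 * T) * (norm (P z - z))\<^sup>2)
      \<le> ennreal ((f (P z) - ?i) + rho / 2 * Q) + ennreal (rho * kappa / (4 * T) * (norm (P z - z))\<^sup>2)"
    by (rule add_right_mono)
  also have "\<dots> = ennreal ((f (P z) - ?i) + rho / 2 * Q + rho * kappa / (4 * T) * (norm (P z - z))\<^sup>2)"
    using Pi rho_pos kappa_pos T \<open>0 \<le> Q\<close> by (subst ennreal_plus) auto
  also have "\<dots> \<le> ennreal (gap z + rho / T * S + rho / T * U * e\<^sup>2)"
  proof (rule ennreal_leI)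
    have "rho / 2 * Q \<le> rho / 2 * ((norm (P z - z))\<^sup>2 - kappa / (2 * T) * (norm (P z - z))\<^sup>2
        + 2 / T * (S + (lphi * e)\<^sup>2 / kappa + (lphi * e)\<^sup>2 / (2 * (a - rho - lphi * Lc))))"
      using step_expected(2) rho_pos unfolding Q_def T_def S_def e_def by (intro mult_left_mono) auto
    also have "\<dots> = rho / 2 * (norm (P z - z))\<^sup>2 - rho * kappa / (4 * T) * (norm (P z - z))\<^sup>2
        + rho / T * S + rho / T * U * e\<^sup>2"
      unfolding U_def using T by (simp add: algebra_simps power_mult_distrib)
    finally show "(f (P z) - ?i) + rho / 2 * Q + rho * kappa / (4 * T) * (norm (P z - z))\<^sup>2
        \<le> gap z + rho / T * S + rho / T * U * e\<^sup>2"
      unfolding gap_def moreau_envelope_eq by simp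
  qed
  also have "\<dots> = ennreal (gap z) + ennreal (rho / T * S) + ennreal (rho / T * U * e\<^sup>2)"
    using gap_nonneg rho_pos T S U by (simp add: ennreal_plus)
  also have "ennreal (rho / T * U * e\<^sup>2) = ennreal (rho / T * U) * ennreal (e\<^sup>2)"
    by (rule ennreal_mult'') simp
  finally show ?thesis unfolding T_def S_def U_def .
qed

end
end
end

section \<open>Sampling from kernels\<close>

text \<open>Freshness in a run is stated on products of events only. These form an
  intersection-stable generator of the nested product, and a finite measure is determined by its
  values on them.\<close>

lemma measure_eqI_triple_rectangles:
  assumes mu: "sets mu = sets (A \<Otimes>\<^sub>M (B \<Otimes>\<^sub>M C))" "finite_measure mu"
    and nu: "sets nu = sets (A \<Otimes>\<^sub>M (B \<Otimes>\<^sub>M C))"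
    and eq: "\<And>a b c. a \<in> sets A \<Longrightarrow> b \<in> sets B \<Longrightarrow> c \<in> sets C \<Longrightarrow>
      emeasure mu (a \<times> (b \<times> c)) = emeasure nu (a \<times> (b \<times> c))"
  shows "mu = nu"
proof -
  interpret finite_measure mu by fact
  let ?R = "{b \<times> c | b c. b \<in> sets B \<and> c \<in> sets C}"
  let ?E = "{a \<times> b | a b. a \<in> sets A \<and> b \<in> ?R}"
  let ?O = "space A \<times> (space B \<times> space C)"
  have gen: "sets (A \<Otimes>\<^sub>M (B \<Otimes>\<^sub>M C)) = sigma_sets ?O ?E"
  proof -
    have "sets (A \<Otimes>\<^sub>M (B \<Otimes>\<^sub>M C)) = sets (sigma ?O ?E)"
      unfolding space_pair_measure[of B C, symmetric]
    proof (rule sets_pair_eq[of "sets A" A "{space A}" "?R" "B \<Otimes>\<^sub>M C" "{space (B \<Otimes>\<^sub>M C)}"])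
      show "sets (B \<Otimes>\<^sub>M C) = sigma_sets (space (B \<Otimes>\<^sub>M C)) ?R"
        unfolding space_pair_measure by (rule sets_pair_measure)
    qed (auto simp: sets.sigma_sets_eq space_pair_measure dest: sets.sets_into_space)
    also have "\<dots> = sigma_sets ?O ?E"
      by (rule sets_measure_of) (auto dest: sets.sets_into_space)
    finally show ?thesis .
  qed
  show ?thesis
  proof (rule measure_eqI_generator_eq[of ?E ?O mu nu "\<lambda>_. ?O"])
    show "Int_stable ?E"
    proof (rule Int_stableI)
      fix x y assume "x \<in> ?E" "y \<in> ?E"
      then obtain a b c a' b' c' where *: "a \<in> sets A" "b \<in> sets B" "c \<in> sets C"
          "a' \<in> sets A" "b' \<in> sets B" "c' \<in> sets C" "x = a \<times> (b \<times> c)" "y = a' \<times> (b' \<times> c')" by auto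
      then have "x \<inter> y = (a \<inter> a') \<times> ((b \<inter> b') \<times> (c \<inter> c'))" by auto
      moreover have "(b \<inter> b') \<times> (c \<inter> c') \<in> ?R" using * by blast
      ultimately show "x \<inter> y \<in> ?E" using * by blast
    qed
    show "?E \<subseteq> Pow ?O" by (auto dest: sets.sets_into_space)
    show "emeasure mu x = emeasure nu x" if "x \<in> ?E" for x using that eq by auto
    show "range (\<lambda>_ :: nat. ?O) \<subseteq> ?E" by blast
  qed (use mu nu gen in auto)
qed

text \<open>
  A kernel that is the image of one fixed probability space under a jointly measurable map.
  This representation makes the dependence of the sampling laws on the current point measurable.
\<close>

definition simulated :: "('a::topological_space \<Rightarrow> 'b measure) \<Rightarrow> 'b measure \<Rightarrow> 'c measure \<Rightarrow> ('a \<Rightarrow> 'c \<Rightarrow> 'b) \<Rightarrow> bool"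
  where "simulated K PK U G \<longleftrightarrow> prob_space U \<and> (\<lambda>(z, u). G z u) \<in> measurable (borel \<Otimes>\<^sub>M U) PK
    \<and> (\<forall>z. K z = distr U PK (G z))"

lemma simulatedD:
  assumes "simulated K PK U G"
  shows "prob_space U" "(\<lambda>(z, u). G z u) \<in> measurable (borel \<Otimes>\<^sub>M U) PK" "K z = distr U PK (G z)"
    "G z \<in> measurable U PK"
proof -
  show 1: "prob_space U" "(\<lambda>(z, u). G z u) \<in> measurable (borel \<Otimes>\<^sub>M U) PK" "K z = distr U PK (G z)"
    using assms by (auto simp: simulated_def)
  show "G z \<in> measurable U PK" using measurable_Pair2[OF 1(2), of z] by simp
qed

lemma simulated_prob_space: "simulated K PK U G \<Longrightarrow> prob_space (K z)"
  using simulatedD[of K PK U G] by (metis prob_space.prob_space_distr)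

lemma simulated_sets: "simulated K PK U G \<Longrightarrow> sets (K z) = sets PK"
  using simulatedD(3)[of K PK U G] by simp

text \<open>Extends the conditional law from events to arbitrary integrands. The joint law of point
  and samples equals the image of the product of \<open>M\<close> with \<open>U1\<close> and
  \<open>U2\<close>, where Fubini is available; on rectangles this equality is the freshness
  hypothesis.\<close>

lemma nn_integral_fresh_samples:
  fixes z :: "'w \<Rightarrow> 'a::topological_space"
  assumes M: "prob_space M" "subalgebra M F" and z: "z \<in> measurable F borel"
    and W: "W \<in> measurable M PW" and S: "S \<in> measurable M PS"
    and K1: "simulated K1 PW U1 G1" and K2: "simulated K2 PS U2 G2"
    and fresh: "\<And>E A B. E \<in> sets F \<Longrightarrow> A \<in> sets PW \<Longrightarrow> B \<in> sets PS \<Longrightarrow>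
      emeasure M {\<omega>\<in>E. W \<omega> \<in> A \<and> S \<omega> \<in> B}
      = (\<integral>\<^sup>+\<omega>\<in>E. emeasure (K1 (z \<omega>)) A * emeasure (K2 (z \<omega>)) B \<partial>M)"
    and H: "H \<in> borel_measurable (borel \<Otimes>\<^sub>M (PW \<Otimes>\<^sub>M PS))"
  shows "(\<integral>\<^sup>+\<omega>. H (z \<omega>, W \<omega>, S \<omega>) \<partial>M)
    = (\<integral>\<^sup>+\<omega>. \<integral>\<^sup>+s. \<integral>\<^sup>+w. H (z \<omega>, w, s) \<partial>K1 (z \<omega>) \<partial>K2 (z \<omega>) \<partial>M)"
proof -
  interpret M: prob_space M by fact
  interpret U1: prob_space U1 by (rule simulatedD(1)[OF K1])
  interpret U2: prob_space U2 by (rule simulatedD(1)[OF K2])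
  interpret U: pair_prob_space U1 U2 ..
  note [measurable] = W S H simulatedD(2)[OF K1] simulatedD(2)[OF K2] simulatedD(4)[OF K1] simulatedD(4)[OF K2]
  have zM [measurable]: "z \<in> measurable M borel" using measurable_from_subalg[OF M(2) z] .
  let ?P = "borel \<Otimes>\<^sub>M (PW \<Otimes>\<^sub>M PS)"
  let ?g = "\<lambda>(\<omega>, u1, u2). (z \<omega>, G1 (z \<omega>) u1, G2 (z \<omega>) u2)"
  have g [measurable]: "?g \<in> measurable (M \<Otimes>\<^sub>M (U1 \<Otimes>\<^sub>M U2)) ?P" by measurable
  have h [measurable]: "(\<lambda>\<omega>. (z \<omega>, W \<omega>, S \<omega>)) \<in> measurable M ?P" by measurable
  have "distr M ?P (\<lambda>\<omega>. (z \<omega>, W \<omega>, S \<omega>)) = distr (M \<Otimes>\<^sub>M (U1 \<Otimes>\<^sub>M U2)) ?P ?g"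
  proof (rule measure_eqI_triple_rectangles)
    show "finite_measure (distr M ?P (\<lambda>\<omega>. (z \<omega>, W \<omega>, S \<omega>)))" by (rule M.finite_measure_distr[OF h])
    fix C :: "'a set" and A B assume *: "C \<in> sets borel" "A \<in> sets PW" "B \<in> sets PS"
    \<comment> \<open>The event that the current point lies in \<open>C\<close> belongs to
      \<open>F\<close>, so it may serve as the conditioning event.\<close>
    define E where "E = z -` C \<inter> space F"
    have E: "E \<in> sets F" unfolding E_def by (rule measurable_sets[OF z *(1)])
    have sp: "space F = space M" using M(2) by (simp add: subalgebra_def)
    have "emeasure (distr M ?P (\<lambda>\<omega>. (z \<omega>, W \<omega>, S \<omega>))) (C \<times> (A \<times> B))
        = emeasure M {\<omega>\<in>E. W \<omega> \<in> A \<and> S \<omega> \<in> B}"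
      using * by (subst emeasure_distr[OF h]) (auto simp: E_def sp intro!: arg_cong[where f = "emeasure M"])
    also have "\<dots> = (\<integral>\<^sup>+\<omega>\<in>E. emeasure (K1 (z \<omega>)) A * emeasure (K2 (z \<omega>)) B \<partial>M)"
      by (rule fresh) (use E * in auto)
    also have "\<dots> = (\<integral>\<^sup>+\<omega>. emeasure (U1 \<Otimes>\<^sub>M U2)
        (Pair \<omega> -` (?g -` (C \<times> (A \<times> B)) \<inter> space (M \<Otimes>\<^sub>M (U1 \<Otimes>\<^sub>M U2)))) \<partial>M)"
    proof (rule nn_integral_cong)
      fix \<omega> assume \<omega>: "\<omega> \<in> space M"
      have "Pair \<omega> -` (?g -` (C \<times> (A \<times> B)) \<inter> space (M \<Otimes>\<^sub>M (U1 \<Otimes>\<^sub>M U2)))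
          = (if \<omega> \<in> E then (G1 (z \<omega>) -` A \<inter> space U1) \<times> (G2 (z \<omega>) -` B \<inter> space U2) else {})"
        using \<omega> by (auto simp: E_def sp space_pair_measure)
      then show "emeasure (K1 (z \<omega>)) A * emeasure (K2 (z \<omega>)) B * indicator E \<omega>
          = emeasure (U1 \<Otimes>\<^sub>M U2) (Pair \<omega> -` (?g -` (C \<times> (A \<times> B)) \<inter> space (M \<Otimes>\<^sub>M (U1 \<Otimes>\<^sub>M U2))))"
        using * simulatedD(4)[OF K1] simulatedD(4)[OF K2]
        by (simp add: simulatedD(3)[OF K1] simulatedD(3)[OF K2] emeasure_distr measurable_sets
            U2.emeasure_pair_measure_Times)
    qed
    also have "\<dots> = emeasure (M \<Otimes>\<^sub>M (U1 \<Otimes>\<^sub>M U2)) (?g -` (C \<times> (A \<times> B)) \<inter> space (M \<Otimes>\<^sub>M (U1 \<Otimes>\<^sub>M U2)))"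
      by (rule U.P.emeasure_pair_measure_alt[symmetric], rule measurable_sets[OF g]) (use * in auto)
    also have "\<dots> = emeasure (distr (M \<Otimes>\<^sub>M (U1 \<Otimes>\<^sub>M U2)) ?P ?g) (C \<times> (A \<times> B))"
      using * by (intro emeasure_distr[OF g, symmetric]) auto
    finally show "emeasure (distr M ?P (\<lambda>\<omega>. (z \<omega>, W \<omega>, S \<omega>))) (C \<times> (A \<times> B)) = \<dots>" .
  qed simp_all
  then have "(\<integral>\<^sup>+x. H x \<partial>distr M ?P (\<lambda>\<omega>. (z \<omega>, W \<omega>, S \<omega>))) = (\<integral>\<^sup>+x. H x \<partial>distr (M \<Otimes>\<^sub>M (U1 \<Otimes>\<^sub>M U2)) ?P ?g)"
    by simp
  then have "(\<integral>\<^sup>+\<omega>. H (z \<omega>, W \<omega>, S \<omega>) \<partial>M) = (\<integral>\<^sup>+x. H (?g x) \<partial>(M \<Otimes>\<^sub>M (U1 \<Otimes>\<^sub>M U2)))"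
    by (simp add: nn_integral_distr)
  also have "\<dots> = (\<integral>\<^sup>+\<omega>. \<integral>\<^sup>+u. H (?g (\<omega>, u)) \<partial>(U1 \<Otimes>\<^sub>M U2) \<partial>M)"
    by (rule U.P.nn_integral_fst[symmetric]) measurable
  also have "\<dots> = (\<integral>\<^sup>+\<omega>. \<integral>\<^sup>+s. \<integral>\<^sup>+w. H (z \<omega>, w, s) \<partial>K1 (z \<omega>) \<partial>K2 (z \<omega>) \<partial>M)"
  proof (rule nn_integral_cong)
    fix \<omega> assume "\<omega> \<in> space M"
    have Hz [measurable]: "(\<lambda>(w, s). H (z \<omega>, w, s)) \<in> borel_measurable (PW \<Otimes>\<^sub>M PS)" by measurable
    have Hw: "(\<lambda>w. H (z \<omega>, w, s)) \<in> borel_measurable PW" if "s \<in> space PS" for s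
      using that by measurable
    have "(\<integral>\<^sup>+u. H (?g (\<omega>, u)) \<partial>(U1 \<Otimes>\<^sub>M U2)) = (\<integral>\<^sup>+u2. \<integral>\<^sup>+u1. H (z \<omega>, G1 (z \<omega>) u1, G2 (z \<omega>) u2) \<partial>U1 \<partial>U2)"
      by (subst U.nn_integral_snd[symmetric]) (auto simp: split_beta')
    also have "\<dots> = (\<integral>\<^sup>+u2. \<integral>\<^sup>+w. H (z \<omega>, w, G2 (z \<omega>) u2) \<partial>K1 (z \<omega>) \<partial>U2)"
      unfolding simulatedD(3)[OF K1] using measurable_space[OF simulatedD(4)[OF K2]] Hw
      by (intro nn_integral_cong nn_integral_distr[symmetric]) auto
    also have "\<dots> = (\<integral>\<^sup>+s. \<integral>\<^sup>+w. H (z \<omega>, w, s) \<partial>K1 (z \<omega>) \<partial>K2 (z \<omega>))"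
    proof -
      interpret K1z: prob_space "K1 (z \<omega>)" by (rule simulated_prob_space[OF K1])
      have [measurable_cong]: "sets (K1 (z \<omega>)) = sets PW" by (rule simulated_sets[OF K1])
      have "(\<lambda>s. \<integral>\<^sup>+w. H (z \<omega>, w, s) \<partial>K1 (z \<omega>)) \<in> borel_measurable PS" by measurable
      then show ?thesis unfolding simulatedD(3)[OF K2] by (intro nn_integral_distr[symmetric]) auto
    qed
    finally show "(\<integral>\<^sup>+u. H (?g (\<omega>, u)) \<partial>(U1 \<Otimes>\<^sub>M U2))
        = (\<integral>\<^sup>+s. \<integral>\<^sup>+w. H (z \<omega>, w, s) \<partial>K1 (z \<omega>) \<partial>K2 (z \<omega>))" .
  qed
  finally show ?thesis .
qed

lemma simulated_PiM:
  fixes g :: "'a::topological_space \<Rightarrow> 'c \<Rightarrow> 'b"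
  assumes U: "prob_space U" and g: "(\<lambda>(z, u). g z u) \<in> measurable (borel \<Otimes>\<^sub>M U) Q"
  shows "simulated (\<lambda>z. Pi\<^sub>M {..<k::nat} (\<lambda>_. distr U Q (g z))) (Pi\<^sub>M {..<k} (\<lambda>_. Q))
    (Pi\<^sub>M {..<k} (\<lambda>_. U)) (\<lambda>z. compose {..<k} (g z))"
  unfolding simulated_def
proof (intro conjI allI)
  show "prob_space (Pi\<^sub>M {..<k} (\<lambda>_. U))" using U by (rule prob_space_PiM)
  note [measurable] = g
  show "(\<lambda>(z, u). compose {..<k} (g z) u) \<in> measurable (borel \<Otimes>\<^sub>M Pi\<^sub>M {..<k} (\<lambda>_. U)) (Pi\<^sub>M {..<k} (\<lambda>_. Q))"
    unfolding compose_def split_beta'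
    by (rule measurable_restrict) (rule measurable_compose[OF _ g, of "\<lambda>p. (fst p, snd p _)", simplified split_beta', simplified], measurable)
  fix z
  have gz: "g z \<in> measurable U Q" using measurable_Pair2[OF g, of z] by simp
  show "Pi\<^sub>M {..<k} (\<lambda>_. distr U Q (g z)) = distr (Pi\<^sub>M {..<k} (\<lambda>_. U)) (Pi\<^sub>M {..<k} (\<lambda>_. Q)) (compose {..<k} (g z))"
  proof -
    \<comment> \<open>\<open>?D\<close> is a probability space with the same sets as
      \<open>Q\<close>, so it can stand in for \<open>Q\<close> as the target while the product
      theorem is applied.\<close>
    let ?D = "distr U Q (g z)"
    have "Pi\<^sub>M {..<k} (\<lambda>_. distr U ?D (g z)) = distr (Pi\<^sub>M {..<k} (\<lambda>_. U)) (Pi\<^sub>M {..<k} (\<lambda>_. ?D)) (compose {..<k} (g z))"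
      using U gz by (intro distr_PiM_finite_prob_space'[symmetric]) (auto intro: prob_space.prob_space_distr)
    also have "\<dots> = distr (Pi\<^sub>M {..<k} (\<lambda>_. U)) (Pi\<^sub>M {..<k} (\<lambda>_. Q)) (compose {..<k} (g z))"
      by (intro distr_cong refl sets_PiM_cong) simp
    also have "distr U ?D (g z) = ?D" by (intro distr_cong) auto
    finally show ?thesis .
  qed
qed

section \<open>The iteration\<close>

lemma prob_space_density_lborel: "prob_density p \<Longrightarrow> prob_space (density lborel (\<lambda>x. ennreal (p x)))"
  by (rule prob_spaceI) (auto simp: prob_density_def emeasure_density)

text \<open>A static design ignores \<open>z\<close>. An adaptive one draws \<open>x\<close> with
  density \<open>g\<close> and returns \<open>z + h n *\<^sub>R x\<close>; the volume factor of this
  affine map cancels the power of \<open>1 / h n\<close> in the density.\<close>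

lemma design_law_simulation:
  fixes D :: "'a::euclidean_space design"
  assumes D: "valid_design X D" and n: "1 \<le> n"
  shows "\<exists>(Q :: 'a measure) (\<theta> :: 'a \<Rightarrow> 'a \<Rightarrow> 'a). prob_space Q \<and> sets Q = sets borel \<and>
    (\<lambda>(z, x). \<theta> z x) \<in> borel_measurable (borel \<Otimes>\<^sub>M borel) \<and> (\<forall>z. design_law D n z = distr Q borel (\<theta> z))"
proof (cases D)
  case (Static p)
  then have p: "prob_density p" using D by simp
  show ?thesis
    by (rule exI[of _ "density lborel (\<lambda>x. ennreal (p x))"], rule exI[of _ "\<lambda>z x. x"])
      (auto simp: Static prob_space_density_lborel[OF p] intro!: distr_id2[symmetric])
next
  case (Adaptive g h)
  then have g: "prob_density g" and h: "0 < h n" using D n by auto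
  have [measurable]: "g \<in> borel_measurable borel" using g by (simp add: prob_density_def)
  define Q where "Q = density lborel (\<lambda>x. ennreal (g x))"
  define \<theta> where "\<theta> z x = z + h n *\<^sub>R x" for z x :: 'a
  have "design_law D n z = distr Q borel (\<theta> z)" for z
  proof -
    let ?q = "\<lambda>x. ennreal ((1 / h n) ^ DIM('a) * g ((1 / h n) *\<^sub>R (x - z)))"
    have [measurable]: "\<theta> z \<in> borel_measurable borel" unfolding \<theta>_def by measurable
    have lb: "lborel = density (distr lborel borel (\<theta> z)) (\<lambda>_. ennreal (\<bar>h n\<bar> ^ DIM('a)))"
      unfolding \<theta>_def using h by (intro lborel_affine) simp
    have "design_law D n z = density (density (distr lborel borel (\<theta> z)) (\<lambda>_. ennreal (\<bar>h n\<bar> ^ DIM('a)))) ?q"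
      unfolding Adaptive by (simp flip: lb)
    also have "\<dots> = density (distr lborel borel (\<theta> z)) (\<lambda>x. ennreal (\<bar>h n\<bar> ^ DIM('a)) * ?q x)"
      by (rule density_density_eq) measurable
    also have "\<dots> = distr (density lborel (\<lambda>x. ennreal (\<bar>h n\<bar> ^ DIM('a)) * ?q (\<theta> z x))) borel (\<theta> z)"
      by (rule density_distr) measurable
    also have "(\<lambda>x. ennreal (\<bar>h n\<bar> ^ DIM('a)) * ?q (\<theta> z x)) = (\<lambda>x. ennreal (g x))"
      using h by (auto simp: \<theta>_def ennreal_mult'[symmetric] power_divide)
    finally show ?thesis unfolding Q_def .
  qed
  moreover have "prob_space Q" unfolding Q_def by (rule prob_space_density_lborel[OF g])
  moreover have "(\<lambda>(z, x). \<theta> z x) \<in> borel_measurable (borel \<Otimes>\<^sub>M borel)" unfolding \<theta>_def by measurable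
  ultimately show ?thesis unfolding Q_def by auto
qed

lemma dataset_law_simulation:
  fixes c :: "real^'d \<Rightarrow> real^'l"
  assumes N: "prob_space N" "sets N = sets borel" and c [measurable]: "c \<in> borel_measurable borel"
    and valid_design: "valid_design X D" and n: "1 \<le> n"
  shows "\<exists>(U :: (nat \<Rightarrow> (real^'d) \<times> (real^'l)) measure) G.
    simulated (dataset_law c N D n) (Pi\<^sub>M {..<n} (\<lambda>_. borel \<Otimes>\<^sub>M borel)) U G"
proof -
  interpret N: prob_space N by (rule N)
  note [measurable_cong] = N(2)
  obtain Q :: "(real^'d) measure" and \<theta> :: "real^'d \<Rightarrow> real^'d \<Rightarrow> real^'d" where Q: "prob_space Q" "sets Q = sets borel"
    and th: "(\<lambda>(z, x). \<theta> z x) \<in> borel_measurable (borel \<Otimes>\<^sub>M borel)"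
    and law: "\<And>z. design_law D n z = distr Q borel (\<theta> z)"
    using design_law_simulation[OF valid_design n] by auto
  interpret Q: prob_space Q by fact
  interpret QN: pair_prob_space Q N ..
  note [measurable] = th and [measurable_cong] = Q(2)
  have [measurable]: "\<theta> z \<in> borel_measurable borel" for z using measurable_Pair2[OF th, of z] by simp
  have obs: "observation_law c N D n z = distr (Q \<Otimes>\<^sub>M N) (borel \<Otimes>\<^sub>M borel) (\<lambda>(x, e). (\<theta> z x, c (\<theta> z x) + e))" for z
  proof -
    have "design_law D n z \<Otimes>\<^sub>M N = distr Q borel (\<theta> z) \<Otimes>\<^sub>M distr N borel (\<lambda>e. e)"
      unfolding law using N(2) by (simp add: distr_id2)
    also have "\<dots> = distr (Q \<Otimes>\<^sub>M N) (borel \<Otimes>\<^sub>M borel) (\<lambda>(x, e). (\<theta> z x, e))"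
      using N(2) N.sigma_finite_measure_axioms by (intro pair_measure_distr) (auto simp: distr_id2)
    finally show ?thesis
      unfolding observation_law_def by (simp add: distr_distr comp_def split_beta')
  qed
  have "(\<lambda>(z, p). case p of (x, e) \<Rightarrow> (\<theta> z x, c (\<theta> z x) + e))
      \<in> measurable (borel \<Otimes>\<^sub>M (Q \<Otimes>\<^sub>M N)) (borel \<Otimes>\<^sub>M borel)"
    unfolding split_beta' by measurable
  from simulated_PiM[OF QN.P.prob_space_axioms this, of n] show ?thesis
    unfolding dataset_law_def obs by blast
qed

section \<open>Expected decrease in one random step\<close>

locale lspl_setting = composite_problem X Op phi c N lam lphi lc Lc lhat rho
  for X Op :: "(real^'d) set" and phi :: "(real^'d) \<times> (real^'l) \<Rightarrow> real"
    and c :: "real^'d \<Rightarrow> real^'l" and N :: "(real^'l) measure" and lam lphi lc Lc lhat rho :: real +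
  fixes D :: "(real^'d) design" and est :: "('d, 'l) estimator"
  assumes valid_design: "valid_design X D" and measurable_estimator: "measurable_estimator est"
    and estimator_bounded: "\<forall>z\<in>X. \<forall>n\<ge>1. AE S in dataset_law c N D n z. opnorm (est n z S) \<le> lhat"
begin

lemma simulated_sample_law:
  "simulated (sample_law c N m) (Pi\<^sub>M {..<m} (\<lambda>_. borel)) (Pi\<^sub>M {..<m} (\<lambda>_. N)) (\<lambda>z. compose {..<m} (\<lambda>e. c z + e))"
proof -
  have "sample_law c N m = (\<lambda>z. Pi\<^sub>M {..<m} (\<lambda>_. distr N borel (\<lambda>e. c z + e)))"
    by (auto simp: sample_law_def outcome_law_def)
  moreover have "(\<lambda>(z, e). c z + e) \<in> borel_measurable (borel \<Otimes>\<^sub>M N)" by measurable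
  ultimately show ?thesis using simulated_PiM[OF N(1), of "\<lambda>z e. c z + e" borel m] by simp
qed

lemma simulated_dataset_law:
  assumes "1 \<le> n"
  shows "\<exists>(U :: (nat \<Rightarrow> (real^'d) \<times> (real^'l)) measure) G.
    simulated (dataset_law c N D n) (Pi\<^sub>M {..<n} (\<lambda>_. borel \<Otimes>\<^sub>M borel)) U G"
  using dataset_law_simulation[OF N(1,2) c_measurable valid_design assms] .

lemma sets_dataset_law:
  "1 \<le> n \<Longrightarrow> sets (dataset_law c N D n z) = sets (Pi\<^sub>M {..<n} (\<lambda>_. borel \<Otimes>\<^sub>M borel))"
  using simulated_dataset_law simulated_sets by blast

lemma prob_space_dataset_law: "1 \<le> n \<Longrightarrow> prob_space (dataset_law c N D n z)"
  using simulated_dataset_law simulated_prob_space by blast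

lemma est_measurable:
  assumes "1 \<le> n"
  shows "(\<lambda>(z, S). est n z S) \<in> borel_measurable (borel \<Otimes>\<^sub>M Pi\<^sub>M {..<n} (\<lambda>_. borel \<Otimes>\<^sub>M borel))"
    and "est n z \<in> borel_measurable (dataset_law c N D n z)"
proof -
  show 1: "(\<lambda>(z, S). est n z S) \<in> borel_measurable (borel \<Otimes>\<^sub>M Pi\<^sub>M {..<n} (\<lambda>_. borel \<Otimes>\<^sub>M borel))"
    using measurable_estimator assms by (auto simp: measurable_estimator_def)
  have "est n z \<in> borel_measurable (Pi\<^sub>M {..<n} (\<lambda>_. borel \<Otimes>\<^sub>M borel))"
    using measurable_Pair2[OF 1, of z] by simp
  then show "est n z \<in> borel_measurable (dataset_law c N D n z)"
    unfolding measurable_cong_sets[OF sets_dataset_law[OF assms] refl] .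
qed

abbreviation "e \<equiv> estimation_error X c N D est"

text \<open>\<open>estimation_error\<close> is a real supremum of Bochner integrals, informative
  only if the integrals exist and are bounded. The almost sure bound \<open>lhat + lc\<close> on the
  error provides both.\<close>

lemma estimation_error_bounds:
  assumes z: "z \<in> X" and n: "1 \<le> n"
  shows "0 \<le> e n"
    and "(\<integral>\<^sup>+S. ennreal ((opnorm (est n z S - J z))\<^sup>2) \<partial>dataset_law c N D n z) \<le> ennreal ((e n)\<^sup>2)"
proof -
  define I where "I z = (\<integral>S. (opnorm (est n z S - J z))\<^sup>2 \<partial>dataset_law c N D n z)" for z
  have AE: "AE S in dataset_law c N D n z. (opnorm (est n z S - J z))\<^sup>2 \<le> (lhat + lc)\<^sup>2" if z: "z \<in> X" for z
  proof -
    have J: "opnorm (J z) \<le> lc"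
      using z c_differentiable X_subset by (intro lipschitz_on_opnorm_jacobian_le[OF Op(1) c_lipschitz]) auto
    have "AE S in dataset_law c N D n z. opnorm (est n z S) \<le> lhat" using estimator_bounded z n by blast
    then show ?thesis
    proof eventually_elim
      case (elim S)
      have "opnorm (est n z S - J z) \<le> opnorm (est n z S) + opnorm (J z)"
        using opnorm_triangle[of "est n z S" "- J z"] opnorm_uminus[of "J z"] by simp
      then show ?case using elim J opnorm_nonneg by (intro power_mono) auto
    qed
  qed
  have int: "integrable (dataset_law c N D n z) (\<lambda>S. (opnorm (est n z S - J z))\<^sup>2)" if z: "z \<in> X" for z
  proof -
    interpret prob_space "dataset_law c N D n z" by (rule prob_space_dataset_law[OF n])
    note [measurable] = est_measurable(2)[OF n]
    show ?thesis using AE[OF z] by (intro integrable_const_bound[where B = "(lhat + lc)\<^sup>2"]) auto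
  qed
  have I: "0 \<le> I z" "I z \<le> (lhat + lc)\<^sup>2" if z: "z \<in> X" for z
  proof -
    interpret prob_space "dataset_law c N D n z" by (rule prob_space_dataset_law[OF n])
    show "0 \<le> I z" unfolding I_def by simp
    have "I z \<le> (\<integral>S. (lhat + lc)\<^sup>2 \<partial>dataset_law c N D n z)"
      unfolding I_def using AE[OF z] int[OF z] by (intro integral_mono_AE) auto
    then show "I z \<le> (lhat + lc)\<^sup>2" by (simp add: prob_space)
  qed
  have e: "e n = (SUP z\<in>X. sqrt (I z))" unfolding estimation_error_def I_def ..
  have "bdd_above ((\<lambda>z. sqrt (I z)) ` X)"
    by (rule bdd_aboveI2, rule real_sqrt_le_mono, rule I(2))
  then have le: "sqrt (I z) \<le> e n" unfolding e using z by (intro cSUP_upper) auto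
  then show "0 \<le> e n" using I[OF z] real_sqrt_ge_zero order_trans by blast
  have "I z = (sqrt (I z))\<^sup>2" using I[OF z] by simp
  also have "\<dots> \<le> (e n)\<^sup>2" using le I[OF z] by (intro power_mono) auto
  finally have "I z \<le> (e n)\<^sup>2" .
  then show "(\<integral>\<^sup>+S. ennreal ((opnorm (est n z S - J z))\<^sup>2) \<partial>dataset_law c N D n z) \<le> ennreal ((e n)\<^sup>2)"
    using int[OF z] by (subst nn_integral_eq_integral) (auto simp: I_def intro: ennreal_leI)
qed

definition admissible :: "nat \<Rightarrow> (real^'d) \<times> (nat \<Rightarrow> real^'l) \<times> (nat \<Rightarrow> (real^'d) \<times> (real^'l)) \<Rightarrow> bool" where
  "admissible n = (\<lambda>(z, W, S). z \<in> X \<and> opnorm (est n z S) \<le> lhat)"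

text \<open>Existence and growth of the minimiser are known only for points of \<open>X\<close> and
  matrices within \<open>lhat\<close>. Elsewhere the current point is returned, a measurable default
  that a run meets with probability zero.\<close>

definition next_iterate :: "nat \<Rightarrow> nat \<Rightarrow> real \<Rightarrow> (real^'d) \<times> (nat \<Rightarrow> real^'l) \<times> (nat \<Rightarrow> (real^'d) \<times> (real^'l)) \<Rightarrow> real^'d" where
  "next_iterate m n a p = (if admissible n p then case p of (z, W, S) \<Rightarrow> step m a z (est n z S) W else fst p)"

definition noise :: "nat \<Rightarrow> nat \<Rightarrow> ((real^'d) \<times> (nat \<Rightarrow> real^'l) \<times> (nat \<Rightarrow> (real^'d) \<times> (real^'l))) measure" where
  "noise m n = borel \<Otimes>\<^sub>M (Pi\<^sub>M {..<m} (\<lambda>_. borel) \<Otimes>\<^sub>M Pi\<^sub>M {..<n} (\<lambda>_. borel \<Otimes>\<^sub>M borel))"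

lemma noise_measurable:
  assumes "1 \<le> n"
  shows "(\<lambda>p. est n (fst p) (snd (snd p))) \<in> borel_measurable (noise m n)"
    and "fst \<in> borel_measurable (noise m n)"
    and "i < m \<Longrightarrow> (\<lambda>p. fst (snd p) i) \<in> borel_measurable (noise m n)"
proof -
  have "(\<lambda>p. (fst p, snd (snd p))) \<in> measurable (noise m n) (borel \<Otimes>\<^sub>M Pi\<^sub>M {..<n} (\<lambda>_. borel \<Otimes>\<^sub>M borel))"
    unfolding noise_def by measurable
  from measurable_compose[OF this est_measurable(1)[OF assms]]
  show "(\<lambda>p. est n (fst p) (snd (snd p))) \<in> borel_measurable (noise m n)" by simp
  show "fst \<in> borel_measurable (noise m n)" unfolding noise_def by measurable
  show "i < m \<Longrightarrow> (\<lambda>p. fst (snd p) i) \<in> borel_measurable (noise m n)"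
    unfolding noise_def by (rule measurable_compose[OF _ measurable_component_singleton[of i "{..<m}"]]) auto
qed

lemma admissible_measurable:
  assumes "1 \<le> n" shows "Measurable.pred (noise m n) (admissible n)"
proof -
  note [measurable] = noise_measurable(1,2)[OF assms]
  have [measurable]: "X \<in> sets borel" using X by (intro borel_closed)
  have "Measurable.pred (noise m n) (\<lambda>p. fst p \<in> X \<and> opnorm (est n (fst p) (snd (snd p))) \<le> lhat)" by measurable
  then show ?thesis unfolding admissible_def split_beta' .
qed

lemma next_iterate_measurable:
  assumes m: "0 < m" and n: "1 \<le> n" and a: "lamhat < a"
  shows "next_iterate m n a \<in> borel_measurable (noise m n)"
proof -
  have "(\<lambda>p. step m a (fst p) (est n (fst p) (snd (snd p))) (fst (snd p)))
      \<in> borel_measurable (restrict_space (noise m n) {p. admissible n p})"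
    using noise_measurable[OF n]
    by (intro step_measurable[OF m a] measurable_restrict_space1)
      (auto simp: space_restrict_space admissible_def)
  then have "(\<lambda>p. if admissible n p then step m a (fst p) (est n (fst p) (snd (snd p))) (fst (snd p)) else fst p)
      \<in> borel_measurable (noise m n)"
    using admissible_measurable[OF n] noise_measurable(2)[OF n]
    by (subst measurable_If_restrict_space_iff) (auto intro: measurable_restrict_space1)
  then show ?thesis unfolding next_iterate_def[abs_def] split_beta' .
qed

text \<open>The error that one step may add to the expected gap; 4 times its sum over the iterations
  is the error part of the numerator in \<open>guarantee_bound\<close>.\<close>

definition step_error :: "nat \<Rightarrow> nat \<Rightarrow> real \<Rightarrow> real" where
  "step_error m n a = rho / (a + rho - tau) * (2 * Lmod\<^sup>2 / (real m * (a - lamhat))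
     + (lphi\<^sup>2 / kappa + lphi\<^sup>2 / (2 * (a - rho - lphi * Lc))) * (e n)\<^sup>2)"

lemma step_error_nonneg: "rho + lphi * Lc < a \<Longrightarrow> 0 \<le> step_error m n a"
  using a_gt_lamhat[of 1 a] a_tau_pos[of 1 a] rho_pos kappa_pos by (auto simp: step_error_def)

text \<open>For a fixed data set \<open>S\<close> the matrix is constant while \<open>W\<close> is
  integrated, so \<open>gap_step_expected\<close> holds under the outer integral, which only has to
  average the squared matrix error.\<close>

lemma gap_next_expected:
  assumes m: "0 < m" and n: "1 \<le> n" and a: "rho + lphi * Lc < a" and z: "z \<in> X"
  shows "(\<integral>\<^sup>+S. \<integral>\<^sup>+W. ennreal (gap (next_iterate m n a (z, W, S)))
        + ennreal (rho * kappa / (4 * (a + rho - tau)) * (norm (P z - z))\<^sup>2)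
      \<partial>sample_law c N m z \<partial>dataset_law c N D n z)
    \<le> ennreal (gap z) + ennreal (step_error m n a)"
proof -
  interpret S: prob_space "dataset_law c N D n z" by (rule prob_space_dataset_law[OF n])
  interpret W: prob_space "sample_law c N m z" by (rule prob_space_sample_law)
  have al: "lamhat < a" using a_gt_lamhat[OF m a] .
  define k1 where "k1 = rho / (a + rho - tau) * (2 * Lmod\<^sup>2 / (real m * (a - lamhat)))"
  define k2 where "k2 = rho / (a + rho - tau) * (lphi\<^sup>2 / kappa + lphi\<^sup>2 / (2 * (a - rho - lphi * Lc)))"
  define k3 where "k3 = ennreal (rho * kappa / (4 * (a + rho - tau)) * (norm (P z - z))\<^sup>2)"
  have k: "0 \<le> k1" "0 \<le> k2"
    unfolding k1_def k2_def using al a a_tau_pos[OF m a] rho_pos kappa_pos by auto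
  have [measurable]: "next_iterate m n a \<in> borel_measurable
      (borel \<Otimes>\<^sub>M (Pi\<^sub>M {..<m} (\<lambda>_. borel) \<Otimes>\<^sub>M Pi\<^sub>M {..<n} (\<lambda>_. borel \<Otimes>\<^sub>M borel)))"
    using next_iterate_measurable[OF m n al] unfolding noise_def .
  note [measurable_cong] = sets_dataset_law[OF n, of z]
  note [measurable] = est_measurable(2)[OF n]
  let ?I = "\<lambda>S. \<integral>\<^sup>+W. ennreal (gap (next_iterate m n a (z, W, S))) \<partial>sample_law c N m z"
  have "(\<integral>\<^sup>+S. \<integral>\<^sup>+W. ennreal (gap (next_iterate m n a (z, W, S))) + k3
      \<partial>sample_law c N m z \<partial>dataset_law c N D n z) = (\<integral>\<^sup>+S. ?I S + k3 \<partial>dataset_law c N D n z)"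
  proof (rule nn_integral_cong)
    fix S assume "S \<in> space (dataset_law c N D n z)"
    then have [measurable]: "S \<in> space (Pi\<^sub>M {..<n} (\<lambda>_. borel \<Otimes>\<^sub>M borel :: ((real^'d) \<times> (real^'l)) measure))"
      using sets_eq_imp_space_eq[OF sets_dataset_law[OF n]] by simp
    have "(\<lambda>W. ennreal (gap (next_iterate m n a (z, W, S)))) \<in> borel_measurable (sample_law c N m z)"
      by measurable
    then show "(\<integral>\<^sup>+W. ennreal (gap (next_iterate m n a (z, W, S))) + k3 \<partial>sample_law c N m z) = ?I S + k3"
      by (simp add: nn_integral_add W.emeasure_space_1)
  qed
  also have "\<dots> \<le> (\<integral>\<^sup>+S. ennreal (gap z) + ennreal k1 + ennreal k2 * ennreal ((opnorm (est n z S - J z))\<^sup>2) \<partial>dataset_law c N D n z)"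
  proof (rule nn_integral_mono_AE)
    have "AE S in dataset_law c N D n z. opnorm (est n z S) \<le> lhat" using estimator_bounded z n by blast
    then show "AE S in dataset_law c N D n z. ?I S + k3
        \<le> ennreal (gap z) + ennreal k1 + ennreal k2 * ennreal ((opnorm (est n z S - J z))\<^sup>2)"
    proof eventually_elim
      case (elim S)
      have "next_iterate m n a (z, W, S) = step m a z (est n z S) W" for W
        using elim z by (simp add: next_iterate_def admissible_def)
      then show ?case using gap_step_expected[OF m a z elim] unfolding k1_def k2_def k3_def by simp
    qed
  qed
  also have "\<dots> = ennreal (gap z) + ennreal k1
      + ennreal k2 * (\<integral>\<^sup>+S. ennreal ((opnorm (est n z S - J z))\<^sup>2) \<partial>dataset_law c N D n z)"
    by (simp add: nn_integral_add nn_integral_cmult S.emeasure_space_1)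
  also have "\<dots> \<le> ennreal (gap z) + ennreal k1 + ennreal k2 * ennreal ((e n)\<^sup>2)"
    by (intro add_left_mono mult_left_mono estimation_error_bounds[OF z n]) simp
  also have "\<dots> = ennreal (gap z) + ennreal (k1 + k2 * (e n)\<^sup>2)"
    using k by (simp add: ennreal_mult'' ennreal_plus add.assoc)
  also have "k1 + k2 * (e n)\<^sup>2 = step_error m n a"
    unfolding k1_def k2_def step_error_def by (simp add: algebra_simps)
  finally show ?thesis unfolding k3_def .
qed

end

section \<open>The random output\<close>

text \<open>Jensen's inequality for extended integrals, through the bound of \<open>h\<close> by
  \<open>s / 2 + h\<^sup>2 / (2 * s)\<close>, optimal at \<open>s = sqrt B\<close>; the slack
  \<open>d\<close> keeps \<open>s\<close> positive when \<open>B = 0\<close>.\<close>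

lemma (in prob_space) nn_integral_le_sqrt:
  fixes h :: "'a \<Rightarrow> real"
  assumes [measurable]: "h \<in> borel_measurable M"
    and le: "(\<integral>\<^sup>+\<omega>. ennreal ((h \<omega>)\<^sup>2) \<partial>M) \<le> ennreal B" and B: "0 \<le> B"
  shows "(\<integral>\<^sup>+\<omega>. ennreal (h \<omega>) \<partial>M) \<le> ennreal (sqrt B)"
proof (rule ennreal_le_epsilon)
  fix d :: real assume d: "0 < d"
  define s where "s = sqrt B + d"
  have s: "0 < s" unfolding s_def using d B by (intro add_nonneg_pos) auto
  have "(sqrt B)\<^sup>2 \<le> s\<^sup>2" unfolding s_def using d B by (intro power_mono) auto
  then have "B \<le> s\<^sup>2" using B by simp
  have "h \<omega> \<le> s / 2 + 1 / (2 * s) * (h \<omega>)\<^sup>2" for \<omega>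
    using young_weighted[of s "h \<omega>" 1] s by simp
  then have "ennreal (h \<omega>) \<le> ennreal (s / 2) + ennreal (1 / (2 * s)) * ennreal ((h \<omega>)\<^sup>2)" for \<omega>
    using s by (simp add: ennreal_mult''[symmetric] ennreal_plus[symmetric] ennreal_leI del: ennreal_plus)
  then have "(\<integral>\<^sup>+\<omega>. ennreal (h \<omega>) \<partial>M) \<le> (\<integral>\<^sup>+\<omega>. ennreal (s / 2) + ennreal (1 / (2 * s)) * ennreal ((h \<omega>)\<^sup>2) \<partial>M)"
    by (rule nn_integral_mono)
  also have "\<dots> = ennreal (s / 2) + ennreal (1 / (2 * s)) * (\<integral>\<^sup>+\<omega>. ennreal ((h \<omega>)\<^sup>2) \<partial>M)"
    by (simp add: nn_integral_add nn_integral_cmult emeasure_space_1)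
  also have "\<dots> \<le> ennreal (s / 2) + ennreal (1 / (2 * s)) * ennreal (s\<^sup>2)"
    using \<open>B \<le> s\<^sup>2\<close> by (intro add_left_mono mult_left_mono order_trans[OF le] ennreal_leI) auto
  also have "\<dots> = ennreal s"
    using s by (simp add: ennreal_mult''[symmetric] ennreal_plus[symmetric] power2_eq_square del: ennreal_plus)
  also have "\<dots> = ennreal (sqrt B) + ennreal d" unfolding s_def using d B by simp
  finally show "(\<integral>\<^sup>+\<omega>. ennreal (h \<omega>) \<partial>M) \<le> ennreal (sqrt B) + ennreal d" .
qed

text \<open>Independence of the index is given on events. It passes to integrals as an equality of
  measures: \<open>M\<close> cut down to the event that \<open>tstar\<close> equals \<open>t\<close>
  is, on \<open>G\<close>, a multiple of \<open>M\<close>.\<close>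

lemma nn_integral_random_index:
  assumes M: "prob_space M" "subalgebra M G" and index: "random_index M G w T tstar"
    and w: "\<And>t. t \<le> T \<Longrightarrow> 0 \<le> w t"
    and h: "\<And>t. t \<le> T \<Longrightarrow> h t \<in> borel_measurable G"
  shows "(\<integral>\<^sup>+\<omega>. h (tstar \<omega>) \<omega> \<partial>M) = (\<Sum>t\<le>T. ennreal (w t / (\<Sum>s\<le>T. w s)) * (\<integral>\<^sup>+\<omega>. h t \<omega> \<partial>M))"
proof -
  interpret prob_space M by fact
  have ts [measurable]: "tstar \<in> measurable M (count_space UNIV)" and le: "\<And>\<omega>. \<omega> \<in> space M \<Longrightarrow> tstar \<omega> \<le> T"
    and prob: "\<And>t E. t \<le> T \<Longrightarrow> E \<in> sets G \<Longrightarrow>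
      measure M {\<omega>\<in>E. tstar \<omega> = t} = w t / (\<Sum>s\<le>T. w s) * measure M E"
    using index by (auto simp: random_index_def)
  have hM [measurable]: "t \<le> T \<Longrightarrow> h t \<in> borel_measurable M" for t
    using measurable_from_subalg[OF M(2) h] .
  have comp: "(\<integral>\<^sup>+\<omega>. h t \<omega> * indicator {\<omega>\<in>space M. tstar \<omega> = t} \<omega> \<partial>M)
      = ennreal (w t / (\<Sum>s\<le>T. w s)) * (\<integral>\<^sup>+\<omega>. h t \<omega> \<partial>M)" if t: "t \<le> T" for t
  proof -
    let ?p = "w t / (\<Sum>s\<le>T. w s)"
    let ?N = "density M (indicator {\<omega>\<in>space M. tstar \<omega> = t})"
    have sub: "subalgebra ?N G" using M(2) by (simp add: subalgebra_def)
    have "0 \<le> ?p" using w t by (intro divide_nonneg_nonneg sum_nonneg) auto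
    have eq: "restr_to_subalg ?N G = scale_measure (ennreal ?p) (restr_to_subalg M G)"
    proof (rule measure_eqI)
      show "sets (restr_to_subalg ?N G) = sets (scale_measure (ennreal ?p) (restr_to_subalg M G))"
        using sub M(2) by (simp add: sets_restr_to_subalg)
      fix E assume "E \<in> sets (restr_to_subalg ?N G)"
      then have E: "E \<in> sets G" using sets_restr_to_subalg[OF sub] by simp
      then have EM: "E \<in> sets M" using M(2) by (auto simp: subalgebra_def)
      then have "{\<omega>\<in>space M. tstar \<omega> = t} \<inter> E = {\<omega>\<in>E. tstar \<omega> = t}" using sets.sets_into_space by auto
      then have "emeasure (restr_to_subalg ?N G) E = emeasure M {\<omega>\<in>E. tstar \<omega> = t}"
        using EM by (simp add: emeasure_restr_to_subalg[OF sub E] emeasure_restricted)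
      also have "\<dots> = ennreal ?p * emeasure M E"
        unfolding emeasure_eq_measure prob[OF t E] by (rule ennreal_mult'') simp
      finally show "emeasure (restr_to_subalg ?N G) E = emeasure (scale_measure (ennreal ?p) (restr_to_subalg M G)) E"
        by (simp add: emeasure_restr_to_subalg[OF M(2) E])
    qed
    have "(\<integral>\<^sup>+\<omega>. h t \<omega> * indicator {\<omega>\<in>space M. tstar \<omega> = t} \<omega> \<partial>M) = (\<integral>\<^sup>+\<omega>. h t \<omega> \<partial>?N)"
      using t by (subst nn_integral_density) (auto simp: mult.commute)
    also have "\<dots> = (\<integral>\<^sup>+\<omega>. h t \<omega> \<partial>restr_to_subalg ?N G)"
      by (rule nn_integral_subalgebra2[OF sub h[OF t], symmetric])
    also have "\<dots> = ennreal ?p * (\<integral>\<^sup>+\<omega>. h t \<omega> \<partial>restr_to_subalg M G)"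
      unfolding eq using h[OF t] M(2)
      by (intro nn_integral_scale_measure) (simp add: measurable_in_subalg' measurable_def sets_restr_to_subalg space_restr_to_subalg subalgebra_def)
    also have "\<dots> = ennreal ?p * (\<integral>\<^sup>+\<omega>. h t \<omega> \<partial>M)"
      by (simp add: nn_integral_subalgebra2[OF M(2) h[OF t]])
    finally show ?thesis .
  qed
  have "(\<integral>\<^sup>+\<omega>. h (tstar \<omega>) \<omega> \<partial>M) = (\<integral>\<^sup>+\<omega>. (\<Sum>t\<le>T. h t \<omega> * indicator {\<omega>\<in>space M. tstar \<omega> = t} \<omega>) \<partial>M)"
  proof (rule nn_integral_cong)
    fix \<omega> assume \<omega>: "\<omega> \<in> space M"
    have "(\<Sum>t\<le>T. h t \<omega> * indicator {\<omega>\<in>space M. tstar \<omega> = t} \<omega>)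
        = (\<Sum>t\<le>T. if tstar \<omega> = t then h t \<omega> else 0)"
      using \<omega> by (intro sum.cong) auto
    then show "h (tstar \<omega>) \<omega> = (\<Sum>t\<le>T. h t \<omega> * indicator {\<omega>\<in>space M. tstar \<omega> = t} \<omega>)"
      using le[OF \<omega>] by simp
  qed
  also have "\<dots> = (\<Sum>t\<le>T. \<integral>\<^sup>+\<omega>. h t \<omega> * indicator {\<omega>\<in>space M. tstar \<omega> = t} \<omega> \<partial>M)"
    by (rule nn_integral_sum) auto
  also have "\<dots> = (\<Sum>t\<le>T. ennreal (w t / (\<Sum>s\<le>T. w s)) * (\<integral>\<^sup>+\<omega>. h t \<omega> \<partial>M))"
    by (intro sum.cong comp) auto
  finally show ?thesis .
qed

section \<open>Descent along a run\<close>

context lspl_setting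
begin

context
  fixes M :: "'w measure" and F and alpha m n z0 T W S z
  assumes run: "lspl_run M F X phi c N D est alpha m n z0 T W S z" and z0: "z0 \<in> X"
    and alpha: "\<And>t. rho + lphi * Lc < alpha t" and m: "\<And>t. 0 < m t" and n: "\<And>t. 1 \<le> n t"
begin

lemma run_prob_space: "prob_space M"
  using run by (simp add: lspl_run_def)

lemma run_subalgebra: "t \<le> Suc T \<Longrightarrow> subalgebra M (F t)"
  using run by (simp add: lspl_run_def)

lemma run_filtration: "t \<le> Suc T \<Longrightarrow> subalgebra (F (Suc T)) (F t)"
proof (induction t rule: inc_induct)
  case (step t)
  then have "subalgebra (F (Suc t)) (F t)" using run by (simp add: lspl_run_def)
  with step.IH show ?case by (auto simp: subalgebra_def)
qed (simp add: subalgebra_def)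

lemma run_measurable:
  assumes "t \<le> Suc T"
  shows "z t \<in> borel_measurable (F t)" "z t \<in> borel_measurable M" "z t \<in> borel_measurable (F (Suc T))"
proof -
  show 1: "z t \<in> borel_measurable (F t)" using run assms by (simp add: lspl_run_def)
  show "z t \<in> borel_measurable M" "z t \<in> borel_measurable (F (Suc T))"
    using measurable_from_subalg[OF run_subalgebra[OF assms] 1]
      measurable_from_subalg[OF run_filtration[OF assms] 1] by auto
qed

lemma run_in:
  assumes "t \<le> Suc T" shows "AE \<omega> in M. z t \<omega> \<in> X"
proof (cases t)
  case 0
  have "AE \<omega> in M. z 0 \<omega> = z0" using run by (simp add: lspl_run_def)
  then show ?thesis unfolding 0 by eventually_elim (simp add: z0)
next
  case (Suc s)
  then have "AE \<omega> in M. is_arg_min (spl_model phi (m s) (alpha s) (z s \<omega>) (W s \<omega>) (est (n s) (z s \<omega>) (S s \<omega>)))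
      (\<lambda>y. y \<in> X) (z (Suc s) \<omega>)"
    using run assms by (simp add: lspl_run_def)
  then show ?thesis unfolding Suc by eventually_elim (simp add: is_arg_min_def)
qed

lemma run_samples_measurable:
  assumes "t \<le> T"
  shows "W t \<in> measurable M (Pi\<^sub>M {..<m t} (\<lambda>_. borel))"
    and "S t \<in> measurable M (Pi\<^sub>M {..<n t} (\<lambda>_. borel \<Otimes>\<^sub>M borel))"
proof -
  have sub: "subalgebra M (F (Suc t))" using run_subalgebra[of "Suc t"] assms by simp
  have "W t \<in> measurable (F (Suc t)) (Pi\<^sub>M {..<m t} (\<lambda>_. borel))"
    "S t \<in> measurable (F (Suc t)) (Pi\<^sub>M {..<n t} (\<lambda>_. borel \<Otimes>\<^sub>M borel))"
    using run assms by (simp_all add: lspl_run_def)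
  then show "W t \<in> measurable M (Pi\<^sub>M {..<m t} (\<lambda>_. borel))"
    "S t \<in> measurable M (Pi\<^sub>M {..<n t} (\<lambda>_. borel \<Otimes>\<^sub>M borel))"
    using measurable_from_subalg[OF sub] by blast+
qed

lemma run_fresh:
  assumes t: "t \<le> T" and H: "H \<in> borel_measurable (noise (m t) (n t))"
  shows "(\<integral>\<^sup>+\<omega>. H (z t \<omega>, W t \<omega>, S t \<omega>) \<partial>M)
    = (\<integral>\<^sup>+\<omega>. \<integral>\<^sup>+s. \<integral>\<^sup>+w. H (z t \<omega>, w, s) \<partial>sample_law c N (m t) (z t \<omega>) \<partial>dataset_law c N D (n t) (z t \<omega>) \<partial>M)"
proof -
  obtain U :: "(nat \<Rightarrow> (real^'d) \<times> (real^'l)) measure" and G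
    where UG: "simulated (dataset_law c N D (n t)) (Pi\<^sub>M {..<n t} (\<lambda>_. borel \<Otimes>\<^sub>M borel)) U G"
    using simulated_dataset_law[OF n] by blast
  have law: "\<forall>E\<in>sets (F t). \<forall>A\<in>sets (Pi\<^sub>M {..<m t} (\<lambda>_. borel)).
        \<forall>B\<in>sets (Pi\<^sub>M {..<n t} (\<lambda>_. borel \<Otimes>\<^sub>M borel)).
          emeasure M {\<omega>\<in>E. W t \<omega> \<in> A \<and> S t \<omega> \<in> B} =
          (\<integral>\<^sup>+\<omega>\<in>E. emeasure (sample_law c N (m t) (z t \<omega>)) A
                  * emeasure (dataset_law c N D (n t) (z t \<omega>)) B \<partial>M)"
    using run t by (simp add: lspl_run_def)
  show ?thesis
  proof (rule nn_integral_fresh_samples[OF run_prob_space run_subalgebra run_measurable(1) run_samples_measurable simulated_sample_law UG])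
    fix E A B
    assume "E \<in> sets (F t)" "A \<in> sets (Pi\<^sub>M {..<m t} (\<lambda>_. borel :: (real^'l) measure))"
      "B \<in> sets (Pi\<^sub>M {..<n t} (\<lambda>_. borel \<Otimes>\<^sub>M borel :: ((real^'d) \<times> (real^'l)) measure))"
    then show "emeasure M {\<omega>\<in>E. W t \<omega> \<in> A \<and> S t \<omega> \<in> B} = (\<integral>\<^sup>+\<omega>\<in>E. emeasure (sample_law c N (m t) (z t \<omega>)) A
                  * emeasure (dataset_law c N D (n t) (z t \<omega>)) B \<partial>M)"
      using law by blast
  qed (use t H in \<open>auto simp: noise_def\<close>)
qed

text \<open>The estimator bound concerns deterministic points of \<open>X\<close>; integrating the
  indicator of the exceptional set with \<open>run_fresh\<close> transfers it to the random
  iterate.\<close>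

lemma run_admissible:
  assumes t: "t \<le> T"
  shows "AE \<omega> in M. admissible (n t) (z t \<omega>, W t \<omega>, S t \<omega>)"
proof -
  let ?B = "{p. \<not> admissible (n t) p}"
  note [measurable] = admissible_measurable[OF n[of t], of "m t"]
  have meas: "(\<lambda>p. indicator ?B p :: ennreal) \<in> borel_measurable (noise (m t) (n t))" by measurable
  have "(\<lambda>\<omega>. (z t \<omega>, W t \<omega>, S t \<omega>)) \<in> measurable M (noise (m t) (n t))"
    unfolding noise_def using t by (intro measurable_Pair run_samples_measurable run_measurable(2)) auto
  from measurable_compose[OF this meas]
  have ind: "(\<lambda>\<omega>. indicator ?B (z t \<omega>, W t \<omega>, S t \<omega>) :: ennreal) \<in> borel_measurable M" .
  have "(\<integral>\<^sup>+\<omega>. indicator ?B (z t \<omega>, W t \<omega>, S t \<omega>) \<partial>M) = (\<integral>\<^sup>+\<omega>. \<integral>\<^sup>+s. \<integral>\<^sup>+w. indicator ?B (z t \<omega>, w, s)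
      \<partial>sample_law c N (m t) (z t \<omega>) \<partial>dataset_law c N D (n t) (z t \<omega>) \<partial>M)"
    by (rule run_fresh[OF t meas])
  also have "\<dots> = (\<integral>\<^sup>+\<omega>. 0 \<partial>M)"
  proof (rule nn_integral_cong_AE)
    show "AE \<omega> in M. (\<integral>\<^sup>+s. \<integral>\<^sup>+w. indicator ?B (z t \<omega>, w, s)
      \<partial>sample_law c N (m t) (z t \<omega>) \<partial>dataset_law c N D (n t) (z t \<omega>)) = (0 :: ennreal)"
      using run_in[of t, OF le_SucI[OF t]]
    proof eventually_elim
      case (elim \<omega>)
      have "AE s in dataset_law c N D (n t) (z t \<omega>). opnorm (est (n t) (z t \<omega>) s) \<le> lhat"
        using estimator_bounded elim n by blast
      then have "(\<integral>\<^sup>+s. \<integral>\<^sup>+w. indicator ?B (z t \<omega>, w, s)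
        \<partial>sample_law c N (m t) (z t \<omega>) \<partial>dataset_law c N D (n t) (z t \<omega>)) = (\<integral>\<^sup>+s. 0 \<partial>dataset_law c N D (n t) (z t \<omega>))"
      proof (intro nn_integral_cong_AE, eventually_elim)
        case (elim s)
        then show ?case using \<open>z t \<omega> \<in> X\<close> by (simp add: admissible_def)
      qed
      then show ?case by simp
    qed
  qed
  finally have "AE \<omega> in M. (indicator ?B (z t \<omega>, W t \<omega>, S t \<omega>) :: ennreal) = 0"
    using ind by (simp add: nn_integral_0_iff_AE)
  then show ?thesis by eventually_elim (auto simp: indicator_def split: if_splits)
qed

lemma run_next:
  assumes t: "t \<le> T"
  shows "AE \<omega> in M. z (Suc t) \<omega> = next_iterate (m t) (n t) (alpha t) (z t \<omega>, W t \<omega>, S t \<omega>)"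
proof -
  have "AE \<omega> in M. is_arg_min (spl_model phi (m t) (alpha t) (z t \<omega>) (W t \<omega>) (est (n t) (z t \<omega>) (S t \<omega>)))
      (\<lambda>y. y \<in> X) (z (Suc t) \<omega>)"
    using run t by (simp add: lspl_run_def)
  with run_admissible[OF t] show ?thesis
  proof eventually_elim
    case (elim \<omega>)
    then show ?case
      using is_arg_min_step[OF m a_gt_lamhat[OF m alpha]] by (simp add: next_iterate_def admissible_def)
  qed
qed

abbreviation "coef t \<equiv> rho * kappa / (4 * (alpha t + rho - tau))"
abbreviation "dist2 t \<equiv> (\<integral>\<^sup>+\<omega>. ennreal ((norm (P (z t \<omega>) - z t \<omega>))\<^sup>2) \<partial>M)"

lemma coef_nonneg: "0 \<le> coef t"
  using rho_pos kappa_pos a_tau_pos[OF m alpha, of t] by simp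

lemma run_descent:
  assumes t: "t \<le> T"
  shows "(\<integral>\<^sup>+\<omega>. ennreal (gap (z (Suc t) \<omega>)) \<partial>M) + ennreal (coef t) * dist2 t
    \<le> (\<integral>\<^sup>+\<omega>. ennreal (gap (z t \<omega>)) \<partial>M) + ennreal (step_error (m t) (n t) (alpha t))"
proof -
  interpret M: prob_space M by (rule run_prob_space)
  let ?H = "\<lambda>p. ennreal (gap (next_iterate (m t) (n t) (alpha t) p)) + ennreal (coef t * (norm (P (fst p) - fst p))\<^sup>2)"
  have [measurable]: "z t \<in> borel_measurable M" "z (Suc t) \<in> borel_measurable M"
    using run_measurable(2) t by auto
  note [measurable] = next_iterate_measurable[OF m n a_gt_lamhat[OF m alpha], of t t t] noise_measurable(2)[OF n[of t], of "m t"]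
  have H: "?H \<in> borel_measurable (noise (m t) (n t))" by measurable
  have "(\<integral>\<^sup>+\<omega>. ennreal (gap (z (Suc t) \<omega>)) \<partial>M) + ennreal (coef t) * dist2 t
      = (\<integral>\<^sup>+\<omega>. ennreal (gap (z (Suc t) \<omega>)) + ennreal (coef t * (norm (P (z t \<omega>) - z t \<omega>))\<^sup>2) \<partial>M)"
  proof -
    have "(\<integral>\<^sup>+\<omega>. ennreal (coef t * (norm (P (z t \<omega>) - z t \<omega>))\<^sup>2) \<partial>M) = ennreal (coef t) * dist2 t"
      unfolding ennreal_mult'[OF coef_nonneg] by (rule nn_integral_cmult) measurable
    then show ?thesis by (subst nn_integral_add) auto
  qed
  also have "\<dots> = (\<integral>\<^sup>+\<omega>. ?H (z t \<omega>, W t \<omega>, S t \<omega>) \<partial>M)"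
    using run_next[OF t] by (intro nn_integral_cong_AE) (auto elim: eventually_mono)
  also have "\<dots> = (\<integral>\<^sup>+\<omega>. \<integral>\<^sup>+s. \<integral>\<^sup>+w. ?H (z t \<omega>, w, s)
      \<partial>sample_law c N (m t) (z t \<omega>) \<partial>dataset_law c N D (n t) (z t \<omega>) \<partial>M)"
    by (rule run_fresh[OF t H])
  also have "\<dots> \<le> (\<integral>\<^sup>+\<omega>. ennreal (gap (z t \<omega>)) + ennreal (step_error (m t) (n t) (alpha t)) \<partial>M)"
  proof (rule nn_integral_mono_AE)
    show "AE \<omega> in M. (\<integral>\<^sup>+s. \<integral>\<^sup>+w. ?H (z t \<omega>, w, s)
        \<partial>sample_law c N (m t) (z t \<omega>) \<partial>dataset_law c N D (n t) (z t \<omega>))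
      \<le> ennreal (gap (z t \<omega>)) + ennreal (step_error (m t) (n t) (alpha t))"
      using run_in[of t, OF le_SucI[OF t]]
      by eventually_elim (use gap_next_expected[OF m n alpha] in simp)
  qed
  also have "\<dots> = (\<integral>\<^sup>+\<omega>. ennreal (gap (z t \<omega>)) \<partial>M) + ennreal (step_error (m t) (n t) (alpha t))"
    by (simp add: nn_integral_add M.emeasure_space_1)
  finally show ?thesis .
qed

text \<open>The expected gap is passed from step to step by substitution; cancelling it from a
  summed inequality in the extended reals would require its finiteness first.\<close>

lemma run_telescope:
  "k \<le> Suc T \<Longrightarrow> (\<integral>\<^sup>+\<omega>. ennreal (gap (z k \<omega>)) \<partial>M) + (\<Sum>t<k. ennreal (coef t) * dist2 t)
    \<le> ennreal (gap z0) + (\<Sum>t<k. ennreal (step_error (m t) (n t) (alpha t)))"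
proof (induction k)
  case 0
  interpret M: prob_space M by (rule run_prob_space)
  have "AE \<omega> in M. z 0 \<omega> = z0" using run by (simp add: lspl_run_def)
  then have "(\<integral>\<^sup>+\<omega>. ennreal (gap (z 0 \<omega>)) \<partial>M) = (\<integral>\<^sup>+\<omega>. ennreal (gap z0) \<partial>M)"
    by (intro nn_integral_cong_AE) (auto elim: eventually_mono)
  then show ?case by (simp add: M.emeasure_space_1)
next
  case (Suc k)
  have "(\<integral>\<^sup>+\<omega>. ennreal (gap (z (Suc k) \<omega>)) \<partial>M) + (\<Sum>t<Suc k. ennreal (coef t) * dist2 t)
      = ((\<integral>\<^sup>+\<omega>. ennreal (gap (z (Suc k) \<omega>)) \<partial>M) + ennreal (coef k) * dist2 k) + (\<Sum>t<k. ennreal (coef t) * dist2 t)"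
    by (simp only: sum.lessThan_Suc ac_simps)
  also have "\<dots> \<le> ((\<integral>\<^sup>+\<omega>. ennreal (gap (z k \<omega>)) \<partial>M) + ennreal (step_error (m k) (n k) (alpha k)))
      + (\<Sum>t<k. ennreal (coef t) * dist2 t)"
    using Suc.prems by (intro add_right_mono run_descent) simp
  also have "\<dots> = ((\<integral>\<^sup>+\<omega>. ennreal (gap (z k \<omega>)) \<partial>M) + (\<Sum>t<k. ennreal (coef t) * dist2 t))
      + ennreal (step_error (m k) (n k) (alpha k))"
    by (simp only: ac_simps)
  also have "\<dots> \<le> (ennreal (gap z0) + (\<Sum>t<k. ennreal (step_error (m t) (n t) (alpha t))))
      + ennreal (step_error (m k) (n k) (alpha k))"
    using Suc by (intro add_right_mono Suc.IH) simp
  also have "\<dots> = ennreal (gap z0) + (\<Sum>t<Suc k. ennreal (step_error (m t) (n t) (alpha t)))"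
    by (simp only: sum.lessThan_Suc ac_simps)
  finally show ?case .
qed

context
  fixes tstar
  assumes index: "random_index M (F (Suc T)) (\<lambda>t. 1 / (alpha t + rho - tau)) T tstar"
begin

lemma tstar_le: "\<omega> \<in> space M \<Longrightarrow> tstar \<omega> \<le> T"
  using index by (simp add: random_index_def)

lemma output_measurable: "(\<lambda>\<omega>. z (tstar \<omega>) \<omega>) \<in> borel_measurable M"
proof (rule measurable_compose_countable'[where I = "{..T}" and g = tstar])
  have "tstar \<in> measurable M (count_space UNIV)" using index by (simp add: random_index_def)
  then show "tstar \<in> measurable M (count_space {..T})"
    using tstar_le by (auto simp: measurable_def)
qed (use run_measurable(2) in auto)

lemma output_in: "AE \<omega> in M. z (tstar \<omega>) \<omega> \<in> X"
proof -
  have "AE \<omega> in M. \<forall>t\<in>{..T}. z t \<omega> \<in> X"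
    using run_in by (intro AE_finite_allI) auto
  with AE_space[of M] show ?thesis by eventually_elim (use tstar_le in auto)
qed

theorem output_guarantee:
  "(\<integral>\<^sup>+\<omega>. ennreal (norm (P (z (tstar \<omega>) \<omega>) - z (tstar \<omega>) \<omega>)) \<partial>M)
    \<le> ennreal (guarantee_bound (gap z0) rho lphi Lc lhat lamhat tau e alpha m n T)"
proof -
  interpret M: prob_space M by (rule run_prob_space)
  define w where "w t = 1 / (alpha t + rho - tau)" for t
  have w: "0 < w t" for t unfolding w_def using a_tau_pos[OF m alpha] by simp
  define V where "V = (\<Sum>t\<le>T. w t)"
  have V: "0 < V" unfolding V_def using w by (intro sum_pos) auto
  \<comment> \<open>Chosen so that \<open>C * (w t / V) = coef t\<close>: the probabilities of the
    output index are proportional to the decrease coefficients, so its mean squared distance is the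
    telescoped sum divided by \<open>C\<close>.\<close>
  define C where "C = rho * kappa / 4 * V"
  have C: "0 < C" unfolding C_def using V rho_pos kappa_pos by simp
  define E where "E = (\<Sum>t\<le>T. step_error (m t) (n t) (alpha t))"
  have E: "0 \<le> E" unfolding E_def by (intro sum_nonneg step_error_nonneg alpha)
  let ?Q = "\<integral>\<^sup>+\<omega>. ennreal ((norm (P (z (tstar \<omega>) \<omega>) - z (tstar \<omega>) \<omega>))\<^sup>2) \<partial>M"
  have "?Q = (\<Sum>t\<le>T. ennreal (w t / V) * dist2 t)"
    unfolding V_def w_def
  proof (rule nn_integral_random_index[OF M.prob_space_axioms run_subalgebra index])
    show "(\<lambda>\<omega>. ennreal ((norm (P (z t \<omega>) - z t \<omega>))\<^sup>2)) \<in> borel_measurable (F (Suc T))" if "t \<le> T" for t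
    proof -
      have [measurable]: "z t \<in> borel_measurable (F (Suc T))" using run_measurable(3)[of t] that by simp
      show ?thesis by measurable
    qed
  qed (use w in \<open>auto simp: w_def less_imp_le\<close>)
  then have "ennreal C * ?Q = (\<Sum>t\<le>T. ennreal C * ennreal (w t / V) * dist2 t)"
    by (simp add: sum_distrib_left mult.assoc)
  also have "\<dots> = (\<Sum>t<Suc T. ennreal (coef t) * dist2 t)"
  proof (rule sum.cong)
    fix t
    have "C * (w t / V) = coef t" unfolding C_def w_def using V by simp
    then show "ennreal C * ennreal (w t / V) * dist2 t = ennreal (coef t) * dist2 t"
      using C by (simp flip: ennreal_mult')
  qed (simp add: lessThan_Suc_atMost)
  also have "\<dots> \<le> (\<integral>\<^sup>+\<omega>. ennreal (gap (z (Suc T) \<omega>)) \<partial>M) + (\<Sum>t<Suc T. ennreal (coef t) * dist2 t)" by simp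
  also have "\<dots> \<le> ennreal (gap z0) + (\<Sum>t<Suc T. ennreal (step_error (m t) (n t) (alpha t)))"
    by (rule run_telescope) simp
  also have "\<dots> = ennreal (gap z0 + E)"
    unfolding E_def lessThan_Suc_atMost
    using gap_nonneg step_error_nonneg[OF alpha]
    by (subst sum_ennreal) (auto simp: ennreal_plus sum_nonneg)
  finally have "ennreal (1 / C) * (ennreal C * ?Q) \<le> ennreal (1 / C) * ennreal (gap z0 + E)"
    by (rule mult_left_mono) simp
  also have "ennreal (1 / C) * (ennreal C * ?Q) = ?Q"
    using C by (simp add: mult.assoc[symmetric] ennreal_mult'[symmetric])
  also have "ennreal (1 / C) * ennreal (gap z0 + E) = ennreal ((gap z0 + E) / C)"
    using C by (simp add: ennreal_mult'[symmetric])
  finally have Q: "?Q \<le> ennreal ((gap z0 + E) / C)" .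
  note [measurable] = output_measurable
  have "(\<integral>\<^sup>+\<omega>. ennreal (norm (P (z (tstar \<omega>) \<omega>) - z (tstar \<omega>) \<omega>)) \<partial>M) \<le> ennreal (sqrt ((gap z0 + E) / C))"
    using gap_nonneg[of z0] E C by (intro M.nn_integral_le_sqrt Q) auto
  also have "sqrt ((gap z0 + E) / C) = guarantee_bound (gap z0) rho lphi Lc lhat lamhat tau e alpha m n T"
  proof -
    have num: "4 * gap z0 + (\<Sum>t\<le>T. rho / (alpha t + rho - tau) *
              (8 * lphi\<^sup>2 * (1 + lhat)\<^sup>2 / (real (m t) * (alpha t - lamhat))
               + 4 * lphi\<^sup>2 * (e (n t))\<^sup>2 / (2 * rho - lphi * Lc - tau)
               + 2 * lphi\<^sup>2 * (e (n t))\<^sup>2 / (alpha t - rho - lphi * Lc))) = 4 * (gap z0 + E)"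
    proof -
      have id: "p * (8 * l\<^sup>2 * h\<^sup>2 / q + 4 * l\<^sup>2 * d / k + 2 * l\<^sup>2 * d / g)
          = 4 * (p * (2 * (l * h)\<^sup>2 / q + (l\<^sup>2 / k + l\<^sup>2 / (2 * g)) * d))" for p l h q d k g :: real
        by (simp add: algebra_simps power_mult_distrib)
      show ?thesis
        unfolding E_def step_error_def Lmod_def kappa_eq[symmetric] id by (simp add: sum_distrib_left)
    qed
    have den: "(\<Sum>t\<le>T. rho * (2 * rho - lphi * Lc - tau) / (alpha t + rho - tau)) = 4 * C"
    proof -
      have "4 * C = rho * kappa * V" unfolding C_def by simp
      then show ?thesis unfolding V_def w_def kappa_eq[symmetric] by (simp add: sum_distrib_left)
    qed
    have "4 * (gap z0 + E) / (4 * C) = (gap z0 + E) / C" by (rule mult_divide_mult_cancel_left) simp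
    then show ?thesis unfolding guarantee_bound_def num den by (rule arg_cong[OF sym])
  qed
  finally show ?thesis .
qed

text \<open>The companion point is the proximal point of the output. Its stationarity gap is at most
  \<open>rho\<close> times the same distance, which explains \<open>nu / rho\<close> in the
  minimum.\<close>

theorem output_nearly_stationary:
  assumes nu: "0 < nu" and delta: "0 < delta"
    and bound: "guarantee_bound (gap z0) rho lphi Lc lhat lamhat tau e alpha m n T \<le> min delta (nu / rho)"
  shows "nearly_stationary M X f nu delta (\<lambda>\<omega>. z (tstar \<omega>) \<omega>)"
  unfolding nearly_stationary_def
proof (intro conjI bexI[of _ "\<lambda>\<omega>. P (z (tstar \<omega>) \<omega>)"])
  note [measurable] = output_measurable
  let ?I = "\<integral>\<^sup>+\<omega>. ennreal (norm (z (tstar \<omega>) \<omega> - P (z (tstar \<omega>) \<omega>))) \<partial>M"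
  show "(\<lambda>\<omega>. P (z (tstar \<omega>) \<omega>)) \<in> borel_measurable M" by measurable
  have I: "?I \<le> ennreal (min delta (nu / rho))"
    using output_guarantee ennreal_leI[OF bound] by (simp add: norm_minus_commute)
  then show "?I \<le> ennreal delta" by (rule order_trans) (simp add: ennreal_leI)
  have "(\<integral>\<^sup>+\<omega>. stationarity_gap X f (P (z (tstar \<omega>) \<omega>)) \<partial>M)
      \<le> (\<integral>\<^sup>+\<omega>. ennreal rho * ennreal (norm (z (tstar \<omega>) \<omega> - P (z (tstar \<omega>) \<omega>))) \<partial>M)"
    using prox_stationary rho_pos by (intro nn_integral_mono) (simp add: ennreal_mult')
  also have "\<dots> = ennreal rho * ?I" by (rule nn_integral_cmult) measurable
  also have "\<dots> \<le> ennreal rho * ennreal (nu / rho)"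
    by (intro mult_left_mono order_trans[OF I] ennreal_leI) auto
  also have "\<dots> = ennreal nu" using rho_pos by (simp add: ennreal_mult'[symmetric])
  finally show "(\<integral>\<^sup>+\<omega>. stationarity_gap X f (P (z (tstar \<omega>) \<omega>)) \<partial>M) \<le> ennreal nu" .
qed (use output_measurable output_in prox in auto)

end
end
end

section \<open>Rates\<close>

lemma powr_diff_eq_mvt:
  fixes t p :: real
  assumes t: "0 \<le> t" and p: "0 < p"
  shows "\<exists>x. t < x \<and> x < t + 1 \<and> (t + 1) powr p - t powr p = p * x powr (p - 1)"
proof -
  have der: "((\<lambda>x. x powr p) has_real_derivative p * x powr (p - 1)) (at x)" if "t < x" for x
    using that t by (intro has_real_derivative_powr) simp
  have "continuous_on {t..t + 1} (\<lambda>x. x powr p)"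
    using t p by (intro continuous_on_powr' continuous_intros) auto
  then obtain l x where x: "t < x" "x < t + 1" "((\<lambda>x. x powr p) has_real_derivative l) (at x)"
      "(t + 1) powr p - t powr p = (t + 1 - t) * l"
    using MVT[of t "t + 1" "\<lambda>x. x powr p"] der real_differentiable_def by force
  then show ?thesis using DERIV_unique[OF x(3) der[OF x(1)]] by auto
qed

text \<open>No boundary term remains because \<open>0 powr p = 0\<close>.\<close>

lemma sum_powr_telescope:
  fixes p :: real
  shows "(\<Sum>t\<le>T. (real t + 1) powr p - real t powr p) = (real T + 1) powr p"
  by (induction T) (auto simp: add_ac)

lemma sum_powr_ge:
  fixes k :: real
  assumes "0 \<le> k"
  shows "(real T + 1) powr (1 + k) / (1 + k) \<le> (\<Sum>t\<le>T. (real t + 1) powr k)"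
proof -
  have "(real t + 1) powr (1 + k) - real t powr (1 + k) \<le> (1 + k) * (real t + 1) powr k" for t
  proof -
    obtain x where x: "real t < x" "x < real t + 1"
        "(real t + 1) powr (1 + k) - real t powr (1 + k) = (1 + k) * x powr k"
      using powr_diff_eq_mvt[of "real t" "1 + k"] assms by auto
    have "x powr k \<le> (real t + 1) powr k" using x assms by (intro powr_mono2) auto
    then show ?thesis unfolding x(3) using assms by (intro mult_left_mono) auto
  qed
  then have "(\<Sum>t\<le>T. (real t + 1) powr (1 + k) - real t powr (1 + k)) \<le> (\<Sum>t\<le>T. (1 + k) * (real t + 1) powr k)"
    by (rule sum_mono)
  then show ?thesis using assms unfolding sum_powr_telescope sum_distrib_left[symmetric]
    by (simp add: pos_divide_le_eq mult.commute)
qed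

lemma sum_powr_neg_le:
  fixes b :: real
  assumes "0 \<le> b" "b < 1"
  shows "(\<Sum>t\<le>T. (real t + 1) powr (- b)) \<le> (real T + 1) powr (1 - b) / (1 - b)"
proof -
  have "(1 - b) * (real t + 1) powr (- b) \<le> (real t + 1) powr (1 - b) - real t powr (1 - b)" for t
  proof -
    obtain x where x: "real t < x" "x < real t + 1"
        "(real t + 1) powr (1 - b) - real t powr (1 - b) = (1 - b) * x powr (- b)"
      using powr_diff_eq_mvt[of "real t" "1 - b"] assms by auto
    have "(real t + 1) powr (- b) \<le> x powr (- b)" using x assms by (intro powr_mono2') auto
    then show ?thesis unfolding x(3) using assms by (intro mult_left_mono) auto
  qed
  then have "(\<Sum>t\<le>T. (1 - b) * (real t + 1) powr (- b)) \<le> (\<Sum>t\<le>T. (real t + 1) powr (1 - b) - real t powr (1 - b))"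
    by (rule sum_mono)
  then show ?thesis using assms unfolding sum_powr_telescope sum_distrib_left[symmetric]
    by (simp add: pos_le_divide_eq mult.commute)
qed

lemma sum_inverse_le_ln: "(\<Sum>t\<le>T. 1 / (real t + 1)) \<le> 1 + ln (real T + 1)"
proof (induction T)
  case (Suc T)
  have "1 / (real T + 2) \<le> ln (real T + 2) - ln (real T + 1)"
  proof -
    have "ln ((real T + 1) / (real T + 2)) \<le> (real T + 1) / (real T + 2) - 1"
      by (rule ln_le_minus_one) simp
    also have "\<dots> = - (1 / (real T + 2))" by (simp add: field_simps)
    finally show ?thesis by (simp add: ln_div)
  qed
  then show ?case using Suc by (simp add: add_ac)
qed simp

text \<open>Every term is at least the last one; for exponents below 1 this already has the right
  order.\<close>

lemma sum_powr_neg_ge: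
  fixes q :: real
  assumes "0 \<le> q"
  shows "(real T + 1) powr (1 - q) \<le> (\<Sum>t\<le>T. (real t + 1) powr (- q))"
proof -
  have "(real T + 1) powr (1 - q) = (\<Sum>t\<le>T. (real T + 1) powr (- q))"
    by (simp add: powr_diff powr_minus field_simps)
  also have "\<dots> \<le> (\<Sum>t\<le>T. (real t + 1) powr (- q))"
    using assms by (intro sum_mono powr_mono2') auto
  finally show ?thesis .
qed

section \<open>Lower bound on the samples for arbitrary growth rates\<close>

locale growth_rates =
  fixes alpha0 b r :: real and m0 n0 :: nat
  assumes alpha0: "0 < alpha0" and b: "0 \<le> b" "b \<le> 1 / 2" and r: "0 < r" "r < 1 / 2"
    and m0: "0 < m0" and n0: "0 < n0"
begin

abbreviation "alpha \<equiv> step_param alpha0 b"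
abbreviation "m \<equiv> sample_size m0"
abbreviation "n \<equiv> sample_size n0"
abbreviation "rate j k T \<equiv> rate_bound r alpha (m j) (n k) T"
abbreviation "jstar \<equiv> 1 - 2 * b"
abbreviation "kstar \<equiv> (1 - b) / (2 * r)"

lemma alpha_pos: "0 < alpha t"
  using alpha0 by (simp add: step_param_def)

text \<open>The factor 2 absorbs the rounding, as the rounded quantity is at least 1.\<close>

lemma sample_size_bounds:
  assumes "0 < c" "0 \<le> j"
  shows "(real t + 1) powr j \<le> real (sample_size c j t)"
    and "real (sample_size c j t) \<le> 2 * real c * (real t + 1) powr j"
    and "1 \<le> sample_size c j t"
proof -
  have u: "1 \<le> (real t + 1) powr j" using assms by (simp add: ge_one_powr_ge_zero)
  have c: "1 \<le> real c" using assms by simp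
  have le: "(real t + 1) powr j \<le> real c * (real t + 1) powr j" using c by (simp add: mult_le_cancel_right1)
  have eq: "real (sample_size c j t) = of_int \<lceil>real c * (real t + 1) powr j\<rceil>"
    unfolding sample_size_def by (simp add: of_nat_nat)
  have "real c * (real t + 1) powr j \<le> of_int \<lceil>real c * (real t + 1) powr j\<rceil>" by (rule le_of_int_ceiling)
  then show 1: "(real t + 1) powr j \<le> real (sample_size c j t)" unfolding eq using le by linarith
  show "real (sample_size c j t) \<le> 2 * real c * (real t + 1) powr j"
    unfolding eq using of_int_ceiling_le_add_one[of "real c * (real t + 1) powr j"] le u by linarith
  show "1 \<le> sample_size c j t" using 1 u by linarith
qed

lemma sum_inverse_alpha_ge: "(real T + 1) powr (1 - b) / alpha0 \<le> (\<Sum>t\<le>T. 1 / alpha t)"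
proof -
  have "(\<Sum>t\<le>T. 1 / alpha t) = (\<Sum>t\<le>T. (real t + 1) powr (- b)) / alpha0"
    unfolding step_param_def sum_divide_distrib by (intro sum.cong) (auto simp: powr_minus field_simps)
  then show ?thesis using sum_powr_neg_ge[OF b(1), of T] alpha0 by (simp add: divide_right_mono)
qed

lemma sum_inverse_alpha_le: "(\<Sum>t\<le>T. 1 / alpha t) \<le> (real T + 1) powr (1 - b) / ((1 - b) * alpha0)"
proof -
  have "(\<Sum>t\<le>T. 1 / alpha t) = (\<Sum>t\<le>T. (real t + 1) powr (- b)) / alpha0"
    unfolding step_param_def sum_divide_distrib by (intro sum.cong) (auto simp: powr_minus field_simps)
  also have "\<dots> \<le> ((real T + 1) powr (1 - b) / (1 - b)) / alpha0"
    using sum_powr_neg_le[of b T] b alpha0 by (intro divide_right_mono) auto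
  finally show ?thesis by simp
qed

definition numerator :: "real \<Rightarrow> real \<Rightarrow> nat \<Rightarrow> real" where
  "numerator j k T = 1 + (\<Sum>t\<le>T. 1 / (real (m j t) * (alpha t)\<^sup>2)
                       + 1 / (real (n k t) powr (2 * r) * alpha t)
                       + 1 / (real (n k t) powr (2 * r) * (alpha t)\<^sup>2))"

lemma rate_eq: "rate j k T = sqrt (numerator j k T / (\<Sum>t\<le>T. 1 / alpha t))"
  unfolding rate_bound_def numerator_def ..

lemma numerator_ge_1: "1 \<le> numerator j k T"
  unfolding numerator_def using alpha_pos by (auto intro!: sum_nonneg add_nonneg_nonneg simp: less_imp_le)

lemma sum_inverse_alpha_pos: "0 < (\<Sum>t\<le>T. 1 / alpha t)"
  using alpha_pos by (intro sum_pos) auto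

lemma rate_nonneg: "0 \<le> rate j k T"
  unfolding rate_eq using numerator_ge_1[of j k T] sum_inverse_alpha_pos[of T] by simp

lemma rate_sq: "(rate j k T)\<^sup>2 = numerator j k T / (\<Sum>t\<le>T. 1 / alpha t)"
  unfolding rate_eq using numerator_ge_1[of j k T] sum_inverse_alpha_pos[of T] by simp

lemma rate_sq_ge:
  assumes k: "0 \<le> k"
  shows "(1 - b) * alpha0 * (real T + 1) powr (- (1 - b)) \<le> (rate j k T)\<^sup>2"
    and "(1 - b) / (2 * real n0) * (real T + 1) powr (- (2 * r * k)) \<le> (rate j k T)\<^sup>2"
proof -
  let ?S = "\<Sum>t\<le>T. 1 / alpha t" and ?N = "real T + 1"
  have ge: "y * ((1 - b) * alpha0 * ?N powr (- (1 - b))) \<le> (rate j k T)\<^sup>2" if y: "0 \<le> y" "y \<le> numerator j k T" for y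
  proof -
    have "y * ((1 - b) * alpha0 * ?N powr (- (1 - b))) = y / (?N powr (1 - b) / ((1 - b) * alpha0))"
      unfolding powr_minus by (simp add: divide_inverse mult_ac)
    also have "\<dots> \<le> numerator j k T / ?S"
      using y sum_inverse_alpha_le[of T] sum_inverse_alpha_pos[of T] by (intro frac_le) auto
    finally show ?thesis unfolding rate_sq .
  qed
  show "(1 - b) * alpha0 * ?N powr (- (1 - b)) \<le> (rate j k T)\<^sup>2"
    using ge[of 1] numerator_ge_1 by simp
  \<comment> \<open>Lower bound for the part of the numerator due to the estimation error; division
    by the sum of \<open>1 / alpha t\<close>, of order \<open>?N powr (1 - b)\<close>, leaves
    \<open>?N powr (- (2 * r * k))\<close>.\<close>
  define y where "y = ?N powr (1 - (2 * r * k + b)) / (2 * real n0 * alpha0)"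
  have term_ge: "(real t + 1) powr (- (2 * r * k + b)) / (2 * real n0 * alpha0)
      \<le> 1 / (real (n k t) powr (2 * r) * alpha t)" for t
  proof -
    let ?u = "real t + 1"
    have "real (n k t) powr (2 * r) \<le> (2 * real n0 * ?u powr k) powr (2 * r)"
      using sample_size_bounds(2)[OF n0 k, of t] r by (intro powr_mono2) auto
    also have "\<dots> = (2 * real n0) powr (2 * r) * ?u powr (2 * r * k)"
      by (simp add: powr_mult powr_powr mult_ac)
    \<comment> \<open>The exponent \<open>2 * r\<close> is below 1 and the base is at least
      1.\<close>
    also have "\<dots> \<le> (2 * real n0) powr 1 * ?u powr (2 * r * k)"
      using r n0 by (intro mult_right_mono powr_mono) auto
    finally have "real (n k t) powr (2 * r) * alpha t \<le> 2 * real n0 * ?u powr (2 * r * k) * alpha t"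
      using alpha_pos[of t] n0 by (intro mult_right_mono) auto
    also have "\<dots> = 2 * real n0 * alpha0 * ?u powr (2 * r * k + b)"
      by (simp add: step_param_def powr_add)
    finally have "1 / (2 * real n0 * alpha0 * ?u powr (2 * r * k + b)) \<le> 1 / (real (n k t) powr (2 * r) * alpha t)"
      using sample_size_bounds(3)[OF n0 k, of t] alpha_pos[of t] by (intro frac_le) auto
    moreover have "?u powr (- (2 * r * k + b)) / (2 * real n0 * alpha0) = 1 / (2 * real n0 * alpha0 * ?u powr (2 * r * k + b))"
      unfolding powr_minus by (simp add: field_simps)
    ultimately show ?thesis by simp
  qed
  have "y \<le> (\<Sum>t\<le>T. (real t + 1) powr (- (2 * r * k + b))) / (2 * real n0 * alpha0)"
    unfolding y_def using sum_powr_neg_ge[of "2 * r * k + b" T] r k b n0 alpha0 by (intro divide_right_mono) auto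
  also have "\<dots> \<le> (\<Sum>t\<le>T. 1 / (real (n k t) powr (2 * r) * alpha t))"
    unfolding sum_divide_distrib by (intro sum_mono term_ge)
  also have "\<dots> \<le> numerator j k T"
    unfolding numerator_def using alpha_pos
    by (simp add: sum.distrib) (intro add_nonneg_nonneg sum_nonneg, auto simp: less_imp_le)
  finally have "y \<le> numerator j k T" .
  moreover have "0 \<le> y" unfolding y_def using alpha0 by simp
  ultimately have "y * ((1 - b) * alpha0 * ?N powr (- (1 - b))) \<le> (rate j k T)\<^sup>2" by (intro ge)
  moreover have "y * ((1 - b) * alpha0 * ?N powr (- (1 - b))) = (1 - b) / (2 * real n0) * ?N powr (- (2 * r * k))"
  proof -
    have "y * ((1 - b) * alpha0 * ?N powr (- (1 - b)))
        = (1 - b) / (2 * real n0) * (?N powr (1 - (2 * r * k + b)) * ?N powr (- (1 - b)))"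
      unfolding y_def using alpha0 n0 by (simp add: field_simps)
    also have "?N powr (1 - (2 * r * k + b)) * ?N powr (- (1 - b)) = ?N powr (- (2 * r * k))"
      by (simp flip: powr_add)
    finally show ?thesis .
  qed
  ultimately show "(1 - b) / (2 * real n0) * ?N powr (- (2 * r * k)) \<le> (rate j k T)\<^sup>2" by simp
qed

text \<open>The data sets alone give the bound, uniformly in \<open>j\<close>.\<close>

lemma total_samples_ge:
  assumes "0 \<le> k"
  shows "(real T + 1) powr (1 + k) / (1 + k) \<le> real (total_samples (m j) (n k) T)"
proof -
  have "(real T + 1) powr (1 + k) / (1 + k) \<le> (\<Sum>t\<le>T. (real t + 1) powr k)"
    using assms by (rule sum_powr_ge)
  also have "\<dots> \<le> (\<Sum>t\<le>T. real (n k t))"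
    using sample_size_bounds(1)[OF n0 assms] by (intro sum_mono)
  also have "\<dots> \<le> real (total_samples (m j) (n k) T)"
    unfolding total_samples_def by (simp add: sum.distrib sum_nonneg)
  finally show ?thesis .
qed

lemma powr_lower_bound:
  fixes N d p q x w :: real
  assumes N: "1 \<le> N" and p: "0 < p" and q: "0 \<le> q" and d: "0 < d" and x: "0 < x" "x \<le> 1"
    and le: "d * N powr (- p) \<le> x\<^sup>2" and w: "w \<le> 2 * q / p"
  shows "d powr (q / p) * x powr (- w) \<le> N powr q"
proof -
  have "d * x powr (- 2) \<le> N powr p"
    using le N x by (simp add: powr_minus field_simps)
  then have "(d * x powr (- 2)) powr (q / p) \<le> (N powr p) powr (q / p)"
    using p q d by (intro powr_mono2) auto
  also have "\<dots> = N powr q" using p by (simp add: powr_powr)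
  also have "(d * x powr (- 2)) powr (q / p) = d powr (q / p) * x powr (- (2 * q / p))"
    using d by (simp add: powr_mult powr_powr)
  finally have "d powr (q / p) * x powr (- (2 * q / p)) \<le> N powr q" .
  moreover have "x powr (- w) \<le> x powr (- (2 * q / p))"
    using x w by (intro powr_mono') auto
  ultimately show ?thesis
    by (smt (verit) mult_left_mono powr_ge_zero)
qed

text \<open>If \<open>kstar \<le> k\<close>, the optimisation error forces \<open>N\<close> above
  the order \<open>x powr (- (2 / (1 - b)))\<close>, and the cost \<open>N powr (1 + k)\<close> is
  least at \<open>kstar\<close>. If \<open>k < kstar\<close> is positive, the estimation error
  forces \<open>N\<close> above the order \<open>x powr (- (1 / (r * k)))\<close>, and the exponent
  \<open>1 / (r * k) + 1 / r\<close> of the cost again exceeds the one at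
  \<open>kstar\<close>.\<close>

theorem total_samples_lower_bound:
  assumes j: "0 \<le> j" and k: "0 \<le> k"
    and T: "(\<lambda>x. rate j k (T x)) \<in> O[at_right 0](\<lambda>x. x)"
  shows "(\<lambda>x. real (total_samples (m j) (n k) (T x)))
    \<in> \<Omega>[at_right 0](\<lambda>x. x powr (- (2 / (1 - b)) - 1 / r))"
proof -
  let ?w = "2 / (1 - b) + 1 / r"
  obtain C where C: "0 < C" and ev: "\<forall>\<^sub>F x in at_right 0. norm (rate j k (T x)) \<le> C * norm x"
    using landau_o.bigE[OF T] by blast
  have small: "\<forall>\<^sub>F x in at_right (0::real). 0 < x \<and> x \<le> 1 \<and> (rate j k (T x))\<^sup>2 \<le> C\<^sup>2 * x\<^sup>2"
  proof -
    have "\<forall>\<^sub>F x in at_right (0::real). 0 < x \<and> x \<le> 1"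
      by (auto simp: eventually_at_right[of 0 1] intro!: exI[of _ 1])
    with ev show ?thesis
    proof eventually_elim
      case (elim x)
      then have "rate j k (T x) \<le> C * x" by simp
      then have "(rate j k (T x))\<^sup>2 \<le> (C * x)\<^sup>2" using rate_nonneg by (intro power_mono)
      then show ?case using elim by (simp add: power_mult_distrib)
    qed
  qed
  have main: "\<exists>d>0. \<forall>\<^sub>F x in at_right (0::real). d * x powr (- ?w) \<le> (real (T x) + 1) powr (1 + k)"
  proof (cases "kstar \<le> k")
    case True
    define d where "d = (1 - b) * alpha0 / C\<^sup>2"
    have d: "0 < d" unfolding d_def using b alpha0 C by simp
    have "\<forall>\<^sub>F x in at_right (0::real). d powr ((1 + k) / (1 - b)) * x powr (- ?w) \<le> (real (T x) + 1) powr (1 + k)"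
      using small
    proof eventually_elim
      case (elim x)
      have "(1 - b) * alpha0 * (real (T x) + 1) powr (- (1 - b)) \<le> C\<^sup>2 * x\<^sup>2"
        using rate_sq_ge(1)[OF k, of "T x" j] elim by linarith
      then have "d * (real (T x) + 1) powr (- (1 - b)) \<le> x\<^sup>2"
        unfolding d_def using C by (simp add: field_simps)
      then show ?case
      proof (rule powr_lower_bound[rotated -2])
        have  "?w = 2 * (1 + kstar) / (1 - b)" using b r by (simp add: field_simps)
        also have "\<dots> \<le> 2 * (1 + k) / (1 - b)"
        proof (rule divide_right_mono)
          show "2 * (1 + kstar) \<le> 2 * (1 + k)" by (intro mult_left_mono add_left_mono True) simp
        qed (use b in simp)
        finally show "?w \<le> 2 * (1 + k) / (1 - b)" .
      qed (use b k d elim in auto)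
    qed
    then show ?thesis using d by (intro exI[of _ "d powr ((1 + k) / (1 - b))"]) auto
  next
    case False
    define d where "d = (1 - b) / (2 * real n0) / C\<^sup>2"
    have d: "0 < d" unfolding d_def using b n0 C by simp
    have *: "\<forall>\<^sub>F x in at_right (0::real). d * (real (T x) + 1) powr (- (2 * r * k)) \<le> x\<^sup>2"
      using small
    proof eventually_elim
      case (elim x)
      have "(1 - b) / (2 * real n0) * (real (T x) + 1) powr (- (2 * r * k)) \<le> C\<^sup>2 * x\<^sup>2"
        using rate_sq_ge(2)[OF k, of "T x" j] elim by linarith
      moreover have "y / C\<^sup>2 * q \<le> v" if "y * q \<le> C\<^sup>2 * v" for y q v :: real
        using that C by (simp add: field_simps)
      ultimately show ?case unfolding d_def by blast
    qed
    show ?thesis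
    proof (cases "k = 0")
      case True
      \<comment> \<open>Bounded data sets keep the error above a fixed level, so no horizon reaches
        a small \<open>x\<close>: the order assumed of the rate along \<open>T\<close> is impossible
        and the bound holds vacuously.\<close>
      have "((\<lambda>x::real. x\<^sup>2) \<longlongrightarrow> 0\<^sup>2) (at_right 0)" by (intro tendsto_intros)
      then have "\<forall>\<^sub>F x in at_right (0::real). x\<^sup>2 < d" using d by (intro order_tendstoD(2)) auto
      with * have "\<forall>\<^sub>F x in at_right (0::real). False" by eventually_elim (simp add: True)
      then show ?thesis by simp
    next
      case False
      then have k': "0 < k" using k by simp
      have "\<forall>\<^sub>F x in at_right (0::real). d powr ((1 + k) / (2 * r * k)) * x powr (- ?w) \<le> (real (T x) + 1) powr (1 + k)"
        using small *
      proof eventually_elim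
        case (elim x)
        from elim(2) show ?case
        proof (rule powr_lower_bound[rotated -2])
          have "2 * r * k \<le> 1 - b" using \<open>\<not> kstar \<le> k\<close> r by (simp add: field_simps)
          then have "2 / (1 - b) \<le> 2 / (2 * r * k)" using r k' b by (intro frac_le) auto
          also have "\<dots> + 1 / r = 2 * (1 + k) / (2 * r * k)" using r k' by (simp add: field_simps)
          finally show "?w \<le> 2 * (1 + k) / (2 * r * k)" by simp
        qed (use r k' d elim in auto)
      qed
      then show ?thesis using d by (intro exI[of _ "d powr ((1 + k) / (2 * r * k))"]) auto
    qed
  qed
  then obtain d where d: "0 < d" "\<forall>\<^sub>F x in at_right (0::real). d * x powr (- ?w) \<le> (real (T x) + 1) powr (1 + k)" by auto
  show ?thesis
  proof (rule landau_omega.bigI)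
    show "0 < d / (1 + k)" using d k by simp
    show "\<forall>\<^sub>F x in at_right 0. d / (1 + k) * norm (x powr (- (2 / (1 - b)) - 1 / r))
        \<le> norm (real (total_samples (m j) (n k) (T x)))"
      using d(2)
    proof eventually_elim
      case (elim x)
      have "d / (1 + k) * x powr (- ?w) \<le> (real (T x) + 1) powr (1 + k) / (1 + k)"
        using elim k by (simp add: divide_right_mono)
      also have "\<dots> \<le> real (total_samples (m j) (n k) (T x))" by (rule total_samples_ge[OF k])
      finally have "d / (1 + k) * x powr (- ?w) \<le> real (total_samples (m j) (n k) (T x))" .
      moreover have "- ?w = - (2 / (1 - b)) - 1 / r" by simp
      ultimately show ?case by simp
    qed
  qed
qed

end

section \<open>Upper bounds at the balanced growth rates\<close>

context growth_rates
begin

lemma power4_powr: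
  fixes L q :: real
  assumes "0 < L" shows "(L ^ 4) powr q = L powr (4 * q)"
proof -
  have "L powr 4 = L ^ 4" using powr_realpow[of L 4] assms by simp
  then show ?thesis using powr_powr[of L 4 q] by simp
qed

text \<open>With these exponents the denominators built from \<open>m\<close> and
  \<open>alpha\<^sup>2\<close>, and from \<open>n powr (2 * r)\<close> and \<open>alpha\<close>,
  both grow linearly in \<open>t\<close>. The numerator is thus bounded by a harmonic sum, whose
  logarithm is the source of the suppressed factors.\<close>

lemma rate_star_sq_le:
  "(rate jstar kstar T)\<^sup>2 \<le> alpha0 * (1 + (2 / alpha0\<^sup>2 + 1 / alpha0)) * ((1 + ln (real T + 1)) / (real T + 1) powr (1 - b))"
proof -
  let ?N = "real T + 1" and ?k = "2 / alpha0\<^sup>2 + 1 / alpha0"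
  have j: "0 \<le> jstar" and k: "0 \<le> kstar" using b r by auto
  have "1 / (real (m jstar t) * (alpha t)\<^sup>2) + 1 / (real (n kstar t) powr (2 * r) * alpha t)
      + 1 / (real (n kstar t) powr (2 * r) * (alpha t)\<^sup>2) \<le> ?k * (1 / (real t + 1))" for t
  proof -
    let ?u = "real t + 1"
    have sq: "(alpha t)\<^sup>2 = alpha0\<^sup>2 * ?u powr (2 * b)"
      by (simp add: step_param_def power_mult_distrib powr_power[symmetric] powr_realpow[symmetric] powr_powr mult.commute)
    have "?u powr 1 * alpha0\<^sup>2 = ?u powr jstar * (alpha t)\<^sup>2" unfolding sq by (simp flip: powr_add)
    also have "\<dots> \<le> real (m jstar t) * (alpha t)\<^sup>2"
      using sample_size_bounds(1)[OF m0 j] by (intro mult_right_mono) auto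
    finally have 1: "1 / (real (m jstar t) * (alpha t)\<^sup>2) \<le> 1 / (?u * alpha0\<^sup>2)"
      using alpha0 by (intro frac_le) auto
    have "?u powr (1 - b) = (?u powr kstar) powr (2 * r)" using r by (simp add: powr_powr)
    also have "\<dots> \<le> real (n kstar t) powr (2 * r)"
      using sample_size_bounds(1)[OF n0 k] r by (intro powr_mono2) auto
    finally have n: "?u powr (1 - b) \<le> real (n kstar t) powr (2 * r)" .
    have "?u powr 1 * alpha0 = ?u powr (1 - b) * alpha t" unfolding step_param_def by (simp flip: powr_add)
    also have "\<dots> \<le> real (n kstar t) powr (2 * r) * alpha t"
      using n alpha_pos[of t] by (intro mult_right_mono) auto
    finally have 2: "1 / (real (n kstar t) powr (2 * r) * alpha t) \<le> 1 / (?u * alpha0)"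
      using alpha0 by (intro frac_le) auto
    \<comment> \<open>The third term even decays like \<open>?u powr (- (1 + b))\<close>; it is
      weakened to share the harmonic bound.\<close>
    have "?u powr 1 * alpha0\<^sup>2 \<le> ?u powr (b + 1) * alpha0\<^sup>2"
      using b by (intro mult_right_mono powr_mono) auto
    also have "\<dots> = ?u powr (1 - b) * (alpha t)\<^sup>2" unfolding sq by (simp flip: powr_add)
    also have "\<dots> \<le> real (n kstar t) powr (2 * r) * (alpha t)\<^sup>2"
      using n by (intro mult_right_mono) auto
    finally have 3: "1 / (real (n kstar t) powr (2 * r) * (alpha t)\<^sup>2) \<le> 1 / (?u * alpha0\<^sup>2)"
      using alpha0 by (intro frac_le) auto
    have "?k * (1 / ?u) = 1 / (?u * alpha0\<^sup>2) + 1 / (?u * alpha0) + 1 / (?u * alpha0\<^sup>2)"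
    proof -
      have "(2 / y + 1 / v) * (1 / u) = 1 / (u * y) + 1 / (u * v) + 1 / (u * y)" for u v y :: real
        by (cases "y = 0"; cases "v = 0"; cases "u = 0") (auto simp: field_simps)
      then show ?thesis .
    qed
    then show ?thesis using 1 2 3 by linarith
  qed
  then have "numerator jstar kstar T \<le> 1 + (\<Sum>t\<le>T. ?k * (1 / (real t + 1)))"
    unfolding numerator_def by (intro add_left_mono sum_mono)
  also have "\<dots> = 1 + ?k * (\<Sum>t\<le>T. 1 / (real t + 1))" by (simp only: sum_distrib_left)
  also have "\<dots> \<le> 1 + ?k * (1 + ln ?N)"
    using sum_inverse_le_ln[of T] alpha0 by (intro add_left_mono mult_left_mono) auto
  also have "\<dots> \<le> (1 + ?k) * (1 + ln ?N)" by (simp add: distrib_right)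
  finally have num: "numerator jstar kstar T \<le> (1 + ?k) * (1 + ln ?N)" .
  have "(rate jstar kstar T)\<^sup>2 \<le> ((1 + ?k) * (1 + ln ?N)) / (?N powr (1 - b) / alpha0)"
    unfolding rate_sq using num numerator_ge_1[of jstar kstar T] sum_inverse_alpha_ge[of T] alpha0
    by (intro frac_le) auto
  also have "\<dots> = alpha0 * (1 + ?k) * ((1 + ln ?N) / ?N powr (1 - b))" by (simp add: field_simps)
  finally show ?thesis .
qed

text \<open>The data sets dominate: \<open>r < 1 / 2\<close> gives \<open>1 - b \<le> kstar\<close>,
  hence \<open>jstar \<le> kstar\<close>.\<close>

lemma total_samples_star_le:
  "real (total_samples (m jstar) (n kstar) T) \<le> 2 * (real m0 + real n0) * (real T + 1) powr (1 + kstar)"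
proof -
  let ?N = "real T + 1"
  have j: "0 \<le> jstar" and k: "0 \<le> kstar" using b r by auto
  have "(1 - b) * (2 * r) \<le> (1 - b) * 1" using b r by (intro mult_left_mono) auto
  then have "1 - b \<le> kstar" using r by (simp add: pos_le_divide_eq)
  then have jk: "jstar \<le> kstar" using b by linarith
  have le: "real (sample_size c q t) \<le> 2 * real c * ?N powr kstar"
    if "0 < c" "0 \<le> q" "q \<le> kstar" "t \<le> T" for c q t
  proof -
    have "real (sample_size c q t) \<le> 2 * real c * (real t + 1) powr q"
      using that by (intro sample_size_bounds)
    also have "\<dots> \<le> 2 * real c * ?N powr kstar"
    proof (rule mult_left_mono)
      have "(real t + 1) powr q \<le> ?N powr q" using that by (intro powr_mono2) auto
      also have "\<dots> \<le> ?N powr kstar" using that by (intro powr_mono) auto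
      finally show "(real t + 1) powr q \<le> ?N powr kstar" .
    qed simp
    finally show ?thesis .
  qed
  have "real (total_samples (m jstar) (n kstar) T) = (\<Sum>t\<le>T. real (m jstar t) + real (n kstar t))"
    unfolding total_samples_def by simp
  also have "\<dots> \<le> (\<Sum>t\<le>T. 2 * real m0 * ?N powr kstar + 2 * real n0 * ?N powr kstar)"
    using le[OF m0 j jk] le[OF n0 k order_refl] by (intro sum_mono add_mono) auto
  also have "\<dots> = ?N * (2 * real m0 * ?N powr kstar + 2 * real n0 * ?N powr kstar)" by simp
  also have "\<dots> = 2 * (real m0 + real n0) * ?N powr (1 + kstar)"
    by (simp add: powr_add algebra_simps)
  finally show ?thesis .
qed

text \<open>
  The number of iterations for accuracy \<open>x\<close>, up to rounding. The power of the logarithm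
  exceeds what the bound needs, so that the constants are absorbed for small \<open>x\<close>.
\<close>

definition horizon :: "real \<Rightarrow> real" where
  "horizon x = x powr (- (2 / (1 - b))) * (ln (1 / x)) ^ 4"

lemma horizon_bounds:
  assumes x: "0 < x" and L: "1 \<le> ln (1 / x)"
  defines "N \<equiv> real (nat \<lceil>horizon x\<rceil>) + 1"
  shows "1 \<le> horizon x" "N \<le> 3 * horizon x" "1 + ln N \<le> 12 * ln (1 / x)"
    "(ln (1 / x))\<^sup>2 * x powr (- 2) \<le> N powr (1 - b)"
proof -
  let ?L = "ln (1 / x)" and ?a = "1 - b"
  have x1: "x \<le> 1"
  proof (rule ccontr)
    assume "\<not> x \<le> 1"
    then have "?L < 0" using x by (simp add: ln_div)
    then show False using L by simp
  qed
  have xp: "1 \<le> x powr (- (2 / ?a))" using x x1 b by (simp add: powr_minus one_le_inverse powr_le1)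
  have "1 \<le> ?L ^ 4" using L by (rule one_le_power)
  then show h1: "1 \<le> horizon x" unfolding horizon_def using xp mult_mono[of 1 _ 1] by fastforce
  have N: "horizon x \<le> N" "N \<le> horizon x + 2"
  proof -
    have "N = real_of_int \<lceil>horizon x\<rceil> + 1" unfolding N_def using h1 by (simp add: of_nat_nat)
    then show "horizon x \<le> N" "N \<le> horizon x + 2"
      using of_int_ceiling_le_add_one[of "horizon x"] le_of_int_ceiling[of "horizon x"] by linarith+
  qed
  show N3: "N \<le> 3 * horizon x" using N h1 by linarith
  have "ln N \<le> ln (3 * horizon x)" using N N3 h1 by simp
  also have "\<dots> = ln 3 + ln (horizon x)" using h1 by (simp add: ln_mult)
  also have "ln (horizon x) = 2 / ?a * ?L + 4 * ln ?L"
  proof -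
    have ln_prod: "ln (y * v ^ 4) = ln y + 4 * ln v" if "0 < y" "0 < v" for y v :: real
      using that by (simp add: ln_mult ln_realpow)
    have ln_x: "ln (x powr (- (2 / ?a))) = 2 / ?a * ?L" using x by (simp add: ln_powr ln_div)
    have "ln (horizon x) = ln (x powr (- (2 / ?a))) + 4 * ln ?L"
      unfolding horizon_def
    proof (rule ln_prod)
      show "0 < ?L" using L by linarith
    qed (use x in simp)
    then show ?thesis unfolding ln_x .
  qed
  also have "ln 3 \<le> (2 :: real)" using ln_le_minus_one[of 3] by simp
  finally have "ln N \<le> 2 + (2 / ?a * ?L + 4 * ln ?L)" by simp
  \<comment> \<open>By \<open>b \<le> 1 / 2\<close>. With the next estimate \<open>1 + ln N\<close>
    is at most \<open>3 + 8 * ?L\<close>, below \<open>12 * ?L\<close>.\<close>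
  also have "2 / ?a * ?L \<le> 4 * ?L" using b L by (intro mult_right_mono) (auto simp: field_simps)
  also have "ln ?L \<le> ?L" using L ln_le_minus_one[of ?L] by simp
  finally show "1 + ln N \<le> 12 * ?L" using L by simp
  have "?L\<^sup>2 = ?L powr 2" using L by (simp add: powr_numeral)
  \<comment> \<open>This is where the exponent 4 of \<open>horizon\<close> enters:
    \<open>b \<le> 1 / 2\<close> makes \<open>4 * ?a\<close> at least 2. One factor
    \<open>?L\<close> will cancel the logarithm of the rate, the other beats the constants.\<close>
  also have "\<dots> \<le> ?L powr (4 * ?a)" using L b by (intro powr_mono) auto
  also have "\<dots> = (?L ^ 4) powr ?a" using L by (intro power4_powr[symmetric]) simp
  finally have L2: "?L\<^sup>2 \<le> (?L ^ 4) powr ?a" .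
  have "?L\<^sup>2 * x powr (- 2) \<le> (?L ^ 4) powr ?a * x powr (- 2)"
    using L2 by (intro mult_right_mono) auto
  also have "(?L ^ 4) powr ?a * x powr (- 2) = horizon x powr ?a"
  proof -
    have "x powr (- 2) = (x powr (- (2 / ?a))) powr ?a"
      unfolding powr_powr using b by (intro arg_cong[where f = "\<lambda>q. x powr q"]) (simp add: field_simps)
    then show ?thesis unfolding horizon_def by (simp only: powr_mult mult.commute)
  qed
  also have "\<dots> \<le> N powr ?a" using N h1 b by (intro powr_mono2) auto
  finally show "?L\<^sup>2 * x powr (- 2) \<le> N powr ?a" .
qed

lemma rate_star_small:
  assumes K: "0 < K"
  obtains x0 where "0 < x0" "\<And>x. 0 < x \<Longrightarrow> x \<le> x0 \<Longrightarrow> 1 \<le> ln (1 / x) \<and> K * rate jstar kstar (nat \<lceil>horizon x\<rceil>) \<le> x"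
proof -
  define C where "C = alpha0 * (1 + (2 / alpha0\<^sup>2 + 1 / alpha0))"
  have C: "0 < C" unfolding C_def using alpha0 by (simp add: add_pos_pos)
  \<comment> \<open>At the horizon the squared rate is at most
    \<open>12 * C * x\<^sup>2 / ?L\<close>; beyond this threshold for \<open>?L\<close> the factor
    \<open>K\<^sup>2\<close> is absorbed.\<close>
  define L0 where "L0 = max 1 (12 * C * K\<^sup>2)"
  have small: "1 \<le> ln (1 / x) \<and> K * rate jstar kstar (nat \<lceil>horizon x\<rceil>) \<le> x" if x: "0 < x" "x \<le> exp (- L0)" for x
  proof -
    let ?L = "ln (1 / x)" and ?T = "nat \<lceil>horizon x\<rceil>"
    have "ln x \<le> - L0" using x by (metis ln_exp ln_le_cancel_iff exp_gt_zero)
    then have L0: "L0 \<le> ?L" using x by (simp add: ln_div)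
    then have L: "1 \<le> ?L" "12 * C * K\<^sup>2 \<le> ?L" unfolding L0_def by auto
    note hb = horizon_bounds[OF x(1) L(1)]
    have "(rate jstar kstar ?T)\<^sup>2 \<le> C * ((1 + ln (real ?T + 1)) / (real ?T + 1) powr (1 - b))"
      unfolding C_def by (rule rate_star_sq_le)
    also have "\<dots> \<le> C * (12 * ?L / (?L\<^sup>2 * x powr (- 2)))"
    proof (rule mult_left_mono[OF frac_le])
      show "0 \<le> 12 * ?L" using L by linarith
      have "0 < ?L" using L by linarith
      then show "0 < ?L\<^sup>2 * x powr (- 2)" using x by (intro mult_pos_pos zero_less_power) auto
    qed (use hb C in auto)
    also have "\<dots> = 12 * C * x\<^sup>2 / ?L"
      using L x by (simp add: powr_minus power2_eq_square field_simps)
    finally have "K\<^sup>2 * (rate jstar kstar ?T)\<^sup>2 \<le> K\<^sup>2 * (12 * C * x\<^sup>2 / ?L)"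
      by (intro mult_left_mono) auto
    also have "\<dots> = (12 * C * K\<^sup>2) / ?L * x\<^sup>2" by simp
    also have "\<dots> \<le> 1 * x\<^sup>2" using L by (intro mult_right_mono) (auto simp: divide_le_eq)
    finally have "(K * rate jstar kstar ?T)\<^sup>2 \<le> x\<^sup>2" by (simp add: power_mult_distrib)
    then have "K * rate jstar kstar ?T \<le> x" by (rule power2_le_imp_le) (use x in simp)
    with L(1) show ?thesis by blast
  qed
  show thesis
  proof (rule that)
    show "0 < exp (- L0)" by simp
  qed (rule small)
qed

theorem star_complexity:
  assumes K: "0 < K"
  obtains T :: "real \<Rightarrow> nat" where
    "\<And>x. 0 < x \<Longrightarrow> K * rate jstar kstar (T x) \<le> x"
    "(\<lambda>x. rate jstar kstar (T x)) \<in> O[at_right 0](\<lambda>x. x)"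
    "(\<lambda>x. real (T x)) \<in> soft_bigo (\<lambda>x. x powr (- (2 / (1 - b))))"
    "(\<lambda>x. real (total_samples (m jstar) (n kstar) (T x))) \<in> soft_bigo (\<lambda>x. x powr (- (2 / (1 - b)) - 1 / r))"
proof -
  obtain x0 where x0: "0 < x0" and small:
    "\<And>x. 0 < x \<Longrightarrow> x \<le> x0 \<Longrightarrow> 1 \<le> ln (1 / x) \<and> K * rate jstar kstar (nat \<lceil>horizon x\<rceil>) \<le> x"
    using rate_star_small[OF K] by blast
  \<comment> \<open>The least sufficient horizon, so that the accuracy is reached for every positive
    \<open>x\<close> and not only near 0. \<open>horizon\<close> witnesses existence, taken at
    \<open>min x x0\<close> for large \<open>x\<close>, and bounds \<open>T x\<close> for small
    \<open>x\<close>.\<close>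
  define T where "T x = (LEAST t. K * rate jstar kstar t \<le> x)" for x
  have T: "K * rate jstar kstar (T x) \<le> x" if x: "0 < x" for x
    unfolding T_def
  proof (rule LeastI)
    show "K * rate jstar kstar (nat \<lceil>horizon (min x x0)\<rceil>) \<le> x"
      using small[of "min x x0"] x x0 by simp
  qed
  have Tle: "T x \<le> nat \<lceil>horizon x\<rceil>" if "0 < x" "x \<le> x0" for x
    unfolding T_def using small[OF that] by (intro Least_le) simp
  have ev: "\<forall>\<^sub>F x in at_right (0::real). 0 < x \<and> x \<le> x0"
    using x0 by (auto simp: eventually_at_right[of 0 x0] intro!: exI[of _ x0])
  have horizon: "\<forall>\<^sub>F x in at_right (0::real). 0 < x \<and> 1 \<le> ln (1 / x) \<and> real (T x) + 1 \<le> 3 * horizon x"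
    using ev
  proof eventually_elim
    case (elim x)
    then have L: "1 \<le> ln (1 / x)" using small by blast
    have "real (T x) + 1 \<le> real (nat \<lceil>horizon x\<rceil>) + 1" using Tle elim by simp
    also have "\<dots> \<le> 3 * horizon x" using horizon_bounds(2)[of x] elim L by simp
    finally show ?case using elim L by simp
  qed
  show thesis
  proof (rule that[of T])
    show "K * rate jstar kstar (T x) \<le> x" if "0 < x" for x using T that .
    show "(\<lambda>x. rate jstar kstar (T x)) \<in> O[at_right 0](\<lambda>x. x)"
    proof (rule landau_o.bigI)
      show "0 < 1 / K" using K by simp
      show "\<forall>\<^sub>F x in at_right 0. norm (rate jstar kstar (T x)) \<le> 1 / K * norm x"
        using ev
      proof eventually_elim
        case (elim x)
        then show ?case using T[of x] K rate_nonneg[of jstar kstar "T x"] by (simp add: field_simps)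
      qed
    qed
    show "(\<lambda>x. real (T x)) \<in> soft_bigo (\<lambda>x. x powr (- (2 / (1 - b))))"
      unfolding soft_bigo_def
    proof (rule UN_I[of 4], simp, rule landau_o.bigI)
      show "0 < (3 :: real)" by simp
      show "\<forall>\<^sub>F x in at_right 0. norm (real (T x)) \<le> 3 * norm (x powr (- (2 / (1 - b))) * ln (1 / x) ^ 4)"
        using horizon
      proof eventually_elim
        case (elim x)
        then have "norm (x powr (- (2 / (1 - b))) * ln (1 / x) ^ 4) = horizon x"
          unfolding horizon_def by (simp add: abs_mult)
        then show ?case using elim by simp
      qed
    qed
    \<comment> \<open>The sample count is of order \<open>horizon x powr (1 + kstar)\<close>; its
      logarithmic exponent \<open>4 * (1 + kstar)\<close> is rounded up to the natural number that
      \<open>soft_bigo\<close> asks for.\<close>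
    define p where "p = nat \<lceil>4 * (1 + kstar)\<rceil>"
    show "(\<lambda>x. real (total_samples (m jstar) (n kstar) (T x))) \<in> soft_bigo (\<lambda>x. x powr (- (2 / (1 - b)) - 1 / r))"
      unfolding soft_bigo_def
    proof (rule UN_I[of p], simp, rule landau_o.bigI)
      let ?c = "2 * (real m0 + real n0) * 3 powr (1 + kstar)"
      show "0 < ?c" using m0 by simp
      show "\<forall>\<^sub>F x in at_right 0. norm (real (total_samples (m jstar) (n kstar) (T x)))
          \<le> ?c * norm (x powr (- (2 / (1 - b)) - 1 / r) * ln (1 / x) ^ p)"
        using horizon
      proof eventually_elim
        case (elim x)
        let ?L = "ln (1 / x)"
        have k: "0 \<le> kstar" using b r by simp
        have "(?L ^ 4) powr (1 + kstar) = ?L powr (4 * (1 + kstar))"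
          using elim by (intro power4_powr) linarith
        also have "\<dots> \<le> ?L powr real p"
          unfolding p_def using elim by (intro powr_mono real_nat_ceiling_ge) auto
        also have "\<dots> = ?L ^ p" using elim by (intro powr_realpow) linarith
        finally have L: "(?L ^ 4) powr (1 + kstar) \<le> ?L ^ p" .
        have ex: "- (2 / (1 - b)) * (1 + kstar) = - (2 / (1 - b)) - 1 / r"
          using b r by (simp add: field_simps)
        have "horizon x powr (1 + kstar) = x powr (- (2 / (1 - b)) - 1 / r) * (?L ^ 4) powr (1 + kstar)"
        proof -
          have "horizon x powr (1 + kstar) = (x powr (- (2 / (1 - b)))) powr (1 + kstar) * (?L ^ 4) powr (1 + kstar)"
            unfolding horizon_def by (rule powr_mult)
          then show ?thesis unfolding powr_powr[of x] ex .
        qed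
        also have "\<dots> \<le> x powr (- (2 / (1 - b)) - 1 / r) * ?L ^ p" using L by (intro mult_left_mono) auto
        finally have hp: "horizon x powr (1 + kstar) \<le> x powr (- (2 / (1 - b)) - 1 / r) * ?L ^ p" .
        have "real (total_samples (m jstar) (n kstar) (T x)) \<le> 2 * (real m0 + real n0) * (real (T x) + 1) powr (1 + kstar)"
          by (rule total_samples_star_le)
        also have "\<dots> \<le> 2 * (real m0 + real n0) * (3 * horizon x) powr (1 + kstar)"
          using elim k by (intro mult_left_mono powr_mono2) auto
        also have "\<dots> = ?c * horizon x powr (1 + kstar)" by (simp add: powr_mult horizon_def)
        also have "\<dots> \<le> ?c * (x powr (- (2 / (1 - b)) - 1 / r) * ?L ^ p)"
          using hp by (intro mult_left_mono) auto
        finally have "real (total_samples (m jstar) (n kstar) (T x)) \<le> ?c * (x powr (- (2 / (1 - b)) - 1 / r) * ?L ^ p)" .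
        moreover have "0 \<le> ?L ^ p" using elim by (intro zero_le_power) linarith
        ultimately show ?case by (simp add: abs_mult)
      qed
    qed
  qed
qed

end

section \<open>The order of the guarantee\<close>

text \<open>The guarantee contains shifted parameters \<open>a - s\<close>, its order only
  \<open>a\<close>; above a threshold \<open>a0\<close> larger than \<open>s\<close> the two are
  comparable.\<close>

lemma linear_lower_bound:
  fixes a0 s :: real
  assumes "0 < a0" "s < a0"
  obtains q where "0 < q" "\<And>a. a0 \<le> a \<Longrightarrow> q * a \<le> a - s"
proof (cases "s \<le> 0")
  case True
  show thesis by (rule that[of 1]) (use True in auto)
next
  case False
  show thesis
  proof (rule that[of "(a0 - s) / a0"])
    fix a assume "a0 \<le> a"
    then have "s * a0 \<le> s * a" using False by (intro mult_left_mono) auto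
    then show "(a0 - s) / a0 * a \<le> a - s" using assms by (simp add: field_simps)
  qed (use assms in simp)
qed

context lspl_setting
begin

text \<open>\<open>K\<close> is chosen before the step parameters, the sample sizes and the horizon,
  so that one constant serves all growth rates.\<close>

lemma guarantee_le_rate:
  assumes a0: "rho + lphi * Lc < a0" and Ce: "0 < Ce" "\<forall>n\<ge>1. e n \<le> Ce * real n powr (- r)"
  obtains K where "0 < K" "\<And>alpha m n T. (\<And>t. a0 \<le> alpha t) \<Longrightarrow> (\<And>t. 0 < m t) \<Longrightarrow> (\<And>t. 1 \<le> n t) \<Longrightarrow>
    guarantee_bound (gap z0) rho lphi Lc lhat lamhat tau e alpha m n T \<le> K * rate_bound r alpha m n T"
proof -
  have a0_pos: "0 < a0"
  proof -
    have "0 \<le> lphi * Lc" using lphi Lc by simp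
    then show ?thesis using a0 rho_pos by linarith
  qed
  have s: "tau - rho < a0" "lamhat < a0" "rho + lphi * Lc < a0"
    using a_gt_lamhat[of 1 a0] a_tau_pos[of 1 a0] a0 by auto
  obtain q1 where q1: "0 < q1" "\<And>a. a0 \<le> a \<Longrightarrow> q1 * a \<le> a - (tau - rho)"
    using linear_lower_bound[OF a0_pos s(1)] by blast
  obtain q2 where q2: "0 < q2" "\<And>a. a0 \<le> a \<Longrightarrow> q2 * a \<le> a - lamhat"
    using linear_lower_bound[OF a0_pos s(2)] by blast
  obtain q3 where q3: "0 < q3" "\<And>a. a0 \<le> a \<Longrightarrow> q3 * a \<le> a - (rho + lphi * Lc)"
    using linear_lower_bound[OF a0_pos s(3)] by blast
  \<comment> \<open>The opposite comparison: a lower bound on the weights in the denominator of the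
    guarantee asks for \<open>alpha t + rho - tau\<close> to be at most a multiple of
    \<open>alpha t\<close>.\<close>
  define p where "p = 1 + \<bar>rho - tau\<bar> / a0"
  have p: "0 < p" unfolding p_def using a0_pos by (intro add_pos_nonneg) auto
  have p_le: "a + rho - tau \<le> p * a" if "a0 \<le> a" for a
  proof -
    have "\<bar>rho - tau\<bar> * a0 \<le> \<bar>rho - tau\<bar> * a" using that by (intro mult_left_mono) auto
    then have "\<bar>rho - tau\<bar> \<le> \<bar>rho - tau\<bar> / a0 * a" using a0_pos by (simp add: field_simps)
    then show ?thesis unfolding p_def by (simp add: distrib_right)
  qed
  define A1 where "A1 = rho / q1 * (8 * lphi\<^sup>2 * (1 + lhat)\<^sup>2 / q2)"
  define A2 where "A2 = rho / q1 * (4 * lphi\<^sup>2 * Ce\<^sup>2 / kappa)"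
  define A3 where "A3 = rho / q1 * (2 * lphi\<^sup>2 * Ce\<^sup>2 / q3)"
  define A where "A = 4 * gap z0 + A1 + A2 + A3"
  have A123: "0 \<le> A1" "0 \<le> A2" "0 \<le> A3"
    unfolding A1_def A2_def A3_def using q1 q2 q3 rho_pos kappa_pos by auto
  then have Age: "4 * gap z0 \<le> A" "A1 \<le> A" "A2 \<le> A" "A3 \<le> A" "0 \<le> A"
    unfolding A_def using gap_nonneg[of z0] by auto
  \<comment> \<open>The summand 1 keeps \<open>K\<close> positive when \<open>A\<close>
    vanishes.\<close>
  define K where "K = sqrt (A * p / (rho * kappa)) + 1"
  have "0 \<le> A * p / (rho * kappa)" using Age p rho_pos kappa_pos by simp
  then have K: "0 < K" unfolding K_def by (intro add_nonneg_pos) auto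
  obtain z1 where z1: "z1 \<in> X" using X by auto
  show thesis
  proof (rule that[OF K])
    fix alpha :: "nat \<Rightarrow> real" and m n :: "nat \<Rightarrow> nat" and T
    assume al: "\<And>t. a0 \<le> alpha t" and m: "\<And>t. 0 < m t" and n: "\<And>t. 1 \<le> n t"
    have al_pos: "0 < alpha t" for t using al[of t] a0_pos by linarith
    let ?R = "\<lambda>t. 1 / (real (m t) * (alpha t)\<^sup>2) + 1 / (real (n t) powr (2 * r) * alpha t)
      + 1 / (real (n t) powr (2 * r) * (alpha t)\<^sup>2)"
    let ?G = "\<lambda>t. rho / (alpha t + rho - tau) *
              (8 * lphi\<^sup>2 * (1 + lhat)\<^sup>2 / (real (m t) * (alpha t - lamhat))
               + 4 * lphi\<^sup>2 * (e (n t))\<^sup>2 / (2 * rho - lphi * Lc - tau)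
               + 2 * lphi\<^sup>2 * (e (n t))\<^sup>2 / (alpha t - rho - lphi * Lc))"
    have R: "0 \<le> ?R t" for t using al_pos by (intro add_nonneg_nonneg) (auto simp: less_imp_le)
    have SR: "0 \<le> 1 + (\<Sum>t\<le>T. ?R t)" by (rule add_nonneg_nonneg[OF zero_le_one sum_nonneg[OF R]])
    have G: "?G t \<le> A * ?R t" for t
    proof -
      let ?a = "alpha t" and ?E = "Ce\<^sup>2 / real (n t) powr (2 * r)"
      have "(e (n t))\<^sup>2 \<le> (Ce * real (n t) powr (- r))\<^sup>2"
        using estimation_error_bounds(1)[OF z1 n] Ce(2) n by (intro power_mono) auto
      also have "\<dots> = ?E"
      proof -
        have "(real (n t) powr (- r))\<^sup>2 = real (n t) powr (- (2 * r))"
          unfolding power2_eq_square by (simp flip: powr_add)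
        then show ?thesis by (simp add: power_mult_distrib powr_minus divide_inverse)
      qed
      finally have E: "(e (n t))\<^sup>2 \<le> ?E" .
      have d: "q1 * ?a \<le> ?a + rho - tau" "q2 * ?a \<le> ?a - lamhat" "q3 * ?a \<le> ?a - rho - lphi * Lc"
        using q1(2)[OF al[of t]] q2(2)[OF al[of t]] q3(2)[OF al[of t]] by linarith+
      have "?G t \<le> rho / (q1 * ?a) * (8 * lphi\<^sup>2 * (1 + lhat)\<^sup>2 / (real (m t) * (q2 * ?a))
          + 4 * lphi\<^sup>2 * ?E / kappa + 2 * lphi\<^sup>2 * ?E / (q3 * ?a))"
        unfolding kappa_eq[symmetric]
      proof (intro mult_mono add_mono frac_le)
        show "0 < q1 * ?a" "0 < q3 * ?a" "0 < real (m t) * (q2 * ?a)" using q1 q2 q3 al_pos m by auto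
        then show "0 \<le> rho / (q1 * ?a)" using rho_pos by simp
        show "0 \<le> 8 * lphi\<^sup>2 * (1 + lhat)\<^sup>2 / (real (m t) * (?a - lamhat)) + 4 * lphi\<^sup>2 * (e (n t))\<^sup>2 / kappa
            + 2 * lphi\<^sup>2 * (e (n t))\<^sup>2 / (?a - rho - lphi * Lc)"
        proof -
          have "0 \<le> q2 * ?a" "0 \<le> q3 * ?a" using q2 q3 al_pos[of t] by auto
          then have "0 \<le> ?a - lamhat" "0 \<le> ?a - rho - lphi * Lc" using d by linarith+
          then show ?thesis using kappa_pos by (intro add_nonneg_nonneg divide_nonneg_nonneg) auto
        qed
        show "0 \<le> q2 * ?a" using q2 al_pos[of t] by simp
      qed (use d E rho_pos kappa_pos m in \<open>auto intro!: mult_left_mono\<close>)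
      also have "\<dots> = A1 * (1 / (real (m t) * ?a\<^sup>2)) + A2 * (1 / (real (n t) powr (2 * r) * ?a))
          + A3 * (1 / (real (n t) powr (2 * r) * ?a\<^sup>2))"
      proof -
        have "p1 / (d1 * a) * (u / (k * (d2 * a)) + v * (s / w) / d + y * (s / w) / (d3 * a))
            = p1 / d1 * (u / d2) * (1 / (k * a\<^sup>2)) + p1 / d1 * (v * s / d) * (1 / (w * a))
              + p1 / d1 * (y * s / d3) * (1 / (w * a\<^sup>2))" for p1 d1 a u k d2 v s w d y d3 :: real
          by (simp add: distrib_left power2_eq_square mult_ac)
        then show ?thesis unfolding A1_def A2_def A3_def .
      qed
      also have "\<dots> \<le> A * (1 / (real (m t) * ?a\<^sup>2)) + A * (1 / (real (n t) powr (2 * r) * ?a))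
          + A * (1 / (real (n t) powr (2 * r) * ?a\<^sup>2))"
        using Age al_pos[of t] by (intro add_mono mult_right_mono) (auto simp: less_imp_le)
      also have "\<dots> = A * ?R t" by (simp only: distrib_left)
      finally show ?thesis .
    qed
    have "4 * gap z0 + (\<Sum>t\<le>T. ?G t) \<le> A * 1 + (\<Sum>t\<le>T. A * ?R t)"
      using Age G by (intro add_mono sum_mono) auto
    also have "\<dots> = A * (1 + (\<Sum>t\<le>T. ?R t))" by (simp only: sum_distrib_left distrib_left)
    finally have num: "4 * gap z0 + (\<Sum>t\<le>T. ?G t) \<le> A * (1 + (\<Sum>t\<le>T. ?R t))" .
    have S: "0 < (\<Sum>t\<le>T. 1 / alpha t)" using al_pos by (intro sum_pos) auto
    have "rho * kappa / p * (\<Sum>t\<le>T. 1 / alpha t) = (\<Sum>t\<le>T. rho * kappa / (p * alpha t))"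
      by (simp add: sum_distrib_left)
    also have "\<dots> \<le> (\<Sum>t\<le>T. rho * kappa / (alpha t + rho - tau))"
    proof (rule sum_mono)
      fix t
      have "0 < q1 * alpha t" using q1 al_pos by simp
      then have "0 < alpha t + rho - tau" using q1(2)[OF al[of t]] by linarith
      then show "rho * kappa / (p * alpha t) \<le> rho * kappa / (alpha t + rho - tau)"
        using p_le[OF al[of t]] rho_pos kappa_pos by (intro divide_left_mono) (auto intro!: mult_pos_pos p al_pos)
    qed
    finally have den: "rho * kappa / p * (\<Sum>t\<le>T. 1 / alpha t) \<le> (\<Sum>t\<le>T. rho * kappa / (alpha t + rho - tau))" .
    have "guarantee_bound (gap z0) rho lphi Lc lhat lamhat tau e alpha m n T
        \<le> sqrt ((A * (1 + (\<Sum>t\<le>T. ?R t))) / (rho * kappa / p * (\<Sum>t\<le>T. 1 / alpha t)))"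
      unfolding guarantee_bound_def
    proof (rule real_sqrt_le_mono, rule frac_le)
      show "0 \<le> A * (1 + (\<Sum>t\<le>T. ?R t))"
        by (rule mult_nonneg_nonneg[OF Age(5) SR])
      show "0 < rho * kappa / p * (\<Sum>t\<le>T. 1 / alpha t)" using S p rho_pos kappa_pos by simp
    qed (use num den in \<open>simp_all only: kappa_eq[symmetric]\<close>)
    also have "(A * (1 + (\<Sum>t\<le>T. ?R t))) / (rho * kappa / p * (\<Sum>t\<le>T. 1 / alpha t))
        = A * p / (rho * kappa) * ((1 + (\<Sum>t\<le>T. ?R t)) / (\<Sum>t\<le>T. 1 / alpha t))"
      by simp
    also have "sqrt \<dots> = sqrt (A * p / (rho * kappa)) * rate_bound r alpha m n T"
      unfolding rate_bound_def by (rule real_sqrt_mult)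
    also have "\<dots> \<le> K * rate_bound r alpha m n T"
    proof (rule mult_right_mono)
      show "0 \<le> rate_bound r alpha m n T"
        unfolding rate_bound_def by (rule real_sqrt_ge_zero[OF divide_nonneg_pos[OF SR S]])
    qed (simp add: K_def)
    finally show "guarantee_bound (gap z0) rho lphi Lc lhat lamhat tau e alpha m n T \<le> K * rate_bound r alpha m n T" .
  qed
qed

end

text \<open>Tightness is a lower bound over all horizons \<open>T\<close>, so it is unaffected by
  how the iteration count is selected, and with the attained bounds it determines the order up to
  logarithms. The horizon attaining them makes \<open>K\<close> times the rate at most
  \<open>x\<close> for every positive \<open>x\<close>, which is why near stationarity holds for all
  \<open>nu\<close> and \<open>delta\<close> and not only for small ones.\<close>

theorem corollary1:
  fixes X Op :: "(real^'d) set"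
    and phi :: "(real^'d) \<times> (real^'l) \<Rightarrow> real"
    and c :: "real^'d \<Rightarrow> real^'l"
    and N :: "(real^'l) measure"
    and D :: "(real^'d) design"
    and est :: "('d, 'l) estimator"
    and f :: "real^'d \<Rightarrow> real"
    and alpha :: "nat \<Rightarrow> real"
    and m n :: "real \<Rightarrow> nat \<Rightarrow> nat"
    and lam lphi lc Lc lhat r Ce rho lamtilde lamhat tau Delta0 alpha0 b jstar kstar :: real
    and m0 n0 :: nat
    and z0 :: "real^'d"
  assumes A1: "X \<noteq> {}" "closed X" "convex X" "open Op" "convex Op" "X \<subseteq> Op"
    and A2: "0 \<le> lam" "weakly_convex_on lam (Op \<times> UNIV) phi" "lphi-lipschitz_on (Op \<times> UNIV) phi"
    and A3: "prob_space N" "sets N = sets borel" "integrable N (\<lambda>e. (norm e)\<^sup>2)" "(\<integral>e. e \<partial>N) = 0"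
    and A4: "c \<in> borel_measurable borel" "lc-lipschitz_on Op c"
      "\<forall>x\<in>Op. c differentiable (at x)"
      "\<forall>x\<in>Op. \<forall>y\<in>Op. opnorm (jacobian c (at x) - jacobian c (at y)) \<le> Lc * norm (x - y)"
    and f_eq: "f = objective phi c N"
    and f_bounded: "bdd_below (f ` X)"
    and design: "valid_design X D" "measurable_estimator est"
    and B: "\<forall>z\<in>X. \<forall>n\<ge>1. AE S in dataset_law c N D n z. opnorm (est n z S) \<le> lhat"
    and C: "0 < r" "r < 1 / 2" "0 < Ce"
      "\<forall>n\<ge>1. estimation_error X c N D est n \<le> Ce * real n powr (- r)"
    and lamtilde_eq: "lamtilde = lam * (1 + lc)\<^sup>2"
    and lamhat_eq: "lamhat = lam * (1 + lhat)\<^sup>2"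
    and tau_eq: "tau = lphi * Lc + lamhat + lamtilde"
    and rho: "rho > lphi * Lc + max lamhat lamtilde"
    and z0: "z0 \<in> X"
    and Delta0_eq: "Delta0 = moreau_envelope X f rho z0 - (INF z\<in>X. f z)"
    and alpha0: "alpha0 > rho + lphi * Lc"
    and m0_n0: "0 < m0" "0 < n0"
    and b: "b \<in> {0..1 / 2}"
    and alpha_eq: "alpha = step_param alpha0 b"
    and m_eq: "m = sample_size m0"
    and n_eq: "n = sample_size n0"
    and jstar_eq: "jstar = 1 - 2 * b"
    and kstar_eq: "kstar = (1 - b) / (2 * r)"
  shows
    \<comment> \<open>the guarantee for all growth rates, and its order\<close>
    "(\<exists>K>0. \<forall>j\<ge>0. \<forall>k\<ge>0. \<forall>T.
        (\<forall>(M::'w measure) F W S z tstar.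
           lspl_run M F X phi c N D est alpha (m j) (n k) z0 T W S z \<and>
           random_index M (F (Suc T)) (\<lambda>t. 1 / (alpha t + rho - tau)) T tstar \<longrightarrow>
           (\<integral>\<^sup>+\<omega>. ennreal (norm (prox_point X f rho (z (tstar \<omega>) \<omega>) - z (tstar \<omega>) \<omega>)) \<partial>M)
             \<le> ennreal (guarantee_bound Delta0 rho lphi Lc lhat lamhat tau
                          (estimation_error X c N D est) alpha (m j) (n k) T)) \<and>
        guarantee_bound Delta0 rho lphi Lc lhat lamhat tau
          (estimation_error X c N D est) alpha (m j) (n k) T
          \<le> K * rate_bound r alpha (m j) (n k) T) \<and>
     \<comment> \<open>complexities attained by the stated rates\<close>
     0 \<le> jstar \<and> 0 \<le> kstar \<and>
     (\<exists>T :: real \<Rightarrow> nat.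
        (\<lambda>x. rate_bound r alpha (m jstar) (n kstar) (T x)) \<in> O[at_right 0](\<lambda>x. x) \<and>
        (\<lambda>x. real (T x)) \<in> soft_bigo (\<lambda>x. x powr (- (2 / (1 - b)))) \<and>
        (\<lambda>x. real (total_samples (m jstar) (n kstar) (T x)))
          \<in> soft_bigo (\<lambda>x. x powr (- (2 / (1 - b)) - 1 / r)) \<and>
        (\<forall>nu>0. \<forall>delta>0. \<forall>(M::'w measure) F W S z tstar.
           lspl_run M F X phi c N D est alpha (m jstar) (n kstar) z0 (T (min delta (nu / rho))) W S z \<and>
           random_index M (F (Suc (T (min delta (nu / rho))))) (\<lambda>t. 1 / (alpha t + rho - tau))
             (T (min delta (nu / rho))) tstar \<longrightarrow>
           nearly_stationary M X f nu delta (\<lambda>\<omega>. z (tstar \<omega>) \<omega>))) \<and>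
     \<comment> \<open>no other growth rates give a sample complexity bound of smaller order\<close>
     (\<forall>j\<ge>0. \<forall>k\<ge>0. \<forall>T :: real \<Rightarrow> nat.
        (\<lambda>x. rate_bound r alpha (m j) (n k) (T x)) \<in> O[at_right 0](\<lambda>x. x) \<longrightarrow>
        (\<lambda>x. real (total_samples (m j) (n k) (T x)))
          \<in> \<Omega>[at_right 0](\<lambda>x. x powr (- (2 / (1 - b)) - 1 / r)))"
proof -
  interpret N: prob_space N by (rule A3)
  \<comment> \<open>The law of a data set is a probability measure, so the almost sure bound on a
    nonnegative norm is attained somewhere and fixes the sign of \<open>lhat\<close>.\<close>
  have lhat: "0 \<le> lhat"
  proof -
    obtain U :: "(nat \<Rightarrow> (real^'d) \<times> (real^'l)) measure" and G
      where "simulated (dataset_law c N D 1) (Pi\<^sub>M {..<1} (\<lambda>_. borel \<Otimes>\<^sub>M borel)) U G"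
      using dataset_law_simulation[OF A3(1,2) A4(1) design(1) order_refl] by blast
    then interpret S: prob_space "dataset_law c N D 1 z0" by (rule simulated_prob_space)
    have "AE S in dataset_law c N D 1 z0. opnorm (est 1 z0 S) \<le> lhat" using B z0 by blast
    then have "AE S in dataset_law c N D 1 z0. 0 \<le> lhat"
      by eventually_elim (rule order_trans[OF opnorm_nonneg])
    then show ?thesis by simp
  qed
  interpret L: lspl_setting X Op phi c N lam lphi lc Lc lhat rho D est
  proof
    show "lphi * Lc + max (lam * (1 + lhat)\<^sup>2) (lam * (1 + lc)\<^sup>2) < rho"
      using rho unfolding lamhat_eq lamtilde_eq .
    show "bdd_below (objective phi c N ` X)" using f_bounded unfolding f_eq .
  qed (rule A1 A2 A3 A4 lhat design B)+
  have lamhat: "lamhat = L.lamhat" unfolding lamhat_eq L.lamhat_def ..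
  have tau: "tau = L.tau" unfolding tau_eq L.tau_def lamhat_eq lamtilde_eq L.lamhat_def L.lamtilde_def ..
  have Delta0: "Delta0 = L.gap z0" unfolding Delta0_eq L.gap_def f_eq ..
  have "0 \<le> lphi * Lc" using L.lphi L.Lc by simp
  then have alpha0_pos: "0 < alpha0" using alpha0 L.rho_pos by linarith
  interpret R: growth_rates alpha0 b r m0 n0
    using alpha0_pos b C(1,2) m0_n0 by unfold_locales auto
  have alpha_ge: "alpha0 \<le> alpha t" for t
  proof -
    have "1 \<le> (real t + 1) powr b" using b by (intro ge_one_powr_ge_zero) auto
    then show ?thesis using alpha0_pos unfolding alpha_eq step_param_def by (simp add: mult_le_cancel_left1)
  qed
  have alpha_gt: "rho + lphi * Lc < alpha t" for t using alpha0 alpha_ge[of t] by linarith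
  have m: "0 < m j t" if "0 \<le> j" for j t
    using R.sample_size_bounds(3)[OF m0_n0(1) that, of t] unfolding m_eq by linarith
  have n: "1 \<le> n k t" if "0 \<le> k" for k t
    using R.sample_size_bounds(3)[OF m0_n0(2) that, of t] unfolding n_eq .
  let ?G = "\<lambda>j k T. guarantee_bound Delta0 rho lphi Lc lhat lamhat tau
      (estimation_error X c N D est) alpha (m j) (n k) T"
  obtain K where K: "0 < K" "\<And>alpha m n T. (\<And>t. alpha0 \<le> alpha t) \<Longrightarrow> (\<And>t. 0 < m t) \<Longrightarrow> (\<And>t. 1 \<le> n t) \<Longrightarrow>
    guarantee_bound (L.gap z0) rho lphi Lc lhat L.lamhat L.tau (estimation_error X c N D est) alpha m n T
      \<le> K * rate_bound r alpha m n T"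
    using L.guarantee_le_rate[OF alpha0 C(3,4), where ?z0.0 = z0] by blast
  have order: "?G j k T \<le> K * rate_bound r alpha (m j) (n k) T" if "0 \<le> j" "0 \<le> k" for j k T
    unfolding Delta0 lamhat tau using alpha_ge m[OF that(1)] n[OF that(2)] by (rule K(2))
  have guarantee: "(\<integral>\<^sup>+\<omega>. ennreal (norm (prox_point X f rho (z (tstar \<omega>) \<omega>) - z (tstar \<omega>) \<omega>)) \<partial>M)
      \<le> ennreal (?G j k T)"
    if "0 \<le> j" "0 \<le> k" and run: "lspl_run M F X phi c N D est alpha (m j) (n k) z0 T W S z"
      and index: "random_index M (F (Suc T)) (\<lambda>t. 1 / (alpha t + rho - tau)) T tstar"
    for j k T and M :: "'w measure" and F W S z tstar
    using L.output_guarantee[OF run z0 alpha_gt m[OF that(1)] n[OF that(2)] index[unfolded tau]]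
    unfolding f_eq Delta0 lamhat tau .
  have stationary: "nearly_stationary M X f nu delta (\<lambda>\<omega>. z (tstar \<omega>) \<omega>)"
    if "0 \<le> j" "0 \<le> k" and run: "lspl_run M F X phi c N D est alpha (m j) (n k) z0 T W S z"
      and index: "random_index M (F (Suc T)) (\<lambda>t. 1 / (alpha t + rho - tau)) T tstar"
      and "0 < nu" "0 < delta" "?G j k T \<le> min delta (nu / rho)"
    for j k T nu delta and M :: "'w measure" and F W S z tstar
    using L.output_nearly_stationary[OF run z0 alpha_gt m[OF that(1)] n[OF that(2)] index[unfolded tau] that(5,6)]
      that(7) unfolding f_eq Delta0 lamhat tau by blast
  have jk: "0 \<le> jstar" "0 \<le> kstar" unfolding jstar_eq kstar_eq using b C by auto
  obtain T :: "real \<Rightarrow> nat" where T: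
    "\<And>x. 0 < x \<Longrightarrow> K * rate_bound r alpha (m jstar) (n kstar) (T x) \<le> x"
    "(\<lambda>x. rate_bound r alpha (m jstar) (n kstar) (T x)) \<in> O[at_right 0](\<lambda>x. x)"
    "(\<lambda>x. real (T x)) \<in> soft_bigo (\<lambda>x. x powr (- (2 / (1 - b))))"
    "(\<lambda>x. real (total_samples (m jstar) (n kstar) (T x))) \<in> soft_bigo (\<lambda>x. x powr (- (2 / (1 - b)) - 1 / r))"
    unfolding alpha_eq m_eq n_eq jstar_eq kstar_eq using R.star_complexity[OF K(1)] by blast
  have T_stationary: "nearly_stationary M X f nu delta (\<lambda>\<omega>. z (tstar \<omega>) \<omega>)"
    if "0 < nu" "0 < delta"
      and "lspl_run M F X phi c N D est alpha (m jstar) (n kstar) z0 (T (min delta (nu / rho))) W S z"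
      and "random_index M (F (Suc (T (min delta (nu / rho))))) (\<lambda>t. 1 / (alpha t + rho - tau))
             (T (min delta (nu / rho))) tstar"
    for nu delta and M :: "'w measure" and F W S z tstar
  proof (rule stationary[OF jk that(3,4,1,2)])
    have "0 < min delta (nu / rho)" using that(1,2) L.rho_pos by simp
    then show "?G jstar kstar (T (min delta (nu / rho))) \<le> min delta (nu / rho)"
      using order[OF jk] T(1) order_trans by blast
  qed
  have lower: "(\<lambda>x. real (total_samples (m j) (n k) (T x))) \<in> \<Omega>[at_right 0](\<lambda>x. x powr (- (2 / (1 - b)) - 1 / r))"
    if "0 \<le> j" "0 \<le> k" "(\<lambda>x. rate_bound r alpha (m j) (n k) (T x)) \<in> O[at_right 0](\<lambda>x. x)"
    for j k and T :: "real \<Rightarrow> nat"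
    using R.total_samples_lower_bound[OF that[unfolded alpha_eq m_eq n_eq]] unfolding m_eq n_eq .
  show ?thesis
  proof (intro conjI)
    show "\<exists>K>0. \<forall>j\<ge>0. \<forall>k\<ge>0. \<forall>T.
        (\<forall>(M::'w measure) F W S z tstar.
           lspl_run M F X phi c N D est alpha (m j) (n k) z0 T W S z \<and>
           random_index M (F (Suc T)) (\<lambda>t. 1 / (alpha t + rho - tau)) T tstar \<longrightarrow>
           (\<integral>\<^sup>+\<omega>. ennreal (norm (prox_point X f rho (z (tstar \<omega>) \<omega>) - z (tstar \<omega>) \<omega>)) \<partial>M)
             \<le> ennreal (?G j k T)) \<and>
        ?G j k T \<le> K * rate_bound r alpha (m j) (n k) T"
      using K(1) order guarantee by blast
  qed (use jk T(2-4) T_stationary lower in blast)+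
qed

end
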